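(* Let $n\ge3$ and $d=2(n-2)$. For every iterated sequence $S$ for $\mathrm{Gr}(2,\mathbb C^n)$ the Newton–Okounkov polytope $\Delta(A_{2,n},\mathfrak v_S)$ has $\binom n2$ vertices, namely the points $\mathfrak v_S(\bar p_{ij})$ for $1\le i<j\le n$. Further, it has no interior lattice points and satisfies $\Delta(A_{2,n},\mathfrak v_S)\subset\mathcal H_d$, where $\mathcal H_d=\mathrm{conv}(\{0,1\}^d)\subset\mathbb R^d_{\ge0}$ is the hypercube. Moreover, if $S_1,S_2$ are two different iterated sequences for $\mathrm{Gr}(2,\mathbb C^n)$ with $\mathtt T_n^{S_1}=\mathtt T_n^{S_2}$, then the polytopes $\Delta(A_{2,n},\mathfrak v_{S_1})$ and $\Delta(A_{2,n},\mathfrak v_{S_2})$ are unimodularly equivalent.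
   Context: Iterated sequences. For $1\le i<j\le n$ let $\varepsilon_i-\varepsilon_j$ be the corresponding positive root of type $\mathtt A_{n-1}$. An iterated sequence for $\mathrm{Gr}(2,\mathbb C^n)$ is a sequence $S=(\beta_1,\dots,\beta_d)=(\varepsilon_{i_n}-\varepsilon_n,\varepsilon_{j_n}-\varepsilon_n,\dots,\varepsilon_{i_3}-\varepsilon_3,\varepsilon_{j_3}-\varepsilon_3)$ with $i_l,j_l\in\{1,\dots,l-1\}$, $i_l\ne j_l$, for $3\le l\le n$. Valuation. For $\beta=\varepsilon_i-\varepsilon_j$ let $f_\beta$ be the elementary $n\times n$ matrix with a $1$ in position $(j,i)$, and let $\psi_S(y)=(\mathbb 1+y_1f_{\beta_1})\cdots(\mathbb 1+y_df_{\beta_d})$. The map $\mathbb A^d\to\mathrm{Gr}(2,\mathbb C^n)$ sending $y$ to the span of the first two columns of $\psi_S(y)$ is birational. Let $\mathrm{ht}(\varepsilon_i-\varepsilon_j)=j-i$, $\Psi(m)=\sum_i m_i\mathrm{ht}(\beta_i)$, and order $\mathbb Z^d$ by $m\prec_\Psi n$ iff $\Psi(m)<\Psi(n)$, or $\Psi(m)=\Psi(n)$ and $m>_{\mathrm{lex}}n$. For $0\ne g=\sum a_uy^u\in\mathbb C[y_1,\dots,y_d]$ let $\mathfrak v_S(g)=\min_{\prec_\Psi}\{u\mid a_u\ne0\}$. Let $A_{2,n}=\mathbb C[p_{ij}\mid i<j]/\mathcal I_{2,n}=\bigoplus_{m\ge0}A_m$ be the homogeneous coordinate ring of $\mathrm{Gr}(2,\mathbb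 C^n)$ in its Plücker embedding ($\mathcal I_{2,n}$ the Plücker ideal, $\bar p_{ij}$ the class of $p_{ij}$). For nonzero homogeneous $f\in A_{2,n}$ let $\mathfrak v_S(f)=\mathfrak v_S(\psi_S^*(f))$, where $\psi_S^*(f)$ is obtained by substituting for each $\bar p_{ij}$ the $2\times2$ minor of $\psi_S(y)$ on rows $i,j$ and columns $1,2$. Newton–Okounkov body: $\Delta(A_{2,n},\mathfrak v_S)=\overline{\mathrm{conv}\big(\bigcup_{m>0}\{\mathfrak v_S(f)/m\mid0\ne f\in A_m\}\big)}\subset\mathbb R^d$. Trees. Let $T_3^S$ be the tree with one internal vertex and leaves labeled $1,2,3$; for $4\le l\le n$ let $T_l^S$ be obtained from $T_{l-1}^S$ by replacing the edge with leaf $i_l$ by three edges forming a cherry with leaves $i_l$ and $l$ (subdivide the edge at leaf $i_l$ and attach a new leaf $l$ at the new vertex). $\mathtt T_n^S$ is the unlabeled trivalent tree underlying $T_n^S$; equality of unlabeled trees means isomorphism of graphs. Two polytopes $P,Q\subset\mathbb R^d$ are unimodularly equivalent if there exist $M\in GL_d(\mathbb Z)$ and $w\in\mathbb Z^d$ with $Q=\{xM+w\mid x\in P\}$. *)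

theory Defs
  imports
    "HOL-Analysis.Analysis"
    "HOL-Library.Poly_Mapping"
    "HOL-Algebra.QuotRing"
    "Jordan_Normal_Form.Matrix"
begin

no_notation Matrix.vec_index (infixl \<open>$\<close> 100)

section \<open>Multivariate polynomials\<close>

text \<open>Polynomials are finitely supported functions on exponent vectors, with the convolution product
  of \<^theory>\<open>HOL-Library.Poly_Mapping\<close>.\<close>

type_synonym ('v, 'a) mpoly = "('v \<Rightarrow>\<^sub>0 nat) \<Rightarrow>\<^sub>0 'a"

definition const_poly :: "'a::zero \<Rightarrow> ('v, 'a) mpoly" where
  "const_poly c = Poly_Mapping.single 0 c"

definition var_poly :: "'v \<Rightarrow> ('v, 'a::zero_neq_one) mpoly" where
  "var_poly x = Poly_Mapping.single (Poly_Mapping.single x 1) 1"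

definition subst_poly ::
    "('a::zero \<Rightarrow> 'b::comm_ring_1) \<Rightarrow> ('v \<Rightarrow> 'b) \<Rightarrow> ('v, 'a) mpoly \<Rightarrow> 'b" where
  "subst_poly h s F =
     (\<Sum>u\<in>Poly_Mapping.keys F. h (Poly_Mapping.lookup F u) *
        (\<Prod>x\<in>Poly_Mapping.keys u. s x ^ Poly_Mapping.lookup u x))"

definition homogeneous_poly :: "nat \<Rightarrow> ('v, 'a::zero) mpoly \<Rightarrow> bool" where
  "homogeneous_poly m F \<longleftrightarrow>
     (\<forall>u\<in>Poly_Mapping.keys F. (\<Sum>x\<in>Poly_Mapping.keys u. Poly_Mapping.lookup u x) = m)"


section \<open>The homogeneous coordinate ring of $\mathrm{Gr}(2,\mathbb C^n)$\<close>

type_synonym plucker_poly = "(nat \<times> nat, complex) mpoly"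

definition plucker_indices :: "nat \<Rightarrow> (nat \<times> nat) set" where
  "plucker_indices n = {(i, j). 1 \<le> i \<and> i < j \<and> j \<le> n}"

definition plucker_poly_ring :: "nat \<Rightarrow> plucker_poly ring" where
  "plucker_poly_ring n =
     \<lparr>carrier = {F. \<forall>u\<in>Poly_Mapping.keys F. Poly_Mapping.keys u \<subseteq> plucker_indices n},
      mult = (*), one = 1, zero = 0, add = (+)\<rparr>"

text \<open>The vectors \<open>a\<close> and \<open>b\<close> are the columns of an \<open>n \<times> 2\<close> matrix (only the entries \<open>1, \<dots>, n\<close>
  matter). The ideal consists of all polynomials vanishing at the Pluecker vectors of such matrices,
  i.e. on the affine cone over the embedded Grassmannian.\<close>

definition plucker_ideal :: "nat \<Rightarrow> plucker_poly set" where
  "plucker_ideal n = {F \<in> carrier (plucker_poly_ring n).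
     \<forall>a b :: nat \<Rightarrow> complex. subst_poly (\<lambda>c. c) (\<lambda>(i, j). a i * b j - a j * b i) F = 0}"

definition coord_ring :: "nat \<Rightarrow> plucker_poly set ring" where
  "coord_ring n = plucker_poly_ring n Quot plucker_ideal n"

definition coord_class :: "nat \<Rightarrow> plucker_poly \<Rightarrow> plucker_poly set" where
  "coord_class n F = plucker_ideal n +>\<^bsub>plucker_poly_ring n\<^esub> F"

definition graded_piece :: "nat \<Rightarrow> nat \<Rightarrow> plucker_poly set set" where
  "graded_piece n m =
     coord_class n ` {F \<in> carrier (plucker_poly_ring n). homogeneous_poly m F}"

definition plucker_coord :: "nat \<Rightarrow> nat \<Rightarrow> nat \<Rightarrow> plucker_poly set" where
  "plucker_coord n i j = coord_class n (var_poly (i, j))"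


section \<open>Iterated sequences\<close>

text \<open>The pair \<open>(i, j)\<close> stands for the positive root $\varepsilon_i - \varepsilon_j$.\<close>

type_synonym root = "nat \<times> nat"

definition iterated_sequence :: "nat \<Rightarrow> root list \<Rightarrow> bool" where
  "iterated_sequence n S \<longleftrightarrow>
     (\<exists>i j :: nat \<Rightarrow> nat.
        (\<forall>l\<in>{3..n}. i l \<in> {1..l-1} \<and> j l \<in> {1..l-1} \<and> i l \<noteq> j l) \<and>
        S = concat (map (\<lambda>l. [(i l, l), (j l, l)]) (rev [3..<Suc n])))"

definition height :: "root \<Rightarrow> int" where
  "height = (\<lambda>(i, j). int j - int i)"

text \<open>The coordinates of $\mathbb R^d$ and the variables $y_1, \dots, y_d$ are indexed by a finite
  linearly ordered type with \<open>d\<close> elements; the \<open>k\<close>-th root is the one at the (0-based) position of \<open>k\<close>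
  in that order.\<close>

definition root_at :: "root list \<Rightarrow> 'd::{finite,linorder} \<Rightarrow> root" where
  "root_at S k = S ! card {..<k}"


section \<open>The valuation\<close>

text \<open>Matrix entries are indexed from 0, whereas roots and Pluecker coordinates use the labels
  \<open>1, \<dots>, n\<close>.\<close>

definition root_matrix :: "nat \<Rightarrow> root \<Rightarrow> 'a::zero_neq_one mat" where
  "root_matrix n = (\<lambda>(i, j). mat n n (\<lambda>(r, c). if r = j - 1 \<and> c = i - 1 then 1 else 0))"

definition psi :: "nat \<Rightarrow> root list \<Rightarrow> ('d::{finite,linorder}, complex) mpoly mat" where
  "psi n S = foldr (*)
     (map (\<lambda>k. 1\<^sub>m n + var_poly k \<cdot>\<^sub>m root_matrix n (root_at S k)) (sorted_list_of_set UNIV))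
     (1\<^sub>m n)"

definition psi_minor ::
    "nat \<Rightarrow> root list \<Rightarrow> nat \<times> nat \<Rightarrow> ('d::{finite,linorder}, complex) mpoly" where
  "psi_minor n S = (\<lambda>(i, j).
     psi n S $$ (i - 1, 0) * psi n S $$ (j - 1, 1) - psi n S $$ (i - 1, 1) * psi n S $$ (j - 1, 0))"

text \<open>The substitution takes the same value on all representatives of a class.\<close>

definition psi_pullback ::
    "root list \<Rightarrow> nat \<Rightarrow> plucker_poly set \<Rightarrow> ('d::{finite,linorder}, complex) mpoly" where
  "psi_pullback S n f = the_elem (subst_poly const_poly (psi_minor n S) ` f)"

definition root_weight :: "root list \<Rightarrow> int ^ 'd::{finite,linorder} \<Rightarrow> int" where
  "root_weight S m = (\<Sum>k\<in>UNIV. m $ k * height (root_at S k))"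

definition lex_greater :: "int ^ 'd::{finite,linorder} \<Rightarrow> int ^ 'd::{finite,linorder} \<Rightarrow> bool" where
  "lex_greater m m' \<longleftrightarrow> (\<exists>k. m $ k > m' $ k \<and> (\<forall>k'<k. m $ k' = m' $ k'))"

definition prec :: "root list \<Rightarrow> int ^ 'd::{finite,linorder} \<Rightarrow> int ^ 'd::{finite,linorder} \<Rightarrow> bool" where
  "prec S m m' \<longleftrightarrow> root_weight S m < root_weight S m' \<or>
     root_weight S m = root_weight S m' \<and> lex_greater m m'"

definition exponents :: "('d::{finite,linorder}, 'a::zero) mpoly \<Rightarrow> (int ^ 'd::{finite,linorder}) set" where
  "exponents g = (\<lambda>u. \<chi> k. int (Poly_Mapping.lookup u k)) ` Poly_Mapping.keys g"

definition poly_valuation ::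
    "root list \<Rightarrow> ('d::{finite,linorder}, complex) mpoly \<Rightarrow> int ^ 'd::{finite,linorder}" where
  "poly_valuation S g =
     (THE u. u \<in> exponents g \<and> (\<forall>u'\<in>exponents g. u' \<noteq> u \<longrightarrow> prec S u u'))"

definition valuation ::
    "nat \<Rightarrow> root list \<Rightarrow> plucker_poly set \<Rightarrow> int ^ 'd::{finite,linorder}" where
  "valuation n S f = poly_valuation S (psi_pullback S n f)"


section \<open>The Newton--Okounkov body\<close>

definition real_vec :: "int ^ 'd \<Rightarrow> real ^ 'd" where
  "real_vec m = (\<chi> k. of_int (m $ k))"

definition newton_okounkov_body :: "nat \<Rightarrow> root list \<Rightarrow> (real ^ 'd::{finite,linorder}) set" where
  "newton_okounkov_body n S = closure (convex hull
     (\<Union>m\<in>{0<..}. {(1 / real m) *\<^sub>R real_vec (valuation n S f) | f.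
        f \<in> graded_piece n m \<and> f \<noteq> \<zero>\<^bsub>coord_ring n\<^esub>}))"

definition lattice_points :: "(real ^ 'd) set" where
  "lattice_points = range real_vec"

definition hypercube :: "(real ^ 'd) set" where
  "hypercube = convex hull {x. \<forall>k. x $ k \<in> {0, 1}}"

definition unimodularly_equivalent :: "(real ^ 'd) set \<Rightarrow> (real ^ 'd) set \<Rightarrow> bool" where
  "unimodularly_equivalent P Q \<longleftrightarrow>
     (\<exists>(M :: int ^ 'd ^ 'd) (w :: int ^ 'd). invertible M \<and>
        Q = (\<lambda>x. x v* (\<chi> i j. of_int (M $ i $ j)) + real_vec w) ` P)"


section \<open>The trees\<close>

datatype node = Leaf nat | Inner nat

text \<open>A graph is given by its vertices and its edges, the latter being two-element sets.\<close>

type_synonym 'v graph = "'v set \<times> 'v set set"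

definition graph_isomorphic :: "'v graph \<Rightarrow> 'w graph \<Rightarrow> bool" where
  "graph_isomorphic G H \<longleftrightarrow> (\<exists>f. bij_betw f (fst G) (fst H) \<and> (\<lambda>e. f ` e) ` snd G = snd H)"

definition tripod :: "node graph" where
  "tripod = ({Inner 3, Leaf 1, Leaf 2, Leaf 3}, {{Inner 3, Leaf k} | k. k \<in> {1, 2, 3}})"

definition attach_leaf :: "nat \<Rightarrow> nat \<Rightarrow> node graph \<Rightarrow> node graph" where
  "attach_leaf i l = (\<lambda>(V, E).
     (V \<union> {Inner l, Leaf l},
      {e \<in> E. Leaf i \<notin> e} \<union> {insert (Inner l) (e - {Leaf i}) | e. e \<in> E \<and> Leaf i \<in> e}
        \<union> {{Inner l, Leaf i}, {Inner l, Leaf l}}))"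

text \<open>For an iterated sequence, the root $\varepsilon_{i_l} - \varepsilon_l$ is at the 0-based position
  \<open>2 * (n - l)\<close>.\<close>

definition cherry_leaf :: "nat \<Rightarrow> root list \<Rightarrow> nat \<Rightarrow> nat" where
  "cherry_leaf n S l = fst (S ! (2 * (n - l)))"

text \<open>\<open>tree_aux n S k\<close> is the tree with \<open>k + 3\<close> leaves.\<close>

primrec tree_aux :: "nat \<Rightarrow> root list \<Rightarrow> nat \<Rightarrow> node graph" where
  "tree_aux n S 0 = tripod"
| "tree_aux n S (Suc k) = attach_leaf (cherry_leaf n S (k + 4)) (k + 4) (tree_aux n S k)"

definition sequence_tree :: "nat \<Rightarrow> root list \<Rightarrow> node graph" where
  "sequence_tree n S = tree_aux n S (n - 3)"

end

theory Submission
  imports Defs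
begin

text \<open>Let \<open>v\<^sub>l\<close> be the \<open>l\<close>-th row of the first two columns of \<open>\<psi>\<^sub>S(y)\<close>. Reading the matrix product row by
  row gives \<open>v\<^sub>1 = (1, 0)\<close>, \<open>v\<^sub>2 = (0, 1)\<close> and \<open>v\<^sub>l = y\<^sub>l v\<^sub>a + z\<^sub>l v\<^sub>b\<close> with \<open>a = i\<^sub>l\<close>, \<open>b = j\<^sub>l\<close>, where \<open>y\<^sub>l\<close> and
  \<open>z\<^sub>l\<close> are the variables of the two roots that end at \<open>l\<close>. The Pluecker coordinate \<open>p\<^sub>k\<^sub>l\<close> becomes the bracket
  \<open>[k l] = det(v\<^sub>k, v\<^sub>l)\<close>, and \<open>[k l] = y\<^sub>l [k a] + z\<^sub>l [k b]\<close>. All exponents of a bracket have the same weight \<open>\<Psi>\<close>,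
  so its valuation is its lexicographically largest exponent. As \<open>y\<^sub>l\<close>, \<open>z\<^sub>l\<close> precede all variables of
  smaller index, the valuation satisfies \<open>v(k l) = y\<^sub>l + v(k a)\<close> for \<open>k \<noteq> a\<close> and \<open>v(a l) = z\<^sub>l + v(a b)\<close>
  (variables standing for unit vectors). Consequently the values of the Pluecker coordinates are
  distinct 0/1 vectors (\<open>val_le_1\<close>, \<open>val_inj\<close>), and any set of vertices of the cube is the set of
  extreme points of its convex hull. The interior of the cube contains no lattice point.

  The substance is that the convex hull of these values is the whole body: the valuation of an
  element of degree \<open>m\<close> is a sum of \<open>m\<close> values \<open>v(i j)\<close> (\<open>lead_bspan\<close>, \<open>valuation_graded_piece\<close>). Let \<open>f\<close> be
  a nonzero multihomogeneous polynomial in the brackets of \<open>v\<^sub>1, \<dots>, v\<^sub>l\<close>, of degree \<open>e\<close> in \<open>v\<^sub>l\<close>. If \<open>f\<close>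
  does not vanish identically after setting \<open>v\<^sub>l := v\<^sub>a\<close>, then the result is the coefficient of \<open>y\<^sub>l ^ e\<close>; it involves
  one vector less, and in a decomposition of its leading exponent one may replace \<open>e\<close> of the pairs
  \<open>{k, a}\<close> by \<open>{k, l}\<close>. If it does vanish, then \<open>f\<close> is \<open>[a l]\<close> times a polynomial in the
  brackets (\<open>bracket_divisibility\<close>), and the factor contributes \<open>v(a l)\<close>. Divisibility is proved by polarization: modulo
  \<open>[a l]\<close> the Pluecker relation makes \<open>v\<^sub>a\<close> and \<open>v\<^sub>l\<close> interchangeable, so polarizing \<open>f\<close> restricted to
  \<open>v\<^sub>l = v\<^sub>a\<close> back to its multidegree returns a nonzero multiple of \<open>f\<close>. An arbitrary element of degree
  \<open>m\<close> is a sum of multihomogeneous ones, and these have disjoint sets of exponents, because the torus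
  weight of an exponent determines the multidegree.

  For the unimodular equivalence, the recursion for \<open>v\<close> says that \<open>v(k l) - v(k a)\<close> is the same for
  all \<open>k < l\<close> other than \<open>a\<close>. A function of pairs of leaves has this property if and only if
  \<open>\<delta>(i k) + \<delta>(j k') = \<delta>(i k') + \<delta>(j k)\<close> whenever the tree separates \<open>{i, j}\<close> from \<open>{k, k'}\<close>
  (\<open>tree_like_quartet\<close>, \<open>tree_likeI_quartet\<close>), a condition that is invariant under isomorphisms. Every
  function with this property is an integral affine function of \<open>v\<close> (\<open>tree_like_affine\<close>): its matrix can
  be read off because all unit vectors are differences of values of \<open>v\<close>. An isomorphism of trees thus
  gives integral affine maps in both directions between the values of the Pluecker coordinates, and
  for the same reason their matrices are inverse to each other.\<close>

abbreviation keys :: "('a \<Rightarrow>\<^sub>0 'b::zero) \<Rightarrow> 'a set" where "keys \<equiv> Poly_Mapping.keys"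
abbreviation lookup :: "('a \<Rightarrow>\<^sub>0 'b::zero) \<Rightarrow> 'a \<Rightarrow> 'b" where "lookup \<equiv> Poly_Mapping.lookup"
abbreviation single :: "'a \<Rightarrow> 'b \<Rightarrow> 'a \<Rightarrow>\<^sub>0 'b::zero" where "single \<equiv> Poly_Mapping.single"

section \<open>Leading exponents\<close>

text \<open>The order on exponents is the lexicographic one in which the smallest variable counts most.\<close>

lemma less_exponent_iff:
  fixes u v :: "'v::linorder \<Rightarrow>\<^sub>0 nat"
  shows "u < v \<longleftrightarrow> (\<exists>k. lookup u k < lookup v k \<and> (\<forall>k'<k. lookup u k' = lookup v k'))"
  by (simp add: less_poly_mapping.rep_eq less_fun_def)

definition lead :: "('v::linorder, 'a::zero) mpoly \<Rightarrow> ('v \<Rightarrow>\<^sub>0 nat)" where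
  "lead P = Max (keys P)"

lemma lead_in_keys: "P \<noteq> 0 \<Longrightarrow> lead P \<in> keys P"
  unfolding lead_def by (rule Max_in) (auto simp: poly_mapping_eq_iff fun_eq_iff in_keys_iff)

lemma lead_ge: "u \<in> keys P \<Longrightarrow> u \<le> lead P"
  unfolding lead_def by simp

lemma lead_eqI: "u \<in> keys P \<Longrightarrow> (\<And>w. w \<in> keys P \<Longrightarrow> w \<le> u) \<Longrightarrow> lead P = u"
  unfolding lead_def by (rule Max_eqI) auto

lemma lead_add:
  fixes P Q :: "('v::linorder, 'a::comm_monoid_add) mpoly"
  assumes "P \<noteq> 0" "\<And>u. u \<in> keys Q \<Longrightarrow> u < lead P"
  shows "P + Q \<noteq> 0" "lead (P + Q) = lead P"
proof -
  have "lead P \<notin> keys Q" using assms(2) by blast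
  then have *: "lead P \<in> keys (P + Q)"
    using lead_in_keys[OF assms(1)] by (simp add: in_keys_iff lookup_add)
  then show "P + Q \<noteq> 0" by auto
  show "lead (P + Q) = lead P"
  proof (rule lead_eqI[OF *])
    fix w assume "w \<in> keys (P + Q)"
    then have "w \<in> keys P \<or> w \<in> keys Q" using Poly_Mapping.keys_add[of P Q] by blast
    then show "w \<le> lead P" using lead_ge[of w P] assms(2)[of w] by auto
  qed
qed

lemma lead_single: "c \<noteq> 0 \<Longrightarrow> lead (single u c) = u"
  by (simp add: lead_def)

lemma lead_uminus: "lead (- P :: ('v::linorder, 'a::ab_group_add) mpoly) = lead P"
proof -
  have "keys (- P) = keys P" by (auto simp: in_keys_iff)
  then show ?thesis by (simp add: lead_def)
qed

lemma lead_one: "lead (1 :: ('v::linorder, 'a::comm_ring_1) mpoly) = 0"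
  using lead_single[of "1::'a" "0 :: 'v \<Rightarrow>\<^sub>0 nat"] by simp

text \<open>Both factors are split into leading term and rest. All products other than that of the two leading
  terms have strictly smaller exponents, and the leading coefficients multiply to a nonzero element.\<close>

lemma lead_mult:
  fixes P Q :: "('v::linorder, 'a::idom) mpoly"
  assumes "P \<noteq> 0" "Q \<noteq> 0"
  shows "lead (P * Q) = lead P + lead Q"
proof -
  define A where "A = single (lead P) (lookup P (lead P))"
  define B where "B = single (lead Q) (lookup Q (lead Q))"
  have P: "lookup P (lead P) \<noteq> 0" and Q: "lookup Q (lead Q) \<noteq> 0"
    using lead_in_keys assms by (auto simp: in_keys_iff)
  have lower: "u < lead R" if "u \<in> keys (R - single (lead R) (lookup R (lead R)))"
    for R :: "('v, 'a) mpoly" and u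
  proof -
    have "u \<noteq> lead R" "u \<in> keys R"
      using that by (auto simp: in_keys_iff lookup_minus lookup_single when_def split: if_splits)
    then show ?thesis using lead_ge[of u R] by simp
  qed
  have A0: "A \<noteq> 0" and B0: "B \<noteq> 0" and lA: "lead A = lead P" and lB: "lead B = lead Q"
    using P Q by (auto simp: A_def B_def lead_single dest: arg_cong[where f=keys])
  have AB: "A * B = single (lead P + lead Q) (lookup P (lead P) * lookup Q (lead Q))"
    by (simp add: A_def B_def mult_single)
  have lAB: "A * B \<noteq> 0" "lead (A * B) = lead P + lead Q"
    using A0 B0 P Q lead_single[of "lookup P (lead P) * lookup Q (lead Q)"] by (simp, simp add: AB)
  have "P * Q = A * B + (A * (Q - B) + (P - A) * Q)" by (simp add: algebra_simps)
  moreover have "lead (A * B + (A * (Q - B) + (P - A) * Q)) = lead (A * B)"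
  proof (rule lead_add(2)[OF lAB(1)])
    fix u assume "u \<in> keys (A * (Q - B) + (P - A) * Q)"
    then consider "u \<in> keys (A * (Q - B))" | "u \<in> keys ((P - A) * Q)"
      using Poly_Mapping.keys_add[of "A * (Q - B)" "(P - A) * Q"] by blast
    then show "u < lead (A * B)"
    proof cases
      case 1
      then obtain a b where "u = a + b" "a \<in> keys A" "b \<in> keys (Q - B)" using keys_mult by blast
      moreover have "a \<le> lead P" using lead_ge[OF \<open>a \<in> keys A\<close>] lA by simp
      moreover have "b < lead Q" using lower[of b Q] \<open>b \<in> keys (Q - B)\<close> by (simp add: B_def)
      ultimately show ?thesis using lAB(2) by (simp add: add_le_less_mono)
    next
      case 2
      then obtain a b where "u = a + b" "a \<in> keys (P - A)" "b \<in> keys Q" using keys_mult by blast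
      moreover have "b \<le> lead Q" using lead_ge[OF \<open>b \<in> keys Q\<close>] by simp
      moreover have "a < lead P" using lower[of a P] \<open>a \<in> keys (P - A)\<close> by (simp add: A_def)
      ultimately show ?thesis using lAB(2) by (simp add: add_less_le_mono)
    qed
  qed
  ultimately show ?thesis using lAB(2) by simp
qed

lemma var_poly_neq_0: "var_poly k \<noteq> (0 :: ('v, 'a::zero_neq_one) mpoly)"
  unfolding var_poly_def by (metis keys_single keys_zero insert_not_empty zero_neq_one)

lemma lead_var_poly: "lead (var_poly k :: ('v::linorder, 'a::zero_neq_one) mpoly) = single k 1"
  by (simp add: var_poly_def lead_single)

lemma keys_multE:
  assumes "u \<in> keys (P * Q)"
  obtains a b where "u = a + b" "a \<in> keys P" "b \<in> keys Q"
  using assms keys_mult by blast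

section \<open>Substitution\<close>

definition subst_mon :: "('v \<Rightarrow> 'b::comm_ring_1) \<Rightarrow> ('v \<Rightarrow>\<^sub>0 nat) \<Rightarrow> 'b" where
  "subst_mon s u = (\<Prod>x\<in>keys u. s x ^ lookup u x)"

lemma subst_mon_superset:
  assumes "finite A" "keys u \<subseteq> A"
  shows "subst_mon s u = (\<Prod>x\<in>A. s x ^ lookup u x)"
  unfolding subst_mon_def by (rule prod.mono_neutral_left) (use assms in \<open>auto simp: in_keys_iff\<close>)

lemma subst_mon_add: "subst_mon s (u + w) = subst_mon s u * subst_mon s w"
proof -
  let ?A = "keys u \<union> keys w"
  have "subst_mon s (u + w) = (\<Prod>x\<in>?A. s x ^ lookup (u + w) x)"
    by (rule subst_mon_superset) (use Poly_Mapping.keys_add[of u w] in auto)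
  also have "\<dots> = (\<Prod>x\<in>?A. s x ^ lookup u x) * (\<Prod>x\<in>?A. s x ^ lookup w x)"
    by (simp add: lookup_add power_add prod.distrib)
  also have "\<dots> = subst_mon s u * subst_mon s w"
    by (subst (1 2) subst_mon_superset[where A="?A"]) auto
  finally show ?thesis .
qed

lemma subst_poly_superset:
  assumes "finite A" "keys F \<subseteq> A" "h 0 = 0"
  shows "subst_poly h s F = (\<Sum>u\<in>A. h (lookup F u) * subst_mon s u)"
  unfolding subst_poly_def subst_mon_def
  by (rule sum.mono_neutral_left) (use assms in \<open>auto simp: in_keys_iff\<close>)

lemma mpoly_sum_terms: "P = (\<Sum>u\<in>keys P. single u (lookup P u))"
  by (rule poly_mapping_eqI) (auto simp: lookup_sum lookup_single when_def in_keys_iff)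

locale coefficient_hom =
  fixes h :: "'a::comm_ring_1 \<Rightarrow> 'b::comm_ring_1"
  assumes hom_add: "h (x + y) = h x + h y"
    and hom_mult: "h (x * y) = h x * h y"
    and hom_one: "h 1 = 1"
begin

lemma hom_zero: "h 0 = 0"
  using hom_add[of 0 0] by simp

lemma hom_uminus: "h (- x) = - h x"
  using hom_add[of x "- x"] hom_zero by (simp add: eq_neg_iff_add_eq_0 add.commute)

lemma subst_add: "subst_poly h s (F + G) = subst_poly h s F + subst_poly h s G"
proof -
  let ?A = "keys F \<union> keys G"
  have "subst_poly h s (F + G) = (\<Sum>u\<in>?A. h (lookup (F + G) u) * subst_mon s u)"
    by (rule subst_poly_superset) (use Poly_Mapping.keys_add[of F G] in \<open>auto simp: hom_zero\<close>)
  also have "\<dots> = (\<Sum>u\<in>?A. h (lookup F u) * subst_mon s u) + (\<Sum>u\<in>?A. h (lookup G u) * subst_mon s u)"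
    by (simp add: lookup_add hom_add distrib_right sum.distrib)
  also have "\<dots> = subst_poly h s F + subst_poly h s G"
    by (subst (1 2) subst_poly_superset[where A="?A"]) (auto simp: hom_zero)
  finally show ?thesis .
qed

lemma subst_zero: "subst_poly h s 0 = 0"
  by (simp add: subst_poly_def)

lemma subst_single: "subst_poly h s (single u c) = h c * subst_mon s u"
  by (subst subst_poly_superset[where A="{u}"]) (auto simp: hom_zero)

lemma subst_sum: "subst_poly h s (\<Sum>i\<in>A. F i) = (\<Sum>i\<in>A. subst_poly h s (F i))"
  by (induction A rule: infinite_finite_induct) (auto simp: subst_zero subst_add)

lemma subst_mult: "subst_poly h s (F * G) = subst_poly h s F * subst_poly h s G"
proof -
  have "subst_poly h s (F * G) =
    subst_poly h s ((\<Sum>u\<in>keys F. single u (lookup F u)) * (\<Sum>w\<in>keys G. single w (lookup G w)))"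
    using mpoly_sum_terms[of F] mpoly_sum_terms[of G] by simp
  also have "\<dots> = (\<Sum>u\<in>keys F. \<Sum>w\<in>keys G.
      (h (lookup F u) * subst_mon s u) * (h (lookup G w) * subst_mon s w))"
    by (simp add: sum_product mult_single subst_sum subst_single hom_mult subst_mon_add algebra_simps)
  also have "\<dots> = subst_poly h s F * subst_poly h s G"
    by (simp add: sum_product[symmetric] subst_poly_def subst_mon_def)
  finally show ?thesis .
qed

lemma subst_one: "subst_poly h s 1 = 1"
  using subst_single[of s 0 1] by (simp add: hom_one subst_mon_def)

lemma subst_uminus: "subst_poly h s (- F) = - subst_poly h s F"
  using subst_add[of s F "- F"] subst_zero[of s] by (simp add: eq_neg_iff_add_eq_0 add.commute)

lemma subst_diff: "subst_poly h s (F - G) = subst_poly h s F - subst_poly h s G"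
  using subst_add[of s F "- G"] by (simp add: subst_uminus)

lemma subst_power: "subst_poly h s (F ^ e) = subst_poly h s F ^ e"
  by (induction e) (auto simp: subst_one subst_mult)

lemma subst_prod: "subst_poly h s (\<Prod>i\<in>A. F i) = (\<Prod>i\<in>A. subst_poly h s (F i))"
  by (induction A rule: infinite_finite_induct) (auto simp: subst_one subst_mult)

lemma subst_var: "subst_poly h s (var_poly x) = s x"
  unfolding var_poly_def by (subst subst_single) (simp add: hom_one subst_mon_def)

lemma subst_const: "subst_poly h s (const_poly c) = h c"
  unfolding const_poly_def by (subst subst_single) (simp add: subst_mon_def)

end

lemma const_poly_hom: "coefficient_hom (const_poly :: 'a::comm_ring_1 \<Rightarrow> ('v, 'a) mpoly)"
  by unfold_locales (auto simp: const_poly_def single_add mult_single)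

lemma id_hom: "coefficient_hom (\<lambda>c :: 'a::comm_ring_1. c)"
  by unfold_locales auto

lemma eval_subst_poly:
  fixes s :: "'w \<Rightarrow> ('v, 'a::comm_ring_1) mpoly"
  shows "subst_poly (\<lambda>c. c) y (subst_poly const_poly s F)
    = subst_poly (\<lambda>c. c) (\<lambda>x. subst_poly (\<lambda>c. c) y (s x)) F"
proof -
  interpret coefficient_hom "\<lambda>c :: 'a. c" by (rule id_hom)
  show ?thesis
    unfolding subst_poly_def[of const_poly] subst_poly_def[of "\<lambda>c. c" _ F]
    by (simp add: subst_sum subst_mult subst_const subst_prod subst_power)
qed

text \<open>Uniqueness of digits in base \<open>N\<close>.\<close>

lemma base_digits_unique:
  fixes a b :: "nat \<Rightarrow> nat"
  assumes "\<And>i. i < m \<Longrightarrow> a i < N" "\<And>i. i < m \<Longrightarrow> b i < N"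
    and "(\<Sum>i<m. a i * N ^ i) = (\<Sum>i<m. b i * N ^ i)" "i < m"
  shows "a i = b i"
  using assms
proof (induction m arbitrary: i)
  case (Suc m)
  have less: "(\<Sum>i<m. c i * N ^ i) < N ^ m" if "\<And>i. i < Suc m \<Longrightarrow> c i < N" for c :: "nat \<Rightarrow> nat"
    using that
  proof (induction m)
    case (Suc k)
    have "c k + 1 \<le> N" using Suc.prems[of k] by simp
    then have "(c k + 1) * N ^ k \<le> N * N ^ k" by (rule mult_le_mono1)
    moreover have "(\<Sum>i<k. c i * N ^ i) < N ^ k" using Suc by simp
    ultimately show ?case by simp
  qed simp
  have N: "N ^ m > 0" using Suc.prems(1)[of m] by simp
  have eq: "(\<Sum>i<m. a i * N ^ i) + a m * N ^ m = (\<Sum>i<m. b i * N ^ i) + b m * N ^ m"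
    using Suc.prems(3) by simp
  have la: "(\<Sum>i<m. a i * N ^ i) < N ^ m" and lb: "(\<Sum>i<m. b i * N ^ i) < N ^ m"
    using less[of a] less[of b] Suc.prems(1,2) by blast+
  have "a m = ((\<Sum>i<m. a i * N ^ i) + a m * N ^ m) div N ^ m" using la N by simp
  also have "\<dots> = b m" unfolding eq using lb N by simp
  finally have m: "a m = b m" .
  with eq have "(\<Sum>i<m. a i * N ^ i) = (\<Sum>i<m. b i * N ^ i)" by simp
  with Suc.IH[of i] Suc.prems m show ?case by (cases "i = m") auto
qed simp

text \<open>Kronecker substitution: setting the \<open>k\<close>-th variable to \<open>\<tau> ^ (N ^ k)\<close> sends distinct exponents with
  entries below \<open>N\<close> to distinct powers of \<open>\<tau>\<close>, so the question is reduced to one variable. This is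
  what makes the pullback of a Pluecker polynomial independent of its representative, since the
  ideal is defined by vanishing at complex points.\<close>

lemma mpoly_eq_0_if_vanishing:
  fixes G :: "('d::finite, 'a::{idom,ring_char_0}) mpoly"
  assumes "\<And>y. subst_poly (\<lambda>c. c) y G = 0"
  shows "G = 0"
proof (rule ccontr)
  assume "G \<noteq> 0"
  obtain e :: "'d \<Rightarrow> nat" where e: "bij_betw e UNIV {..<CARD('d)}"
    using ex_bij_betw_finite_nat[of "UNIV :: 'd set"] by (auto simp: atLeast0LessThan)
  define N where "N = Suc (\<Sum>u\<in>keys G. \<Sum>k\<in>UNIV. lookup u k)"
  have N: "lookup u k < N" if "u \<in> keys G" for u k
  proof -
    have "lookup u k \<le> (\<Sum>k\<in>UNIV. lookup u k)" by (rule member_le_sum) auto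
    also have "\<dots> \<le> (\<Sum>u\<in>keys G. \<Sum>k\<in>UNIV. lookup u k)" by (rule member_le_sum[OF that]) auto
    finally show ?thesis by (simp add: N_def)
  qed
  define \<kappa> where "\<kappa> u = (\<Sum>k\<in>UNIV. lookup u k * N ^ e k)" for u :: "'d \<Rightarrow>\<^sub>0 nat"
  have inj: "u = w" if "u \<in> keys G" "w \<in> keys G" "\<kappa> u = \<kappa> w" for u w
  proof (rule poly_mapping_eqI)
    fix k
    let ?f = "inv_into UNIV e"
    have f: "?f (e k) = k" for k using e by (simp add: bij_betw_def)
    have \<kappa>: "\<kappa> x = (\<Sum>i<CARD('d). lookup x (?f i) * N ^ i)" for x
      using sum.reindex_bij_betw[OF e, of "\<lambda>i. lookup x (?f i) * N ^ i"] by (simp add: \<kappa>_def f)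
    have "lookup u (?f (e k)) = lookup w (?f (e k))"
      by (rule base_digits_unique[of "CARD('d)" "\<lambda>i. lookup u (?f i)" N "\<lambda>i. lookup w (?f i)"])
        (use N that \<kappa> e in \<open>auto simp: bij_betw_def\<close>)
    then show "lookup u k = lookup w k" by (simp add: f)
  qed
  define p where "p = (\<Sum>u\<in>keys G. Polynomial.monom (lookup G u) (\<kappa> u))"
  have "poly p \<tau> = 0" for \<tau>
  proof -
    have "poly p \<tau> = (\<Sum>u\<in>keys G. lookup G u * subst_mon (\<lambda>k. \<tau> ^ (N ^ e k)) u)"
      unfolding p_def poly_sum
      by (intro sum.cong refl)
        (simp add: poly_monom subst_mon_superset[of UNIV] \<kappa>_def power_sum power_mult[symmetric] mult.commute)
    also have "\<dots> = subst_poly (\<lambda>c. c) (\<lambda>k. \<tau> ^ (N ^ e k)) G"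
      by (simp add: subst_poly_def subst_mon_def)
    finally show ?thesis using assms by simp
  qed
  then have p: "p = 0" using poly_all_0_iff_0 by blast
  obtain u where u: "u \<in> keys G" using \<open>G \<noteq> 0\<close> lead_in_keys
    by (metis poly_mapping_eqI in_keys_iff lookup_zero)
  have "poly.coeff p (\<kappa> u) = (\<Sum>w\<in>keys G. if w = u then lookup G w else 0)"
    unfolding p_def coeff_sum by (intro sum.cong refl) (use inj u in auto)
  also have "\<dots> = lookup G u" using u by simp
  finally show False using u p by (simp add: in_keys_iff)
qed

section \<open>Bracket monomials\<close>

type_synonym 'r vectors = "nat \<Rightarrow> 'r \<times> 'r"

definition bracket :: "'r::comm_ring_1 vectors \<Rightarrow> nat \<times> nat \<Rightarrow> 'r" where
  "bracket v p = fst (v (fst p)) * snd (v (snd p)) - snd (v (fst p)) * fst (v (snd p))"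

definition bmon :: "'r::comm_ring_1 vectors \<Rightarrow> (nat \<times> nat) list \<Rightarrow> 'r" where
  "bmon v ps = prod_list (map (bracket v) ps)"

definition occ :: "nat \<times> nat \<Rightarrow> nat \<Rightarrow> nat" where
  "occ p x = of_bool (fst p = x) + of_bool (snd p = x)"

text \<open>The degree of a bracket monomial in each of the vectors.\<close>

definition multideg :: "(nat \<times> nat) list \<Rightarrow> nat \<Rightarrow> nat" where
  "multideg ps x = (\<Sum>p\<leftarrow>ps. occ p x)"

definition bracket_lists :: "nat \<Rightarrow> (nat \<times> nat) list set" where
  "bracket_lists l = lists {(i, j). i \<in> {1..l} \<and> j \<in> {1..l} \<and> i \<noteq> j}"

definition bracket_gens :: "nat \<Rightarrow> (nat \<Rightarrow> nat) \<Rightarrow> (nat \<times> nat) list set" where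
  "bracket_gens l d = {ps \<in> bracket_lists l. multideg ps = d}"

lemma bmon_Nil [simp]: "bmon v [] = 1" and
  bmon_Cons [simp]: "bmon v (p # ps) = bracket v p * bmon v ps" and
  bmon_append [simp]: "bmon v (ps @ qs) = bmon v ps * bmon v qs"
  by (simp_all add: bmon_def)

lemma multideg_Nil [simp]: "multideg [] = (\<lambda>_. 0)" and
  multideg_Cons: "multideg (p # ps) x = occ p x + multideg ps x" and
  multideg_append: "multideg (ps @ qs) x = multideg ps x + multideg qs x"
  by (auto simp: multideg_def)

text \<open>Complex linear combinations of bracket monomials, as functions of vectors whose entries are
  themselves polynomials. Working over the polynomial ring avoids passing between identities of
  complex functions and identities of polynomials: the vectors of interest, the rows of \<open>\<psi>\<^sub>S\<close>, are
  just one of the arguments.\<close>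

inductive_set bspan ::
    "(nat \<times> nat) list set \<Rightarrow> (('v, complex) mpoly vectors \<Rightarrow> ('v, complex) mpoly) set"
  for G where
  bspan_zero: "(\<lambda>v. 0) \<in> bspan G"
| bspan_step: "ps \<in> G \<Longrightarrow> f \<in> bspan G \<Longrightarrow> (\<lambda>v. const_poly c * bmon v ps + f v) \<in> bspan G"

lemma const_poly_simps:
  "const_poly 0 = 0" "const_poly 1 = 1"
  "const_poly (a * b :: 'a::comm_ring_1) = const_poly a * const_poly b"
  "const_poly (a + b :: 'a) = const_poly a + const_poly b"
  "const_poly (- a :: 'a) = - const_poly a"
  by (simp_all add: const_poly_def mult_single single_add single_uminus)

lemma const_poly_of_nat: "const_poly (of_nat k :: 'a::comm_ring_1) = of_nat k"
  by (induction k) (simp_all add: const_poly_simps)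

lemma bspan_bmon: "ps \<in> G \<Longrightarrow> (\<lambda>v. bmon v ps) \<in> bspan G"
  using bspan_step[OF _ bspan_zero, of ps G 1] by (simp add: const_poly_simps)

lemma bspan_add:
  assumes "f \<in> bspan G" "g \<in> bspan G"
  shows "(\<lambda>v. f v + g v) \<in> bspan G"
  using assms(1)
proof (induction rule: bspan.induct)
  case (bspan_step ps f c)
  from bspan.bspan_step[OF bspan_step(1,3), of c] show ?case by (simp add: add.assoc)
qed (use assms in simp)

lemma bspan_scale: "f \<in> bspan G \<Longrightarrow> (\<lambda>v. const_poly c * f v) \<in> bspan G"
proof (induction rule: bspan.induct)
  case (bspan_step ps f c')
  from bspan.bspan_step[OF bspan_step(1,3), of "c * c'"] show ?case
    by (simp add: const_poly_simps distrib_left mult.assoc)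
qed (simp add: bspan_zero)

lemma bspan_of_nat: "f \<in> bspan G \<Longrightarrow> (\<lambda>v. of_nat c * f v) \<in> bspan G"
  using bspan_scale[of f G "of_nat c"] by (simp add: const_poly_of_nat)

lemma bspan_uminus: "f \<in> bspan G \<Longrightarrow> (\<lambda>v. - f v) \<in> bspan G"
  using bspan_scale[of f G "- 1"] by (simp add: const_poly_simps)

lemma bspan_sum:
  assumes "\<And>i. i \<in> A \<Longrightarrow> f i \<in> bspan G"
  shows "(\<lambda>v. \<Sum>i\<in>A. f i v) \<in> bspan G"
  using assms by (induction A rule: infinite_finite_induct) (auto intro: bspan_zero bspan_add)

text \<open>A bracket times a bracket polynomial; the second premise absorbs the new factor into the
  generators.\<close>

lemma bspan_bracket_mult:
  assumes "f \<in> bspan G" "\<And>ps. ps \<in> G \<Longrightarrow> \<exists>qs\<in>H. \<forall>v :: ('v, complex) mpoly vectors. bracket v p * bmon v ps = bmon v qs"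
  shows "(\<lambda>v :: ('v, complex) mpoly vectors. bracket v p * f v) \<in> bspan H"
  using assms(1)
proof (induction rule: bspan.induct)
  case (bspan_step ps f c)
  from assms(2)[OF bspan_step(1)] obtain qs where qs: "qs \<in> H"
    "\<And>v :: ('v, complex) mpoly vectors. bracket v p * bmon v ps = bmon v qs" by auto
  from bspan.bspan_step[OF qs(1) bspan_step(3), of c] show ?case
    by (simp add: qs(2)[symmetric] algebra_simps)
qed (simp add: bspan_zero)

lemma bspan_empty: "f \<in> bspan {} \<Longrightarrow> f = (\<lambda>v. 0)"
  by (induction rule: bspan.induct) auto

lemma bracket_swap: "bracket v (j, i) = - bracket v (i, j)"
  by (simp add: bracket_def algebra_simps)

lemma hom_bmon:
  assumes "\<And>x y. h (x * y) = h x * h y" "\<And>x y. h (x - y) = h x - h y" "h 1 = 1"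
  shows "h (bmon v ps) = bmon (\<lambda>i. (h (fst (v i)), h (snd (v i)))) ps"
  by (induction ps) (auto simp: assms bracket_def)

section \<open>Divisibility by a bracket\<close>

text \<open>The span of these lists consists of the multiples of \<open>[a l]\<close> of multidegree \<open>d\<close>. Keeping the
  factor \<open>(a, l)\<close> at the head makes it possible to divide by it syntactically.\<close>

definition bracket_ideal :: "nat \<Rightarrow> nat \<Rightarrow> (nat \<Rightarrow> nat) \<Rightarrow> (nat \<times> nat) list set" where
  "bracket_ideal a l d = {(a, l) # qs | qs. qs \<in> bracket_lists l \<and> multideg ((a, l) # qs) = d}"

lemma bracket_ideal_mult:
  assumes "f \<in> bspan (bracket_ideal a l (multideg ps))" "p \<in> {1..l} \<times> {1..l}" "fst p \<noteq> snd p"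
    "multideg qs = (\<lambda>x. occ p x + multideg ps x)"
  shows "(\<lambda>v :: ('v, complex) mpoly vectors. bracket v p * f v) \<in> bspan (bracket_ideal a l (multideg qs))"
proof (rule bspan_bracket_mult[OF assms(1)])
  fix rs assume "rs \<in> bracket_ideal a l (multideg ps)"
  then obtain ts where ts: "rs = (a, l) # ts" "ts \<in> bracket_lists l" "multideg rs = multideg ps"
    by (auto simp: bracket_ideal_def)
  have "(a, l) # p # ts \<in> bracket_ideal a l (multideg qs)"
    using ts assms(2-4) unfolding bracket_ideal_def bracket_lists_def
    by (auto simp: fun_eq_iff multideg_Cons)
  then show "\<exists>qs'\<in>bracket_ideal a l (multideg qs). \<forall>v :: ('v, complex) mpoly vectors. bracket v p * bmon v rs = bmon v qs'"
    by (rule bexI[rotated]) (simp add: ts(1) algebra_simps)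
qed

definition swap_pair :: "nat \<Rightarrow> nat \<Rightarrow> nat \<times> nat \<Rightarrow> nat \<times> nat" where
  "swap_pair a l p = (Transposition.transpose a l (fst p), Transposition.transpose a l (snd p))"

text \<open>Brackets are alternating, so a bracket that contains exactly one of \<open>a\<close> and \<open>l\<close> may be written
  with that index first. This removes the case distinction over the positions of the indices.\<close>

lemma bracket_orientation:
  assumes "a \<noteq> l" "fst p \<noteq> snd p" "occ p a + occ p l = 1"
  obtains x y k and s :: "'r::comm_ring_1" where "(x = a \<and> y = l) \<or> (x = l \<and> y = a)" "k \<noteq> a" "k \<noteq> l"
    "s = 1 \<or> s = - 1" "\<And>v. bracket v p = s * bracket v (x, k)" "\<And>v. bracket v (swap_pair a l p) = s * bracket v (y, k)"
    "\<And>z. occ p z = occ (x, k) z" "k \<in> {fst p, snd p}"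
proof -
  obtain i j where p: "p = (i, j)" by (cases p)
  have "(i = a \<and> j \<noteq> a \<and> j \<noteq> l) \<or> (j = a \<and> i \<noteq> a \<and> i \<noteq> l) \<or> (i = l \<and> j \<noteq> a \<and> j \<noteq> l) \<or> (j = l \<and> i \<noteq> a \<and> i \<noteq> l)"
    using assms by (auto simp: p occ_def of_bool_def split: if_splits)
  then show thesis
  proof (elim disjE conjE)
    assume *: "i = a" "j \<noteq> a" "j \<noteq> l"
    show thesis by (rule that[of a l j 1]) (use * in \<open>simp_all add: p swap_pair_def\<close>)
  next
    assume *: "j = a" "i \<noteq> a" "i \<noteq> l"
    show thesis by (rule that[of a l i "- 1"]) (use * in \<open>simp_all add: p swap_pair_def bracket_swap[of _ _ i] occ_def\<close>)
  next
    assume *: "i = l" "j \<noteq> a" "j \<noteq> l"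
    show thesis by (rule that[of l a j 1]) (use * in \<open>simp_all add: p swap_pair_def\<close>)
  next
    assume *: "j = l" "i \<noteq> a" "i \<noteq> l"
    show thesis by (rule that[of l a i "- 1"]) (use * in \<open>simp_all add: p swap_pair_def bracket_swap[of _ _ i] occ_def\<close>)
  qed
qed

lemma plucker_relation:
  fixes v :: "'r::comm_ring_1 vectors"
  shows "bracket v (l, k) * bracket v (a, k') - bracket v (a, k) * bracket v (l, k') = bracket v (a, l) * (- bracket v (k, k'))"
  by (simp add: bracket_def algebra_simps)

text \<open>If one bracket contains \<open>a\<close> and the other one \<open>l\<close>, exchanging \<open>a\<close> and \<open>l\<close> changes their product only by a
  multiple of \<open>[a l]\<close>; this is the three-term Pluecker relation up to signs. The witness \<open>r\<close> consists of the other
  two indices.\<close>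

lemma plucker_exchange:
  assumes "a \<noteq> l" "fst p \<noteq> snd p" "fst q \<noteq> snd q"
    "occ p a + occ p l = 1" "occ q a + occ q l = 1" "occ p l + occ q l = 1"
  obtains r and c :: "'r::comm_ring_1" where "c = 1 \<or> c = - 1"
    "\<And>v :: 'r vectors. bracket v (swap_pair a l p) * bracket v (swap_pair a l q) - bracket v p * bracket v q
       = c * (bracket v (a, l) * bracket v r)"
    "set [fst r, snd r] \<subseteq> {fst p, snd p, fst q, snd q}"
    "\<And>x. occ (a, l) x + occ r x = occ p x + occ q x"
proof -
  obtain x y k and s :: 'r where p: "(x = a \<and> y = l) \<or> (x = l \<and> y = a)" "k \<noteq> a" "k \<noteq> l"
    "s = 1 \<or> s = - 1" "\<And>v. bracket v p = s * bracket v (x, k)" "\<And>v. bracket v (swap_pair a l p) = s * bracket v (y, k)"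
    "\<And>z. occ p z = occ (x, k) z" "k \<in> {fst p, snd p}"
    by (rule bracket_orientation[OF assms(1,2,4), where 'r='r]) (rule that)
  obtain x' y' k' and s' :: 'r where q: "(x' = a \<and> y' = l) \<or> (x' = l \<and> y' = a)" "k' \<noteq> a" "k' \<noteq> l"
    "s' = 1 \<or> s' = - 1" "\<And>v. bracket v q = s' * bracket v (x', k')" "\<And>v. bracket v (swap_pair a l q) = s' * bracket v (y', k')"
    "\<And>z. occ q z = occ (x', k') z" "k' \<in> {fst q, snd q}"
    by (rule bracket_orientation[OF assms(1,3,5), where 'r='r]) (rule that)
  have xy: "(x = a \<and> y = l \<and> x' = l \<and> y' = a) \<or> (x = l \<and> y = a \<and> x' = a \<and> y' = l)"
    using p(1,2,3) q(1,2,3) assms(1) assms(6)[unfolded p(7) q(7)] by (auto simp: occ_def)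
  define c where "c = (if x = a then - (s * s') else s * s')"
  have c: "c = 1 \<or> c = - 1" using p(4) q(4) by (auto simp: c_def)
  have eq: "bracket v (swap_pair a l p) * bracket v (swap_pair a l q) - bracket v p * bracket v q = c * (bracket v (a, l) * bracket v (k, k'))"
    for v :: "'r vectors"
  proof -
    have "bracket v (swap_pair a l p) * bracket v (swap_pair a l q) - bracket v p * bracket v q
        = s * s' * (bracket v (y, k) * bracket v (y', k') - bracket v (x, k) * bracket v (x', k'))"
      unfolding p(5,6) q(5,6) by (simp add: algebra_simps)
    also have "\<dots> = c * (bracket v (a, l) * bracket v (k, k'))"
      using xy
    proof (elim disjE conjE)
      assume "x = a" "y = l" "x' = l" "y' = a"
      then show ?thesis using plucker_relation[of v l k a k'] by (simp add: c_def)
    next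
      assume "x = l" "y = a" "x' = a" "y' = l"
      then show ?thesis using plucker_relation[of v a k l k'] bracket_swap[of v l a] assms(1) by (simp add: c_def)
    qed
    finally show ?thesis .
  qed
  have "occ (a, l) z + occ (k, k') z = occ p z + occ q z" for z
    unfolding p(7) q(7) using xy by (elim disjE conjE) (simp_all add: occ_def)
  then show thesis
    using p(8) q(8) by (intro that[of c "(k, k')", OF c eq]) auto
qed

text \<open>In the degenerate case in which the two remaining indices coincide the difference is zero;
  otherwise it is a bracket monomial with the factor \<open>[a l]\<close>.\<close>

lemma exchange_modulo_bracket:
  assumes "a \<noteq> l" "p # q # ts \<in> bracket_lists l" "a \<in> {1..l}"
    "occ p a + occ p l = 1" "occ q a + occ q l = 1" "occ p l + occ q l = 1"
  shows "(\<lambda>v :: ('v, complex) mpoly vectors.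
      bracket v (swap_pair a l p) * (bracket v (swap_pair a l q) * bmon v ts) - bracket v p * (bracket v q * bmon v ts))
    \<in> bspan (bracket_ideal a l (multideg (p # q # ts)))"
proof -
  have pq: "fst p \<noteq> snd p" "fst q \<noteq> snd q" "set [fst p, snd p, fst q, snd q] \<subseteq> {1..l}"
    "ts \<in> bracket_lists l" "l \<in> {1..l}"
    using assms(2,3) by (auto simp: bracket_lists_def)
  obtain r and c :: "('v, complex) mpoly" where c: "c = 1 \<or> c = - 1"
    and eq: "\<And>v. bracket v (swap_pair a l p) * bracket v (swap_pair a l q) - bracket v p * bracket v q = c * (bracket v (a, l) * bracket v r)"
    and r: "set [fst r, snd r] \<subseteq> {fst p, snd p, fst q, snd q}"
    and oc: "\<And>x. occ (a, l) x + occ r x = occ p x + occ q x"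
    by (rule plucker_exchange[OF assms(1) pq(1,2) assms(4-6), where 'r="('v, complex) mpoly"]) (rule that)
  have eq': "bracket v (swap_pair a l p) * (bracket v (swap_pair a l q) * bmon v ts) - bracket v p * (bracket v q * bmon v ts)
      = c * (bracket v (a, l) * bracket v r * bmon v ts)" for v :: "('v, complex) mpoly vectors"
    using arg_cong[OF eq[of v], of "\<lambda>x. x * bmon v ts"] by (simp add: algebra_simps)
  show ?thesis
  proof (cases "fst r = snd r")
    case True
    then have "bracket v r = 0" for v :: "('v, complex) mpoly vectors" by (simp add: bracket_def)
    then show ?thesis unfolding eq' by (simp add: bspan_zero)
  next
    case False
    have "multideg ((a, l) # r # ts) = multideg (p # q # ts)"
      using oc by (auto simp: fun_eq_iff multideg_Cons)
    then have "(a, l) # r # ts \<in> bracket_ideal a l (multideg (p # q # ts))"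
      using False r pq unfolding bracket_ideal_def bracket_lists_def
      by (cases r) auto
    from bspan_bmon[OF this] bspan_uminus[OF bspan_bmon[OF this]] show ?thesis
      unfolding eq' using c by (auto simp: mult.assoc)
  qed
qed

text \<open>Both \<open>v\<^sub>a\<close> and \<open>v\<^sub>l\<close> are replaced by the point \<open>v\<^sub>a + \<tau> v\<^sub>l\<close>, with \<open>\<tau>\<close> the variable of the univariate
  polynomials.\<close>

definition line_vectors :: "nat \<Rightarrow> nat \<Rightarrow> 'r::comm_ring_1 vectors \<Rightarrow> 'r poly vectors" where
  "line_vectors a l v i = (if i = a \<or> i = l then ([:fst (v a), fst (v l):], [:snd (v a), snd (v l):])
     else ([:fst (v i):], [:snd (v i):]))"

lemma bracket_line_vectors:
  assumes "a \<noteq> l" "fst p \<noteq> snd p"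
  shows "bracket (line_vectors a l v) (swap_pair a l p) = bracket (line_vectors a l v) p"
    and "occ p a + occ p l = 0 \<Longrightarrow> bracket (line_vectors a l v) p = [:bracket v p:]"
    and "occ p a = 1 \<Longrightarrow> occ p l = 0 \<Longrightarrow> bracket (line_vectors a l v) p = [:bracket v p, bracket v (swap_pair a l p):]"
    and "occ p a = 0 \<Longrightarrow> occ p l = 1 \<Longrightarrow> bracket (line_vectors a l v) p = [:bracket v (swap_pair a l p), bracket v p:]"
    and "occ p a = 1 \<Longrightarrow> occ p l = 1 \<Longrightarrow> bracket (line_vectors a l v) p = 0"
proof -
  show "bracket (line_vectors a l v) (swap_pair a l p) = bracket (line_vectors a l v) p"
    by (simp add: bracket_def line_vectors_def swap_pair_def Transposition.transpose_def)
next
  obtain i j where p: "p = (i, j)" "i \<noteq> j" using assms(2) by (cases p) auto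
  have tr: "Transposition.transpose a l a = l" "Transposition.transpose a l l = a"
    "x \<noteq> a \<Longrightarrow> x \<noteq> l \<Longrightarrow> Transposition.transpose a l x = x" for x by auto
  note defs = p bracket_def line_vectors_def swap_pair_def tr
  show "bracket (line_vectors a l v) p = [:bracket v p:]" if "occ p a + occ p l = 0"
  proof -
    have "i \<noteq> a" "i \<noteq> l" "j \<noteq> a" "j \<noteq> l" using that by (auto simp: p occ_def of_bool_def split: if_splits)
    then show ?thesis by (simp add: defs)
  qed
  show "bracket (line_vectors a l v) p = [:bracket v p, bracket v (swap_pair a l p):]" if "occ p a = 1" "occ p l = 0"
  proof -
    have "i \<noteq> l" "j \<noteq> l" "i = a \<or> j = a" using that by (auto simp: p occ_def of_bool_def split: if_splits)
    then show ?thesis using p(2) by (elim disjE) (simp_all add: defs algebra_simps)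
  qed
  show "bracket (line_vectors a l v) p = [:bracket v (swap_pair a l p), bracket v p:]" if "occ p a = 0" "occ p l = 1"
  proof -
    have "i \<noteq> a" "j \<noteq> a" "i = l \<or> j = l" using that by (auto simp: p occ_def of_bool_def split: if_splits)
    then show ?thesis using p(2) assms(1) by (elim disjE) (simp_all add: defs algebra_simps)
  qed
  show "bracket (line_vectors a l v) p = 0" if "occ p a = 1" "occ p l = 1"
  proof -
    have "i = a \<or> j = a" using that(1) by (auto simp: p occ_def of_bool_def split: if_splits)
    moreover have "i = l \<or> j = l" using that(2) by (auto simp: p occ_def of_bool_def split: if_splits)
    ultimately have "(i = a \<and> j = l) \<or> (i = l \<and> j = a)" using assms(1) by blast
    then show ?thesis using assms(1) by (elim disjE conjE) (simp_all add: defs algebra_simps)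
  qed
qed

lemma occ_swap_pair:
  assumes "a \<noteq> l"
  shows "occ (swap_pair a l p) a = occ p l" "occ (swap_pair a l p) l = occ p a"
    "x \<noteq> a \<Longrightarrow> x \<noteq> l \<Longrightarrow> occ (swap_pair a l p) x = occ p x"
  using assms by (auto simp: occ_def swap_pair_def Transposition.transpose_def)

lemma occ_le_1: "fst p \<noteq> snd p \<Longrightarrow> occ p x \<le> 1"
  by (auto simp: occ_def)

lemma degree_bmon_line:
  assumes "a \<noteq> l" "ps \<in> bracket_lists m"
  shows "degree (bmon (line_vectors a l v) ps) \<le> multideg ps a + multideg ps l"
  using assms(2)
proof (induction ps)
  case (Cons p ps)
  have p: "fst p \<noteq> snd p" and IH: "degree (bmon (line_vectors a l v) ps) \<le> multideg ps a + multideg ps l"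
    using Cons by (auto simp: bracket_lists_def)
  have "degree (bracket (line_vectors a l v) p) \<le> occ p a + occ p l"
  proof -
    have "(occ p a + occ p l = 0) \<or> (occ p a = 1 \<and> occ p l = 0) \<or> (occ p a = 0 \<and> occ p l = 1)
        \<or> (occ p a = 1 \<and> occ p l = 1)"
      using occ_le_1[OF p, of a] occ_le_1[OF p, of l] by linarith
    then show ?thesis
      by (elim disjE conjE) (simp_all add: bracket_line_vectors(2-5)[OF assms(1) p])
  qed
  with IH show ?case
    using degree_mult_le[of "bracket (line_vectors a l v) p" "bmon (line_vectors a l v) ps"]
    by (simp add: multideg_Cons)
qed simp

lemma coeff_linear_mult:
  "poly.coeff ([:x, y:] * X) s = x * poly.coeff X s + (if s = 0 then 0 else y * poly.coeff X (s - 1))"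
  by (cases s) (auto simp: mult_pCons_left)

lemma split_occ:
  assumes "multideg qs x > 0"
  obtains us q ws where "qs = us @ q # ws" "occ q x > 0"
proof -
  have "\<exists>q\<in>set qs. occ q x > 0"
    using assms by (induction qs) (auto simp: multideg_def)
  then show ?thesis using that by (meson split_list)
qed

text \<open>The coefficient of \<open>\<tau>\<close> to the power of the degree in \<open>v\<^sub>l\<close>: the part of the substituted monomial that
  has the original multidegree.\<close>

definition polarization :: "nat \<Rightarrow> nat \<Rightarrow> 'r::comm_ring_1 vectors \<Rightarrow> (nat \<times> nat) list \<Rightarrow> 'r" where
  "polarization a l v ps = poly.coeff (bmon (line_vectors a l v) ps) (multideg ps l)"

text \<open>With \<open>r\<close> factors containing \<open>a\<close> and \<open>s\<close> containing \<open>l\<close>, the polarization is the sum over all ways to put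
  \<open>l\<close> into \<open>s\<close> of these \<open>r + s\<close> factors and \<open>a\<close> into the others. By the exchange relation all
  \<open>(r + s) choose s\<close> summands agree modulo \<open>[a l]\<close>. The induction removes one factor, and the two
  summands of Pascal's rule are the two choices for that factor; in the choice that differs from the
  original monomial another factor has to be exchanged in compensation.\<close>

lemma polarization_bmon:
  assumes "a \<noteq> l" "a \<in> {1..l}" "ps \<in> bracket_lists l" "\<And>p. p \<in> set ps \<Longrightarrow> occ p a + occ p l \<le> 1"
  shows "(\<lambda>v :: ('v::linorder, complex) mpoly vectors. polarization a l v ps
      - of_nat ((multideg ps a + multideg ps l) choose multideg ps l) * bmon v ps)
    \<in> bspan (bracket_ideal a l (multideg ps))"
  using assms(3,4)
proof (induction "length ps" arbitrary: ps)
  case 0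
  then show ?case by (simp add: polarization_def bspan_zero)
next
  case (Suc N)
  let ?I = "\<lambda>ps. bspan (bracket_ideal a l (multideg ps)) :: (('v, complex) mpoly vectors \<Rightarrow> _) set"
  let ?W = "line_vectors a l"
  obtain p qs where ps: "ps = p # qs" using Suc(2) by (cases ps) auto
  have p: "fst p \<noteq> snd p" "p \<in> {1..l} \<times> {1..l}" "qs \<in> bracket_lists l"
    "swap_pair a l p \<in> {1..l} \<times> {1..l}" "fst (swap_pair a l p) \<noteq> snd (swap_pair a l p)"
    using Suc.prems(1) assms(1,2)
    by (auto simp: ps bracket_lists_def swap_pair_def Transposition.transpose_def)
  have occ_qs: "occ q a + occ q l \<le> 1" if "q \<in> set qs" for q using Suc.prems(2)[of q] that by (simp add: ps)
  note W = bracket_line_vectors[OF assms(1) p(1)]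
  define r s where "r = multideg qs a" and "s = multideg qs l"
  have IH_qs: "(\<lambda>v. polarization a l v qs - of_nat ((r + s) choose s) * bmon v qs) \<in> ?I qs"
    using Suc.hyps(1)[of qs] Suc.hyps(2) p(3) occ_qs by (simp add: ps r_def s_def)
  have mult_p: "(\<lambda>v. bracket v p * f v) \<in> ?I ps" if "f \<in> ?I qs" for f
    by (rule bracket_ideal_mult[OF that p(2,1)]) (simp add: ps fun_eq_iff multideg_Cons)
  \<comment> \<open>If \<open>p\<close> contains \<open>y\<close>, exchanging \<open>a\<close> and \<open>l\<close> in \<open>p\<close> and in a factor of \<open>qs\<close> that contains \<open>x\<close> preserves the
    multidegree; the line does not distinguish \<open>a\<close> from \<open>l\<close>, so \<open>qs\<close> and \<open>qs'\<close> agree there.\<close>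
  have flip: "\<exists>qs'. multideg qs' x = multideg qs x - 1 \<and> multideg qs' y = multideg qs y + 1 \<and>
      (\<forall>v :: ('v, complex) mpoly vectors. bmon (?W v) qs' = bmon (?W v) qs) \<and>
      (\<lambda>v. bracket v (swap_pair a l p) * (poly.coeff (bmon (?W v) qs) (multideg qs' l)
          - of_nat ((r + s) choose (multideg qs' l)) * bmon v qs')) \<in> ?I ps \<and>
      (\<lambda>v. bracket v (swap_pair a l p) * bmon v qs' - bracket v p * bmon v qs) \<in> ?I ps"
    if xy: "(x = a \<and> y = l) \<or> (x = l \<and> y = a)" and px: "occ p y = 1" "occ p x = 0"
      and pos: "multideg qs x > 0" for x y
  proof -
    obtain us q ws where q: "qs = us @ q # ws" "occ q x > 0" using split_occ[OF pos] .
    define qs' where "qs' = us @ swap_pair a l q # ws"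
    have ql: "occ q a + occ q l = 1" "occ q x = 1" "occ q y = 0"
      using occ_qs[of q] q xy by auto
    have vq: "fst q \<noteq> snd q" "fst q \<in> {1..l}" "snd q \<in> {1..l}" "us \<in> bracket_lists l" "ws \<in> bracket_lists l"
      using p(3) by (auto simp: q bracket_lists_def)
    have val: "qs' \<in> bracket_lists l"
      using vq assms(1,2) by (auto simp: qs'_def bracket_lists_def swap_pair_def Transposition.transpose_def)
    have occ': "occ q' a + occ q' l \<le> 1" if "q' \<in> set qs'" for q'
      using that occ_qs[of q'] ql occ_swap_pair[OF assms(1), where p=q] by (auto simp: qs'_def q)
    have len: "N = length qs'" using Suc.hyps(2) by (simp add: ps q qs'_def)
    have d1: "multideg qs' x = multideg qs x - 1" "multideg qs' y = multideg qs y + 1"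
      using ql xy occ_swap_pair[OF assms(1), where p=q] by (auto simp: q qs'_def multideg_append multideg_Cons)
    have dd: "multideg qs' a + multideg qs' l = r + s"
      using d1 xy pos by (auto simp: r_def s_def)
    have d2: "multideg ps z = occ (swap_pair a l p) z + multideg qs' z" for z
      using ql px xy occ_swap_pair[OF assms(1), where p=q] occ_swap_pair[OF assms(1), where p=p]
      by (cases "z = a"; cases "z = l") (auto simp: ps q qs'_def multideg_append multideg_Cons)
    have W': "bmon (?W v) qs' = bmon (?W v) qs" for v :: "('v, complex) mpoly vectors"
      using bracket_line_vectors(1)[OF assms(1) vq(1), of v] by (simp add: q qs'_def)
    have IH: "(\<lambda>v. polarization a l v qs' - of_nat ((r + s) choose (multideg qs' l)) * bmon v qs') \<in> ?I qs'"
      using Suc.hyps(1)[OF len val occ'] by (simp add: dd)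
    have A: "(\<lambda>v. bracket v (swap_pair a l p) * (poly.coeff (bmon (?W v) qs) (multideg qs' l)
          - of_nat ((r + s) choose (multideg qs' l)) * bmon v qs')) \<in> ?I ps"
      using bracket_ideal_mult[OF IH p(4,5), of ps] d2 by (simp add: polarization_def W' fun_eq_iff)
    have "p # q # us @ ws \<in> bracket_lists l"
      using p(1-3) vq by (auto simp: bracket_lists_def case_prod_unfold mem_Times_iff)
    then have "(\<lambda>v. bracket v (swap_pair a l p) * (bracket v (swap_pair a l q) * bmon v (us @ ws))
        - bracket v p * (bracket v q * bmon v (us @ ws))) \<in> ?I (p # q # us @ ws)"
      by (rule exchange_modulo_bracket[OF assms(1) _ assms(2)]) (use px ql xy in auto)
    moreover have "multideg (p # q # us @ ws) = multideg ps"
      by (auto simp: ps q fun_eq_iff multideg_append multideg_Cons)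
    ultimately have B: "(\<lambda>v. bracket v (swap_pair a l p) * bmon v qs' - bracket v p * bmon v qs) \<in> ?I ps"
      by (simp add: q qs'_def algebra_simps)
    show ?thesis using d1 W' A B by blast
  qed
  have "occ p a + occ p l \<le> 1" using Suc.prems(2)[of p] by (simp add: ps)
  then consider "occ p a = 0" "occ p l = 0" | "occ p a = 1" "occ p l = 0" | "occ p a = 0" "occ p l = 1"
    by linarith
  then show ?case
  proof cases
    case 1
    have "polarization a l v ps = bracket v p * polarization a l v qs" for v :: "('v, complex) mpoly vectors"
      using 1 W(2)[of v] by (simp add: polarization_def ps multideg_Cons)
    then show ?thesis using mult_p[OF IH_qs] 1
      by (simp add: ps multideg_Cons r_def s_def algebra_simps)
  next
    case 2
    have pol: "polarization a l v ps = bracket v p * polarization a l v qs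
        + (if s = 0 then 0 else bracket v (swap_pair a l p) * poly.coeff (bmon (?W v) qs) (s - 1))"
      for v :: "('v, complex) mpoly vectors"
      using 2 W(3)[of v]
      by (simp add: polarization_def ps multideg_Cons coeff_linear_mult s_def del: mult_pCons_left)
    have deg: "multideg ps a = Suc r" "multideg ps l = s" using 2 by (auto simp: ps multideg_Cons r_def s_def)
    show ?thesis
    proof (cases "s = 0")
      case True
      then show ?thesis using mult_p[OF IH_qs] by (simp add: pol deg) (simp add: ps algebra_simps)
    next
      case False
      obtain qs' where "multideg qs' l = s - 1"
        "(\<lambda>v. bracket v (swap_pair a l p) * (poly.coeff (bmon (?W v) qs) (multideg qs' l)
          - of_nat ((r + s) choose (multideg qs' l)) * bmon v qs')) \<in> ?I ps"
        "(\<lambda>v. bracket v (swap_pair a l p) * bmon v qs' - bracket v p * bmon v qs) \<in> ?I ps"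
        using flip[of l a] 2 False by (auto simp: s_def)
      note qs' = this(1) this(2)[unfolded this(1)] this(3)
      have "Suc r + s choose s = (r + s choose s) + (r + s choose (s - 1))"
        using False by (cases s) auto
      then have eq: "polarization a l v ps - of_nat (Suc r + s choose s) * bmon v ps
        = bracket v p * (polarization a l v qs - of_nat ((r + s) choose s) * bmon v qs)
          + (bracket v (swap_pair a l p) * (poly.coeff (bmon (?W v) qs) (s - 1)
          - of_nat ((r + s) choose (s - 1)) * bmon v qs')
          + of_nat ((r + s) choose (s - 1)) * (bracket v (swap_pair a l p) * bmon v qs' - bracket v p * bmon v qs))"
        for v :: "('v, complex) mpoly vectors"
        using False by (simp add: pol) (simp add: ps algebra_simps)
      show ?thesis unfolding deg eq
        by (intro bspan_add mult_p IH_qs qs' bspan_of_nat)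
    qed
  next
    case 3
    have pol: "polarization a l v ps = bracket v (swap_pair a l p) * poly.coeff (bmon (?W v) qs) (Suc s)
        + bracket v p * polarization a l v qs"
      for v :: "('v, complex) mpoly vectors"
      using 3 W(4)[of v]
      by (simp add: polarization_def ps multideg_Cons coeff_linear_mult s_def del: mult_pCons_left)
    have deg: "multideg ps a = r" "multideg ps l = Suc s" using 3 by (auto simp: ps multideg_Cons r_def s_def)
    show ?thesis
    proof (cases "r = 0")
      case True
      \<comment> \<open>No factor is available for the exchange, but then the degree is too small for this coefficient.\<close>
      have "poly.coeff (bmon (?W v) qs) (Suc s) = 0" for v :: "('v, complex) mpoly vectors"
        by (rule coeff_eq_0) (use degree_bmon_line[OF assms(1) p(3), of v] True in \<open>simp add: r_def s_def\<close>)
      then show ?thesis using mult_p[OF IH_qs] True by (simp add: pol deg) (simp add: ps algebra_simps)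
    next
      case False
      obtain qs' where "multideg qs' l = Suc s"
        "(\<lambda>v. bracket v (swap_pair a l p) * (poly.coeff (bmon (?W v) qs) (multideg qs' l)
          - of_nat ((r + s) choose (multideg qs' l)) * bmon v qs')) \<in> ?I ps"
        "(\<lambda>v. bracket v (swap_pair a l p) * bmon v qs' - bracket v p * bmon v qs) \<in> ?I ps"
        using flip[of a l] 3 False by (auto simp: s_def r_def)
      note qs' = this(1) this(2)[unfolded this(1)] this(3)
      have "r + Suc s choose Suc s = (r + s choose s) + (r + s choose Suc s)" by simp
      then have eq: "polarization a l v ps - of_nat (r + Suc s choose Suc s) * bmon v ps
        = bracket v p * (polarization a l v qs - of_nat ((r + s) choose s) * bmon v qs)
          + (bracket v (swap_pair a l p) * (poly.coeff (bmon (?W v) qs) (Suc s)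
          - of_nat ((r + s) choose Suc s) * bmon v qs')
          + of_nat ((r + s) choose Suc s) * (bracket v (swap_pair a l p) * bmon v qs' - bracket v p * bmon v qs))"
        for v :: "('v, complex) mpoly vectors"
        by (simp only: pol of_nat_add) (simp add: ps algebra_simps)
      show ?thesis unfolding deg eq
        by (intro bspan_add mult_p IH_qs qs' bspan_of_nat)
    qed
  qed
qed

text \<open>The values of \<open>line_vectors\<close> at a point \<open>\<tau>\<close> of the coefficient ring.\<close>

definition on_line :: "nat \<Rightarrow> nat \<Rightarrow> 'r::comm_ring_1 \<Rightarrow> 'r vectors \<Rightarrow> 'r vectors" where
  "on_line a l \<tau> v i = (if i = a \<or> i = l then (fst (v a) + \<tau> * fst (v l), snd (v a) + \<tau> * snd (v l)) else v i)"

lemma poly_bmon_line_vectors: "poly (bmon (line_vectors a l v) ps) \<tau> = bmon (on_line a l \<tau> v) ps"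
proof -
  have "(\<lambda>i. (poly (fst (line_vectors a l v i)) \<tau>, poly (snd (line_vectors a l v i)) \<tau>)) = on_line a l \<tau> v"
    by (auto simp: fun_eq_iff line_vectors_def on_line_def)
  then show ?thesis
    using hom_bmon[of "\<lambda>p. poly p \<tau>" "line_vectors a l v" ps] by simp
qed

lemma bmon_multiple:
  assumes "a \<noteq> l" "ps \<in> bracket_lists l" "p \<in> set ps" "occ p a + occ p l > 1"
  shows "(\<lambda>v :: ('v, complex) mpoly vectors. bmon v ps) \<in> bspan (bracket_ideal a l (multideg ps))"
    and "bmon (line_vectors a l v) ps = 0"
proof -
  obtain us ws where ps: "ps = us @ p # ws" using assms(3) by (meson split_list)
  have "fst p \<noteq> snd p" using assms(2) by (auto simp: ps bracket_lists_def)
  then have oc: "occ p a = 1" "occ p l = 1"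
    using assms(4) occ_le_1[of p a] occ_le_1[of p l] by auto
  show "bmon (line_vectors a l v) ps = 0"
    using bracket_line_vectors(5)[OF assms(1) \<open>fst p \<noteq> snd p\<close> oc, of v] by (simp add: ps)
  have p: "p = (a, l) \<or> p = (l, a)"
  proof -
    have "fst p = a \<or> snd p = a" "fst p = l \<or> snd p = l"
      using oc by (auto simp: occ_def intro: ccontr)
    then show ?thesis using assms(1) by (cases p) auto
  qed
  have "multideg ((a, l) # us @ ws) = multideg ps"
    using p by (elim disjE) (simp_all add: ps fun_eq_iff multideg_append multideg_Cons occ_def)
  then have mem: "(a, l) # us @ ws \<in> bracket_ideal a l (multideg ps)"
    using assms(2) by (auto simp: bracket_ideal_def bracket_lists_def ps)
  have "bmon v ps = (if p = (a, l) then bmon v ((a, l) # us @ ws) else - bmon v ((a, l) # us @ ws))"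
    for v :: "('v, complex) mpoly vectors"
    using p bracket_swap[of v l a] assms(1) by (auto simp: ps algebra_simps)
  then show "(\<lambda>v :: ('v, complex) mpoly vectors. bmon v ps) \<in> bspan (bracket_ideal a l (multideg ps))"
    using bspan_bmon[OF mem] bspan_uminus[OF bspan_bmon[OF mem]] by (cases "p = (a, l)") auto
qed

text \<open>\<open>Q v\<close> is \<open>f\<close> evaluated on the line, as a univariate polynomial. It is determined by
  its values, which depend on \<open>f\<close> as a function and not on how \<open>f\<close> is written in bracket monomials.\<close>

lemma polarization_bspan:
  fixes f :: "('v::linorder, complex) mpoly vectors \<Rightarrow> _"
  assumes "a \<noteq> l" "a \<in> {1..l}" "f \<in> bspan (bracket_gens l d)"
  shows "\<exists>Q. (\<forall>v \<tau>. poly (Q v) \<tau> = f (on_line a l \<tau> v)) \<and>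
    (\<lambda>v. poly.coeff (Q v) (d l) - of_nat ((d a + d l) choose d l) * f v) \<in> bspan (bracket_ideal a l d)"
  using assms(3)
proof (induction rule: bspan.induct)
  case bspan_zero
  show ?case by (rule exI[of _ "\<lambda>v. 0"]) (simp add: bspan.bspan_zero)
next
  case (bspan_step ps f c)
  then obtain Q where Q: "\<And>v \<tau>. poly (Q v) \<tau> = f (on_line a l \<tau> v)"
    "(\<lambda>v. poly.coeff (Q v) (d l) - of_nat ((d a + d l) choose d l) * f v) \<in> bspan (bracket_ideal a l d)"
    by blast
  have ps: "ps \<in> bracket_lists l" "multideg ps = d" using bspan_step(1) by (auto simp: bracket_gens_def)
  have gen: "(\<lambda>v :: ('v, complex) mpoly vectors. poly.coeff (bmon (line_vectors a l v) ps) (d l) - of_nat ((d a + d l) choose d l) * bmon v ps)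
      \<in> bspan (bracket_ideal a l d)"
  proof (cases "\<exists>p\<in>set ps. occ p a + occ p l > 1")
    case True
    then obtain p where p: "p \<in> set ps" "occ p a + occ p l > 1" by blast
    from bspan_uminus[OF bspan_of_nat[OF bmon_multiple(1)[OF assms(1) ps(1) p]], of "(d a + d l) choose d l"]
    show ?thesis by (simp add: bmon_multiple(2)[OF assms(1) ps(1) p] ps(2))
  next
    case False
    then show ?thesis
      using polarization_bmon[OF assms(1,2) ps(1)] by (auto simp: polarization_def ps(2) not_less)
  qed
  show ?case
  proof (intro exI[of _ "\<lambda>v. [:const_poly c:] * bmon (line_vectors a l v) ps + Q v"] conjI allI)
    fix v \<tau>
    show "poly ([:const_poly c:] * bmon (line_vectors a l v) ps + Q v) \<tau>
      = const_poly c * bmon (on_line a l \<tau> v) ps + f (on_line a l \<tau> v)"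
      by (simp add: Q(1) poly_bmon_line_vectors)
  next
    show "(\<lambda>v. poly.coeff ([:const_poly c:] * bmon (line_vectors a l v) ps + Q v) (d l)
        - of_nat ((d a + d l) choose d l) * (const_poly c * bmon v ps + f v)) \<in> bspan (bracket_ideal a l d)"
      using bspan_add[OF bspan_scale[OF gen, of c] Q(2)] by (simp add: algebra_simps)
  qed
qed

text \<open>The vectors on the line have \<open>v\<^sub>a = v\<^sub>l\<close>, so \<open>f\<close> vanishes there for every \<open>\<tau>\<close> and its polarization is
  zero. But modulo \<open>[a l]\<close> the polarization is a binomial coefficient times \<open>f\<close>, and this coefficient
  is invertible in the complex numbers.\<close>

theorem bracket_divisibility:
  fixes f :: "('v::linorder, complex) mpoly vectors \<Rightarrow> _"
  assumes "a \<noteq> l" "a \<in> {1..l}" "f \<in> bspan (bracket_gens l d)" "\<And>v. f (v(l := v a)) = 0"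
  shows "f \<in> bspan (bracket_ideal a l d)"
proof -
  obtain Q where Q: "\<And>v \<tau>. poly (Q v) \<tau> = f (on_line a l \<tau> v)"
    "(\<lambda>v. poly.coeff (Q v) (d l) - of_nat ((d a + d l) choose d l) * f v) \<in> bspan (bracket_ideal a l d)"
    using polarization_bspan[OF assms(1-3)] by blast
  have "Q v = 0" for v
  proof -
    have "poly (Q v) \<tau> = 0" for \<tau>
    proof -
      have "on_line a l \<tau> v = (on_line a l \<tau> v)(l := on_line a l \<tau> v a)"
        by (auto simp: on_line_def fun_eq_iff)
      then show ?thesis using Q(1) assms(4)[of "on_line a l \<tau> v"] by simp
    qed
    then show ?thesis using poly_all_0_iff_0 by blast
  qed
  with Q(2) have *: "(\<lambda>v. - (of_nat ((d a + d l) choose d l) * f v)) \<in> bspan (bracket_ideal a l d)"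
    by simp
  define k where "k = (d a + d l) choose d l"
  have k: "k > 0" by (simp add: k_def)
  have "const_poly (- 1 / of_nat k :: complex) * (- (of_nat k * x)) = x" for x :: "('v, complex) mpoly"
  proof -
    have e: "(- 1 / of_nat k * - of_nat k :: complex) = 1" using k by simp
    have "const_poly (- 1 / of_nat k :: complex) * (- (of_nat k * x))
        = const_poly (- 1 / of_nat k :: complex) * const_poly (- of_nat k) * x"
      by (simp only: const_poly_simps(5) const_poly_of_nat) simp
    also have "\<dots> = const_poly (- 1 / of_nat k * - of_nat k :: complex) * x"
      by (simp only: const_poly_simps(3))
    finally show ?thesis unfolding e by (simp add: const_poly_simps(2))
  qed
  then show ?thesis using bspan_scale[OF *, of "- 1 / of_nat k"] by (simp add: k_def)
qed

section \<open>Leading exponents of bracket polynomials\<close>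

lemma in_bracket_lists_iff:
  "ps \<in> bracket_lists l \<longleftrightarrow> (\<forall>p\<in>set ps. fst p \<in> {1..l} \<and> snd p \<in> {1..l} \<and> fst p \<noteq> snd p)"
  by (auto simp: bracket_lists_def in_lists_conv_set)

lemma bmon_merge: "bmon (v(l := v a)) ps = bmon v (map (\<lambda>p. (if fst p = l then a else fst p, if snd p = l then a else snd p)) ps)"
  by (induction ps) (auto simp: bracket_def)

text \<open>A monomial either acquires a factor \<open>[a a] = 0\<close> or is again a bracket monomial.\<close>

lemma bspan_merge:
  fixes f :: "('v::linorder, complex) mpoly vectors \<Rightarrow> _"
  assumes "f \<in> bspan (bracket_gens l d)" "a \<in> {1..<l}"
  shows "(\<lambda>v. f (v(l := v a))) \<in> bspan (bracket_gens (l - 1) (d(l := 0, a := d a + d l)))"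
  using assms(1)
proof (induction rule: bspan.induct)
  case bspan_zero
  show ?case by (rule bspan.bspan_zero)
next
  case (bspan_step ps f c)
  define r where "r p = (if fst p = l then a else fst p, if snd p = l then a else snd p)" for p :: "nat \<times> nat"
  have ps: "ps \<in> bracket_lists l" "multideg ps = d" using bspan_step(1) by (auto simp: bracket_gens_def)
  have mon: "bmon (v(l := v a)) ps = bmon v (map r ps)" for v :: "('v, complex) mpoly vectors"
    by (simp add: bmon_merge r_def[abs_def])
  show ?case
  proof (cases "\<exists>p\<in>set ps. fst (r p) = snd (r p)")
    case True
    then have zero: "bmon (v(l := v a)) ps = 0" for v :: "('v, complex) mpoly vectors"
      unfolding mon unfolding bmon_def by (force simp: prod_list_zero_iff bracket_def image_iff)
    show ?thesis using bspan_step.IH by (simp only: zero mult_zero_right add_0_left)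
  next
    case False
    have occ: "occ (r p) x = (if x = a then occ p a + occ p l else if x = l then 0 else occ p x)" for p x
      using assms(2) by (auto simp: occ_def r_def)
    have "multideg (map r qs) x = (if x = a then multideg qs a + multideg qs l else if x = l then 0 else multideg qs x)"
      for qs x by (induction qs) (auto simp: multideg_Cons occ)
    then have "multideg (map r ps) = d(l := 0, a := d a + d l)" using assms(2) by (auto simp: ps(2) fun_eq_iff)
    moreover have "map r ps \<in> bracket_lists (l - 1)"
      unfolding in_bracket_lists_iff
    proof
      fix q assume "q \<in> set (map r ps)"
      then obtain p where p: "p \<in> set ps" "q = r p" by auto
      then have "fst p \<in> {1..l}" "snd p \<in> {1..l}" using ps(1) by (auto simp: in_bracket_lists_iff)
      then have "fst (r p) \<in> {1..l-1}" "snd (r p) \<in> {1..l-1}" using assms(2) by (auto simp: r_def)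
      then show "fst q \<in> {1..l-1} \<and> snd q \<in> {1..l-1} \<and> fst q \<noteq> snd q" using False p by blast
    qed
    ultimately have "map r ps \<in> bracket_gens (l - 1) (d(l := 0, a := d a + d l))"
      unfolding bracket_gens_def by blast
    from bspan.bspan_step[OF this bspan_step.IH, of c] show ?thesis by (simp only: mon)
  qed
qed

lemma var_poly_power: "var_poly k ^ e = (single (single k e) 1 :: ('v, 'a::comm_ring_1) mpoly)"
  by (induction e) (simp_all add: var_poly_def mult_single single_add[symmetric])

text \<open>The recursion satisfied by the rows of \<open>\<psi>\<^sub>S\<close>. The order of the variables is that of the roots in the
  iterated sequence: variables of larger index come first, and \<open>y\<^sub>l\<close> comes before \<open>z\<^sub>l\<close>.\<close>

locale iterated_vectors =
  fixes n :: nat and ia ja :: "nat \<Rightarrow> nat" and yv zv :: "nat \<Rightarrow> 'd::{finite,linorder}"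
    and V :: "('d, complex) mpoly vectors"
  assumes ij: "l \<in> {3..n} \<Longrightarrow> ia l \<in> {1..<l} \<and> ja l \<in> {1..<l} \<and> ia l \<noteq> ja l"
    and yz: "l \<in> {3..n} \<Longrightarrow> yv l < zv l"
    and zy: "l \<in> {3..n} \<Longrightarrow> l' \<in> {3..n} \<Longrightarrow> l' < l \<Longrightarrow> zv l < yv l'"
    and UNIV_yz: "UNIV = yv ` {3..n} \<union> zv ` {3..n}"
    and V12: "V 1 = (1, 0)" "V 2 = (0, 1)"
    and V_new: "l \<in> {3..n} \<Longrightarrow> V l =
      (var_poly (yv l) * fst (V (ia l)) + var_poly (zv l) * fst (V (ja l)),
       var_poly (yv l) * snd (V (ia l)) + var_poly (zv l) * snd (V (ja l)))"
begin

lemma V_values [simp]: "V (Suc 0) = (1, 0)" "V 2 = (0, 1)" "V (Suc (Suc 0)) = (0, 1)"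
  using V12 by (simp_all add: numeral_2_eq_2)

text \<open>Only variables of index below \<open>l\<close> occur. These come after \<open>y\<^sub>l\<close> and \<open>z\<^sub>l\<close> in the order, so they never
  influence a comparison that is decided at \<open>y\<^sub>l\<close>.\<close>

definition older :: "nat \<Rightarrow> ('d \<Rightarrow>\<^sub>0 nat) \<Rightarrow> bool" where
  "older l u \<longleftrightarrow> (\<forall>m\<in>{3..n}. l \<le> m \<longrightarrow> lookup u (yv m) = 0 \<and> lookup u (zv m) = 0)"

definition in_older :: "nat \<Rightarrow> ('d, complex) mpoly \<Rightarrow> bool" where
  "in_older l P \<longleftrightarrow> (\<forall>u\<in>keys P. older l u)"

lemma older_0: "older l 0" and older_add: "older l u \<Longrightarrow> older l w \<Longrightarrow> older l (u + w)"
  by (auto simp: older_def lookup_add)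

lemma older_mono: "older l u \<Longrightarrow> l \<le> m \<Longrightarrow> older m u"
  by (auto simp: older_def)

lemma yv_neq_zv: "l \<in> {3..n} \<Longrightarrow> m \<in> {3..n} \<Longrightarrow> yv l \<noteq> zv m"
  using yz[of l] yz[of m] zy[of l m] zy[of m l] by (cases l m rule: linorder_cases) force+

lemma yv_inj: "l \<in> {3..n} \<Longrightarrow> m \<in> {3..n} \<Longrightarrow> yv l = yv m \<longleftrightarrow> l = m"
  using yz[of l] yz[of m] zy[of l m] zy[of m l] by (cases l m rule: linorder_cases) force+

lemma zv_inj: "l \<in> {3..n} \<Longrightarrow> m \<in> {3..n} \<Longrightarrow> zv l = zv m \<longleftrightarrow> l = m"
  using yz[of l] yz[of m] zy[of l m] zy[of m l] by (cases l m rule: linorder_cases) force+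

lemma older_single:
  assumes "m \<in> {3..n}" "m < l"
  shows "older l (single (yv m) c)" "older l (single (zv m) c)"
  using assms by (auto simp: older_def lookup_single when_def yv_inj zv_inj yv_neq_zv yv_neq_zv[symmetric])

lemma less_exponentI:
  assumes "l \<in> {3..n}" "older (Suc l) u" "older (Suc l) w" "lookup u (yv l) < lookup w (yv l)"
  shows "u < w"
  unfolding less_exponent_iff
proof (intro exI[of _ "yv l"] conjI allI impI assms(4))
  fix k assume k: "k < yv l"
  obtain m where m: "m \<in> {3..n}" "k = yv m \<or> k = zv m" using UNIV_yz by blast
  have "\<not> m \<le> l" using m k yz[of m] yz[of l] zy[of l m] assms(1) by (cases m l rule: linorder_cases) auto
  then show "lookup u k = lookup w k" using assms(2,3) m by (auto simp: older_def)
qed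

lemma in_older_ring:
  "in_older l 0" "in_older l 1" "in_older l P \<Longrightarrow> in_older l (- P)" "in_older l (const_poly c)"
  "in_older l P \<Longrightarrow> in_older l Q \<Longrightarrow> in_older l (P + Q)"
  "in_older l P \<Longrightarrow> in_older l Q \<Longrightarrow> in_older l (P - Q)"
  "in_older l P \<Longrightarrow> in_older l Q \<Longrightarrow> in_older l (P * Q)"
proof -
  show "in_older l P \<Longrightarrow> in_older l Q \<Longrightarrow> in_older l (P + Q)"
    unfolding in_older_def using Poly_Mapping.keys_add[of P Q] by blast
  show "in_older l P \<Longrightarrow> in_older l Q \<Longrightarrow> in_older l (P - Q)"
    unfolding in_older_def using keys_diff[of P Q] by blast
  show "in_older l P \<Longrightarrow> in_older l Q \<Longrightarrow> in_older l (P * Q)"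
    unfolding in_older_def by (auto elim!: keys_multE intro: older_add)
qed (auto simp: in_older_def older_0 const_poly_def in_keys_iff lookup_single when_def)

lemma in_older_var:
  "m \<in> {3..n} \<Longrightarrow> m < l \<Longrightarrow> in_older l (var_poly (yv m)) \<and> in_older l (var_poly (zv m))"
  by (simp add: in_older_def var_poly_def older_single)

lemma V_older: "1 \<le> i \<Longrightarrow> i \<le> n \<Longrightarrow> i < l \<Longrightarrow> in_older l (fst (V i)) \<and> in_older l (snd (V i))"
proof (induction i rule: less_induct)
  case (less i)
  consider "i = 1" | "i = 2" | "i \<in> {3..n}" using less.prems by fastforce
  then show ?case
  proof cases
    case 3
    with ij[OF this] less show ?thesis
      by (simp add: V_new in_older_ring in_older_var)
  qed (simp_all add: in_older_ring)
qed

lemma bracket_older: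
  assumes "fst p \<in> {1..n}" "snd p \<in> {1..n}" "fst p < l" "snd p < l"
  shows "in_older l (bracket V p)"
  using assms V_older[of "fst p" l] V_older[of "snd p" l] by (simp add: bracket_def in_older_ring)

lemma bmon_older:
  assumes "ps \<in> bracket_lists m" "m < l" "m \<le> n"
  shows "in_older l (bmon V ps)"
  using assms(1)
proof (induction ps)
  case (Cons p ps)
  then show ?case using assms(2,3)
    by (auto simp: bracket_lists_def intro!: in_older_ring bracket_older)
qed (simp add: in_older_ring)

lemma bspan_older: "f \<in> bspan (bracket_gens m d) \<Longrightarrow> m < l \<Longrightarrow> m \<le> n \<Longrightarrow> in_older l (f V)"
  by (induction rule: bspan.induct) (auto simp: bracket_gens_def intro!: in_older_ring bmon_older)

lemma bracket_rec:
  assumes "l \<in> {3..n}"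
  shows "bracket V (k, l) = var_poly (yv l) * bracket V (k, ia l) + var_poly (zv l) * bracket V (k, ja l)"
  by (simp add: bracket_def V_new[OF assms] algebra_simps)

definition val :: "nat \<times> nat \<Rightarrow> 'd \<Rightarrow>\<^sub>0 nat" where
  "val p = lead (bracket V p)"

lemma val_swap: "val (j, i) = val (i, j)"
  using bracket_swap[of V j i] by (simp add: val_def lead_uminus)

text \<open>In \<open>[k l] = y\<^sub>l [k a] + z\<^sub>l [k b]\<close> the brackets on the right contain older variables only, so every
  exponent of the first summand exceeds every exponent of the second.\<close>

lemma bracket_rec_lead:
  assumes l: "l \<in> {3..n}" and k: "k \<in> {1..<l}" "k \<noteq> ia l" and nz: "bracket V (k, ia l) \<noteq> 0"
  shows "bracket V (k, l) \<noteq> 0" "val (k, l) = single (yv l) 1 + val (k, ia l)"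
proof -
  let ?P = "var_poly (yv l) * bracket V (k, ia l)" and ?Q = "var_poly (zv l) * bracket V (k, ja l)"
  have "k \<in> {1..n}" "ia l \<in> {1..n}" "ja l \<in> {1..n}" using l k ij[OF l] by auto
  then have old: "in_older l (bracket V (k, ia l))" "in_older l (bracket V (k, ja l))"
    using bracket_older[of "(k, ia l)" l] bracket_older[of "(k, ja l)" l] k ij[OF l] by auto
  have P: "?P \<noteq> 0" using nz by (simp add: var_poly_neq_0)
  have lP: "lead ?P = single (yv l) 1 + val (k, ia l)"
    using nz by (simp add: lead_mult var_poly_neq_0 lead_var_poly val_def)
  have v: "older l (val (k, ia l))"
    using old(1) lead_in_keys[OF nz] by (simp add: in_older_def val_def)
  have "u < lead ?P" if u: "u \<in> keys ?Q" for u
  proof -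
    obtain b where b: "u = single (zv l) 1 + b" "b \<in> keys (bracket V (k, ja l))"
      using u by (auto elim!: keys_multE simp: var_poly_def)
    have ob: "older l b" using b(2) old(2) by (simp add: in_older_def)
    show ?thesis unfolding lP b(1)
      using v ob l by (intro less_exponentI[OF l] older_add older_single)
        (auto intro: older_mono simp: lookup_add lookup_single when_def older_def yv_neq_zv[symmetric])
  qed
  from lead_add[OF P this] show "bracket V (k, l) \<noteq> 0" "val (k, l) = single (yv l) 1 + val (k, ia l)"
    unfolding val_def[of "(k, l)"] bracket_rec[OF l] lP by auto
qed

lemma bracket_nonzero: "i \<in> {1..n} \<Longrightarrow> j \<in> {1..n} \<Longrightarrow> i \<noteq> j \<Longrightarrow> bracket V (i, j) \<noteq> 0"
proof -
  have *: "bracket V (k, l) \<noteq> 0" if "1 \<le> k" "k < l" "l \<le> n" for k l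
    using that
  proof (induction l arbitrary: k rule: less_induct)
    case (less l)
    consider "k = 1" "l = 2" | "l \<in> {3..n}" using less.prems by fastforce
    then show ?case
    proof cases
      case 1
      then show ?thesis by (simp add: bracket_def)
    next
      case 2
      have IH: "bracket V (i, j) \<noteq> 0" if "i \<in> {1..<l}" "j \<in> {1..<l}" "i \<noteq> j" for i j
        using less.IH[of j i] less.IH[of i j] that less.prems bracket_swap[of V i j]
        by (cases i j rule: linorder_cases) auto
      show ?thesis
      proof (cases "k = ia l")
        case True
        have "bracket V (ia l, ia l) = 0" by (simp add: bracket_def)
        then show ?thesis using bracket_rec[OF 2, of k] IH[of "ia l" "ja l"] ij[OF 2] True
          by (simp add: var_poly_neq_0)
      next
        case False
        then show ?thesis using bracket_rec_lead(1)[OF 2, of k] IH[of k "ia l"] ij[OF 2] less.prems by auto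
      qed
    qed
  qed
  assume "i \<in> {1..n}" "j \<in> {1..n}" "i \<noteq> j"
  then show ?thesis using *[of i j] *[of j i] bracket_swap[of V i j] by (cases i j rule: linorder_cases) auto
qed

lemma val_rec_y:
  assumes "l \<in> {3..n}" "k \<in> {1..<l}" "k \<noteq> ia l"
  shows "val (k, l) = single (yv l) 1 + val (k, ia l)"
  using assms ij[OF assms(1)] by (intro bracket_rec_lead(2) bracket_nonzero) auto

text \<open>For \<open>k = a\<close> the first summand of \<open>[k l]\<close> vanishes.\<close>

lemma val_rec_z:
  assumes "l \<in> {3..n}"
  shows "val (ia l, l) = single (zv l) 1 + val (ia l, ja l)"
proof -
  have "bracket V (ia l, ia l) = 0" by (simp add: bracket_def)
  then have "bracket V (ia l, l) = var_poly (zv l) * bracket V (ia l, ja l)"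
    using bracket_rec[OF assms, of "ia l"] by simp
  moreover have "bracket V (ia l, ja l) \<noteq> 0" using assms ij[OF assms] by (intro bracket_nonzero) auto
  ultimately show ?thesis by (simp add: val_def lead_mult var_poly_neq_0 lead_var_poly)
qed

lemma val_12: "val (1, 2) = 0"
  by (simp add: val_def bracket_def lead_one)

text \<open>The strict inequality makes \<open>y_bounded l e\<close> describe what remains below a top power \<open>y\<^sub>l ^ e\<close>, and
  \<open>y_bounded l (Suc 0)\<close> the polynomials in \<open>z\<^sub>l\<close> and variables of smaller index.\<close>

definition y_bounded :: "nat \<Rightarrow> nat \<Rightarrow> ('d, complex) mpoly \<Rightarrow> bool" where
  "y_bounded l e P \<longleftrightarrow> (\<forall>u\<in>keys P. older (Suc l) u \<and> lookup u (yv l) < e)"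

lemma y_bounded_simps:
  assumes l: "l \<in> {3..n}"
  shows "y_bounded l e 0"
    "y_bounded l e P \<Longrightarrow> y_bounded l e Q \<Longrightarrow> y_bounded l e (P + Q)"
    "y_bounded l e P \<Longrightarrow> y_bounded l (Suc e') Q \<Longrightarrow> y_bounded l (e + e') (P * Q)"
    "in_older l P \<Longrightarrow> y_bounded l (Suc 0) P"
    "y_bounded l (Suc 0) (var_poly (zv l))"
    "y_bounded l (Suc e) (var_poly (yv l) ^ e)"
proof -
  show "y_bounded l e P \<Longrightarrow> y_bounded l e Q \<Longrightarrow> y_bounded l e (P + Q)"
    unfolding y_bounded_def using Poly_Mapping.keys_add[of P Q] by blast
  show "y_bounded l e P \<Longrightarrow> y_bounded l (Suc e') Q \<Longrightarrow> y_bounded l (e + e') (P * Q)"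
    unfolding y_bounded_def by (fastforce elim!: keys_multE intro: older_add simp: lookup_add)
  show "in_older l P \<Longrightarrow> y_bounded l (Suc 0) P"
    unfolding in_older_def y_bounded_def using l by (auto intro: older_mono simp: older_def)
  show "y_bounded l (Suc 0) (var_poly (zv l))"
    using l by (auto simp: y_bounded_def var_poly_def older_single lookup_single when_def yv_neq_zv[symmetric])
  show "y_bounded l (Suc e) (var_poly (yv l) ^ e)"
    using l by (auto simp: y_bounded_def var_poly_power older_single lookup_single)
qed (auto simp: y_bounded_def)

lemma y_bounded_mono: "y_bounded l e P \<Longrightarrow> e \<le> e' \<Longrightarrow> y_bounded l e' P"
  by (force simp: y_bounded_def)

lemma y_bounded_mult:
  assumes "l \<in> {3..n}" "y_bounded l (Suc e) P" "y_bounded l (Suc e') Q"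
  shows "y_bounded l (Suc (e + e')) (P * Q)"
  using y_bounded_simps(3)[OF assms] by simp

text \<open>Each bracket containing \<open>l\<close> is \<open>y\<^sub>l\<close> times the bracket with \<open>l\<close> replaced by \<open>a\<close>, plus a term without
  \<open>y\<^sub>l\<close>; so the coefficient of the top power of \<open>y\<^sub>l\<close> in the product is obtained by replacing \<open>v\<^sub>l\<close> by
  \<open>v\<^sub>a\<close>.\<close>

lemma bmon_top_degree:
  assumes l: "l \<in> {3..n}" and "ps \<in> bracket_lists l"
  shows "y_bounded l (multideg ps l)
      (bmon V ps - var_poly (yv l) ^ multideg ps l * bmon (V(l := V (ia l))) ps)
    \<and> in_older l (bmon (V(l := V (ia l))) ps)"
  using assms(2)
proof (induction ps)
  case Nil
  show ?case using l by (simp add: y_bounded_simps in_older_ring)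
next
  case (Cons p ps)
  let ?W = "V(l := V (ia l))" and ?y = "var_poly (yv l) :: ('d, complex) mpoly"
    and ?z = "var_poly (zv l) :: ('d, complex) mpoly"
  define e where "e = multideg ps l"
  define D where "D = bmon V ps - ?y ^ e * bmon ?W ps"
  have bV: "bmon V ps = ?y ^ e * bmon ?W ps + D" by (simp add: D_def)
  have p: "fst p \<in> {1..l}" "snd p \<in> {1..l}" "fst p \<noteq> snd p" and ps: "ps \<in> bracket_lists l"
    using Cons.prems by (auto simp: bracket_lists_def)
  have D: "y_bounded l e D" and W: "in_older l (bmon ?W ps)"
    using Cons.IH[OF ps] unfolding D_def e_def by blast+
  have ln: "l \<le> n" "ia l \<in> {1..<l}" "ja l \<in> {1..<l}" using l ij[OF l] by auto
  have "in_older l (fst (?W i)) \<and> in_older l (snd (?W i))" if "i \<in> {1..l}" for i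
    using V_older[of i l] V_older[of "ia l" l] that ln by auto
  from this[OF p(1)] this[OF p(2)] have brW: "in_older l (bracket ?W p)"
    by (simp add: bracket_def in_older_ring)
  have old: "in_older l (bmon ?W (p # ps))" using brW W by (simp add: in_older_ring)
  show ?case
  proof (cases "fst p = l \<or> snd p = l")
    case False
    then have bracket: "bracket V p = bracket ?W p" and e': "multideg (p # ps) l = e"
      by (simp_all add: bracket_def multideg_Cons occ_def e_def)
    have "bmon V (p # ps) - ?y ^ e * bmon ?W (p # ps) = D * bracket ?W p"
      by (simp add: bracket bV algebra_simps)
    moreover have "y_bounded l (e + 0) (D * bracket ?W p)"
      using D y_bounded_simps(4)[OF l brW] by (rule y_bounded_simps(3)[OF l])
    ultimately have "y_bounded l e (bmon V (p # ps) - ?y ^ e * bmon ?W (p # ps))"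
      by (simp only: add_0_right)
    with old show ?thesis unfolding e' by blast
  next
    case True
    then have e': "multideg (p # ps) l = Suc e"
      using p(3) by (auto simp: multideg_Cons occ_def e_def)
    obtain Q where Q: "bracket V p = ?y * bracket ?W p + ?z * Q" "in_older l Q"
    proof (cases "snd p = l")
      case True
      then obtain k where p': "p = (k, l)" "k \<in> {1..<l}" "k \<noteq> l" using p by (cases p) auto
      have "bracket V p = ?y * bracket ?W p + ?z * bracket V (k, ja l)"
        using bracket_rec[OF l, of k] p' by (simp add: bracket_def)
      moreover have "in_older l (bracket V (k, ja l))" using p' ln by (intro bracket_older) auto
      ultimately show thesis by (rule that)
    next
      case False
      with True p obtain k where p': "p = (l, k)" "k \<in> {1..<l}" "k \<noteq> l" by (cases p) auto
      have "bracket V (l, k) = - (?y * bracket V (k, ia l) + ?z * bracket V (k, ja l))"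
        using bracket_rec[OF l, of k] bracket_swap[of V l k] by simp
      moreover have "bracket ?W p = - bracket V (k, ia l)"
        using p' by (simp add: bracket_def)
      ultimately have "bracket V p = ?y * bracket ?W p + ?z * - bracket V (k, ja l)"
        by (simp add: p'(1) algebra_simps)
      moreover have "in_older l (- bracket V (k, ja l))" using p' ln by (intro in_older_ring bracket_older) auto
      ultimately show thesis by (rule that)
    qed
    have eq: "bmon V (p # ps) - ?y ^ Suc e * bmon ?W (p # ps)
      = (?y ^ 1 * bracket ?W p) * D + ((?z * Q) * ((?y ^ e) * bmon ?W ps) + (?z * Q) * D)"
      by (simp add: Q(1) bV algebra_simps)
    note yb = y_bounded_simps[OF l]
    have zQ: "y_bounded l (Suc 0) (?z * Q)" using y_bounded_mult[OF l yb(5) yb(4)[OF Q(2)]] by simp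
    have 1: "y_bounded l (Suc 1) (?y ^ 1 * bracket ?W p)"
      using y_bounded_mult[OF l yb(6)[of 1] yb(4)[OF brW]] by simp
    have a: "y_bounded l (e + 1) (D * (?y ^ 1 * bracket ?W p))" using D 1 by (rule yb(3))
    have b: "y_bounded l (Suc e) ((?z * Q) * ((?y ^ e) * bmon ?W ps))"
      using y_bounded_mult[OF l zQ y_bounded_mult[OF l yb(6)[of e] yb(4)[OF W]]] by simp
    have c: "y_bounded l (e + 0) (D * (?z * Q))" using D zQ by (rule yb(3))
    have "y_bounded l (Suc e) (bmon V (p # ps) - ?y ^ Suc e * bmon ?W (p # ps))"
      unfolding eq using a b y_bounded_mono[OF c, of "Suc e"]
      by (intro yb(2)) (simp_all add: mult.commute)
    with old show ?thesis unfolding e' by blast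
  qed
qed

lemma bspan_top_degree:
  assumes l: "l \<in> {3..n}" and "f \<in> bspan (bracket_gens l d)"
  shows "y_bounded l (d l) (f V - var_poly (yv l) ^ d l * f (V(l := V (ia l))))"
  using assms(2)
proof (induction rule: bspan.induct)
  case bspan_zero
  show ?case using l by (simp add: y_bounded_simps)
next
  case (bspan_step ps f c)
  let ?D = "\<lambda>f. f V - var_poly (yv l) ^ d l * f (V(l := V (ia l)))"
  have ps: "ps \<in> bracket_lists l" "multideg ps = d" using bspan_step(1) by (auto simp: bracket_gens_def)
  have "y_bounded l (d l + 0) (?D (\<lambda>v. bmon v ps) * const_poly c)"
    using bmon_top_degree[OF l ps(1)] y_bounded_simps(4)[OF l in_older_ring(4)] unfolding ps(2)
    by (intro y_bounded_simps(3)[OF l]) auto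
  moreover have "?D (\<lambda>v. const_poly c * bmon v ps + f v) = ?D (\<lambda>v. bmon v ps) * const_poly c + ?D f"
    by (simp add: algebra_simps)
  ultimately show ?case using bspan_step.IH by (simp only: y_bounded_simps(2)[OF l] add_0_right)
qed

text \<open>The converse of merging \<open>l\<close> into \<open>a\<close> on the level of values: since \<open>v(k l) = y\<^sub>l + v(k a)\<close>, any \<open>e\<close>
  occurrences of \<open>a\<close> can be turned into \<open>l\<close> at the cost of \<open>e\<close> times the unit vector of \<open>y\<^sub>l\<close>.\<close>

lemma unmerge:
  assumes l: "l \<in> {3..n}" and "ps' \<in> bracket_lists (l - 1)" "e \<le> multideg ps' (ia l)"
  shows "\<exists>ps\<in>bracket_lists l.
    multideg ps = (multideg ps')(l := e, ia l := multideg ps' (ia l) - e) \<and>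
    sum_list (map val ps) = single (yv l) e + sum_list (map val ps')"
  using assms(2,3)
proof (induction ps' arbitrary: e)
  case Nil
  then show ?case by (intro bexI[of _ "[]"]) (auto simp: bracket_lists_def fun_eq_iff)
next
  case (Cons p ps')
  let ?a = "ia l"
  have a: "?a \<in> {1..<l}" using ij[OF l] by blast
  have p: "fst p \<in> {1..<l}" "snd p \<in> {1..<l}" "fst p \<noteq> snd p" and ps': "ps' \<in> bracket_lists (l - 1)"
    using Cons.prems(1) by (auto simp: bracket_lists_def)
  have pl: "occ p l = 0" using p by (auto simp: occ_def)
  have psl: "multideg qs l = 0" if "qs \<in> bracket_lists (l - 1)" for qs
    using that a by (induction qs) (auto simp: bracket_lists_def multideg_Cons occ_def)
  have "l \<noteq> ?a" using a by auto
  show ?case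
  proof (cases "e > 0 \<and> occ p ?a > 0")
    case True
    obtain k where k: "p = (?a, k) \<or> p = (k, ?a)" "k \<noteq> ?a" "k \<in> {1..<l}"
      using True p by (cases p) (auto simp: occ_def of_bool_def split: if_splits)
    have ok: "occ p x = occ (k, ?a) x" for x using k by (auto simp: occ_def)
    have vk: "val p = val (k, ?a)" using k val_swap[of ?a k] by auto
    have "e - 1 \<le> multideg ps' ?a"
      using Cons.prems(2) k by (auto simp: multideg_Cons ok occ_def)
    then obtain ps where ps: "ps \<in> bracket_lists l"
      "multideg ps = (multideg ps')(l := e - 1, ?a := multideg ps' ?a - (e - 1))"
      "sum_list (map val ps) = single (yv l) (e - 1) + sum_list (map val ps')"
      using Cons.IH[OF ps'] by blast
    have "(k, l) # ps \<in> bracket_lists l" using ps(1) k by (auto simp: bracket_lists_def)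
    moreover have "multideg ((k, l) # ps) = (multideg (p # ps'))(l := e, ?a := multideg (p # ps') ?a - e)"
      using True k \<open>l \<noteq> ?a\<close> psl[OF ps']
      by (auto simp: fun_eq_iff multideg_Cons ok ps(2) occ_def)
    moreover have "sum_list (map val ((k, l) # ps)) = single (yv l) e + sum_list (map val (p # ps'))"
    proof -
      have "single (yv l) e = single (yv l) 1 + single (yv l) (e - 1)"
        using True by (simp add: single_add[symmetric])
      then show ?thesis
        by (simp add: ps(3) vk val_rec_y[OF l k(3,2)] algebra_simps)
    qed
    ultimately show ?thesis by blast
  next
    case False
    have "e \<le> multideg ps' ?a" using False Cons.prems(2) by (auto simp: multideg_Cons)
    then obtain ps where ps: "ps \<in> bracket_lists l"
      "multideg ps = (multideg ps')(l := e, ?a := multideg ps' ?a - e)"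
      "sum_list (map val ps) = single (yv l) e + sum_list (map val ps')"
      using Cons.IH[OF ps'] by blast
    have "p # ps \<in> bracket_lists l" using ps(1) p by (auto simp: bracket_lists_def case_prod_unfold)
    moreover have "multideg (p # ps) = (multideg (p # ps'))(l := e, ?a := multideg (p # ps') ?a - e)"
      using \<open>l \<noteq> ?a\<close> pl \<open>e \<le> multideg ps' ?a\<close> by (auto simp: fun_eq_iff multideg_Cons ps(2))
    moreover have "sum_list (map val (p # ps)) = single (yv l) e + sum_list (map val (p # ps'))"
      by (simp add: ps(3) algebra_simps)
    ultimately show ?thesis by blast
  qed
qed

lemma bspan_two_vectors:
  fixes f :: "('v, complex) mpoly vectors \<Rightarrow> _"
  assumes "f \<in> bspan (bracket_gens 2 d)"
  shows "\<exists>c. \<forall>v. f v = const_poly c * bracket v (1, 2) ^ d 1"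
  using assms
proof (induction rule: bspan.induct)
  case bspan_zero
  show ?case by (rule exI[of _ 0]) (simp add: const_poly_simps)
next
  case (bspan_step ps f c)
  then obtain c' where c': "\<And>v. f v = const_poly c' * bracket v (1, 2) ^ d 1" by blast
  have ps: "ps \<in> bracket_lists 2" "multideg ps = d" using bspan_step(1) by (auto simp: bracket_gens_def)
  have "\<exists>s. \<forall>v :: ('v, complex) mpoly vectors. bmon v ps = const_poly s * bracket v (1, 2) ^ multideg ps 1"
    using ps(1)
  proof (induction ps)
    case Nil
    show ?case by (rule exI[of _ 1]) (simp add: const_poly_simps)
  next
    case (Cons p ps)
    then obtain s where s: "\<And>v :: ('v, complex) mpoly vectors. bmon v ps = const_poly s * bracket v (1, 2) ^ multideg ps 1"
      by (auto simp: bracket_lists_def)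
    have "fst p \<in> {1, 2}" "snd p \<in> {1, 2}" "fst p \<noteq> snd p"
      using Cons.prems by (auto simp: bracket_lists_def)
    then have "p = (1, 2) \<or> p = (2, 1)" by (cases p) auto
    then show ?case
    proof
      assume "p = (1, 2)"
      then show ?thesis by (intro exI[of _ s]) (simp add: s multideg_Cons occ_def algebra_simps)
    next
      assume "p = (2, 1)"
      then show ?thesis
        by (intro exI[of _ "- s"]) (simp add: s multideg_Cons occ_def bracket_swap[of _ 2 "Suc 0"] const_poly_simps algebra_simps)
    qed
  qed
  then obtain s where "\<And>v :: ('v, complex) mpoly vectors. bmon v ps = const_poly s * bracket v (1, 2) ^ d 1" unfolding ps(2) by blast
  then show ?case
    by (intro exI[of _ "c * s + c'"]) (simp add: c' const_poly_simps algebra_simps)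
qed

text \<open>The outer induction removes the last vector, the inner one lowers the degree in \<open>v\<^sub>l\<close> by splitting
  off factors \<open>[a l]\<close>. For two vectors only powers of \<open>[1 2]\<close> remain, and \<open>[1 2]\<close> evaluates to \<open>1\<close>.\<close>

theorem lead_bspan:
  assumes "2 \<le> l" "l \<le> n" "f \<in> bspan (bracket_gens l d)" "f \<noteq> (\<lambda>v. 0)"
  shows "f V \<noteq> 0 \<and> (\<exists>ps\<in>bracket_gens l d. lead (f V) = sum_list (map val ps))"
  using assms
proof (induction l arbitrary: f d rule: dec_induct)
  case base
  obtain c where c: "\<And>v. f v = const_poly c * bracket v (1, 2) ^ d 1" using bspan_two_vectors base by blast
  have "bracket V (1, 2) = 1" by (simp add: bracket_def)
  then have fV: "f V = const_poly c" using c[of V] by simp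
  have "c \<noteq> 0" using c base(3) by (auto simp: const_poly_simps)
  then have f: "f V \<noteq> 0" "lead (f V) = 0"
    using fV lead_single[of c "0 :: 'd \<Rightarrow>\<^sub>0 nat"] by (auto simp: const_poly_def dest: arg_cong[where f=keys])
  have "bracket_gens 2 d \<noteq> {}" using base(2,3) bspan_empty[of f] by auto
  then obtain ps where ps: "ps \<in> bracket_gens 2 d" by blast
  have "val p = 0" if "p \<in> set ps" for p
  proof -
    have "fst p \<in> {1, 2}" "snd p \<in> {1, 2}" "fst p \<noteq> snd p"
      using that ps by (auto simp: bracket_gens_def bracket_lists_def)
    then have "p = (1, 2) \<or> p = (2, 1)" by (cases p) auto
    then show ?thesis using val_12 val_swap[of 2 1] by auto
  qed
  then have "sum_list (map val ps) = 0" by (induction ps) auto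
  with f ps show ?case by auto
next
  case (step m)
  define l where "l = Suc m"
  have l: "l \<in> {3..n}" using step by (auto simp: l_def)
  let ?a = "ia l"
  have a: "?a \<in> {1..<l}" using ij[OF l] by blast
  have "f \<in> bspan (bracket_gens l d)" "f \<noteq> (\<lambda>v. 0)" using step by (auto simp: l_def)
  then have "f V \<noteq> 0 \<and> (\<exists>ps\<in>bracket_gens l d. lead (f V) = sum_list (map val ps))"
  proof (induction "d l" arbitrary: f d rule: less_induct)
    case less
    define g where "g v = f (v(l := v ?a))" for v
    have g: "g \<in> bspan (bracket_gens m (d(l := 0, ?a := d ?a + d l)))"
      using bspan_merge[OF less.prems(1) a] unfolding g_def by (simp add: l_def)
    show ?case
    proof (cases "g = (\<lambda>v. 0)")
      case True
      have "f \<in> bspan (bracket_ideal ?a l d)"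
        by (rule bracket_divisibility[OF _ _ less.prems(1)]) (use a True in \<open>auto simp: g_def fun_eq_iff\<close>)
      have "bracket_ideal ?a l d \<noteq> {}"
        using \<open>f \<in> bspan (bracket_ideal ?a l d)\<close> less.prems(2) bspan_empty[of f] by auto
      then obtain qs where qs: "multideg ((?a, l) # qs) = d" by (auto simp: bracket_ideal_def)
      define d' where "d' = multideg qs"
      have d: "d x = occ (?a, l) x + d' x" for x using qs by (auto simp: d'_def multideg_Cons)
      have "\<exists>h\<in>bspan (bracket_gens l d'). \<forall>v. f v = bracket v (?a, l) * h v"
        using \<open>f \<in> bspan (bracket_ideal ?a l d)\<close>
      proof (induction rule: bspan.induct)
        case bspan_zero
        show ?case by (rule bexI[OF _ bspan.bspan_zero]) simp
      next
        case (bspan_step ps f c)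
        then obtain h where h: "h \<in> bspan (bracket_gens l d')" "\<And>v. f v = bracket v (?a, l) * h v" by blast
        obtain ts where ts: "ps = (?a, l) # ts" "ts \<in> bracket_lists l" "multideg ((?a, l) # ts) = d"
          using bspan_step(1) by (auto simp: bracket_ideal_def)
        have "multideg ts x = d' x" for x using d[of x] ts(3) by (auto simp: multideg_Cons)
        then have "ts \<in> bracket_gens l d'" using ts(2) by (auto simp: bracket_gens_def)
        from bspan.bspan_step[OF this h(1), of c] show ?case
          by (rule bexI[rotated]) (simp add: ts(1) h(2) algebra_simps)
      qed
      then obtain h where h: "h \<in> bspan (bracket_gens l d')" "\<And>v. f v = bracket v (?a, l) * h v" by blast
      have "h \<noteq> (\<lambda>v. 0)" using less.prems(2) h(2) by auto
      moreover have "d' l < d l" using d[of l] by (simp add: occ_def)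
      ultimately obtain ps where ps: "h V \<noteq> 0" "ps \<in> bracket_gens l d'" "lead (h V) = sum_list (map val ps)"
        using less.hyps[of d' h] h(1) by blast
      have bracket: "bracket V (?a, l) \<noteq> 0" using a l by (intro bracket_nonzero) auto
      have "(?a, l) # ps \<in> bracket_gens l d"
        using ps(2) a d by (auto simp: bracket_gens_def bracket_lists_def fun_eq_iff multideg_Cons)
      moreover have "lead (f V) = sum_list (map val ((?a, l) # ps))"
        using bracket ps by (simp add: h(2) lead_mult val_def)
      moreover have "f V \<noteq> 0" using bracket ps(1) h(2) by auto
      ultimately show ?thesis by blast
    next
      case False
      obtain ps' where ps': "g V \<noteq> 0" "ps' \<in> bracket_gens m (d(l := 0, ?a := d ?a + d l))"
        "lead (g V) = sum_list (map val ps')"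
        using step.IH[OF _ g False] step.prems(1) Suc_leD by blast
      let ?P = "var_poly (yv l) ^ d l * g V"
      have Y: "var_poly (yv l) ^ d l \<noteq> (0 :: ('d, complex) mpoly)" by (simp add: var_poly_neq_0)
      have P: "?P \<noteq> 0" using ps'(1) Y by simp
      have lP: "lead ?P = single (yv l) (d l) + lead (g V)"
        using ps'(1) Y by (simp add: lead_mult) (simp add: var_poly_power lead_single)
      have "in_older l (g V)" using g l by (rule_tac bspan_older) (auto simp: l_def)
      then have old: "older l (lead (g V))" using lead_in_keys[OF ps'(1)] by (simp add: in_older_def)
      have rest: "y_bounded l (d l) (f V - ?P)"
        using bspan_top_degree[OF l less.prems(1)] by (simp add: g_def)
      have small: "u < lead ?P" if "u \<in> keys (f V - ?P)" for u
        unfolding lP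
      proof (rule less_exponentI[OF l])
        show "older (Suc l) u" using rest that by (simp add: y_bounded_def)
        show "older (Suc l) (single (yv l) (d l) + lead (g V))"
          using l old by (intro older_add older_single) (auto intro: older_mono)
        show "lookup u (yv l) < lookup (single (yv l) (d l) + lead (g V)) (yv l)"
          using rest that by (force simp: y_bounded_def lookup_add)
      qed
      have f: "f V \<noteq> 0" "lead (f V) = lead ?P"
        using lead_add[OF P, of "f V - ?P"] small by auto
      have psm: "ps' \<in> bracket_lists (l - 1)" "multideg ps' = d(l := 0, ?a := d ?a + d l)"
        using ps'(2) by (auto simp: bracket_gens_def l_def)
      obtain ps where ps: "ps \<in> bracket_lists l"
        "multideg ps = (multideg ps')(l := d l, ?a := multideg ps' ?a - d l)"
        "sum_list (map val ps) = single (yv l) (d l) + sum_list (map val ps')"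
        using unmerge[OF l psm(1), of "d l"] by (auto simp: psm(2))
      have "multideg ps = d" unfolding ps(2) psm(2) using a by (auto simp: fun_eq_iff)
      then have "ps \<in> bracket_gens l d" using ps(1) by (simp add: bracket_gens_def)
      moreover have "lead (f V) = sum_list (map val ps)" using f lP ps(3) ps'(3) by simp
      ultimately show ?thesis using f(1) by blast
    qed
  qed
  then show ?case by (simp add: l_def)
qed

end

section \<open>The rows of the matrix product\<close>

definition nth_index :: "nat \<Rightarrow> 'd::{finite,linorder}" where
  "nth_index p = sorted_list_of_set UNIV ! p"

lemma nth_index_less:
  "p < q \<Longrightarrow> q < CARD('d) \<Longrightarrow> nth_index p < (nth_index q :: 'd::{finite,linorder})"
  unfolding nth_index_def
  using sorted_wrt_nth_less[OF strict_sorted_list_of_set[of "UNIV :: 'd set"]] by simp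

lemma nth_index_image: "nth_index ` {..<CARD('d)} = (UNIV :: 'd::{finite,linorder} set)"
proof -
  have "set (sorted_list_of_set (UNIV :: 'd set)) = UNIV" by simp
  then show ?thesis unfolding nth_index_def set_conv_nth by (auto simp: image_def)
qed

lemma card_below_nth_index:
  assumes "p < CARD('d)"
  shows "card {..<nth_index p :: 'd::{finite,linorder}} = p"
proof -
  have "{..<nth_index p :: 'd} = nth_index ` {..<p}"
  proof (intro equalityI subsetI)
    fix k :: 'd assume k: "k \<in> {..<nth_index p}"
    obtain q where q: "q < CARD('d)" "k = nth_index q" using nth_index_image[where 'd='d] by blast
    then have "q < p" using k nth_index_less[of p q, where 'd='d] by (cases q p rule: linorder_cases) auto
    then show "k \<in> nth_index ` {..<p}" using q by blast
  qed (use assms nth_index_less in auto)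
  moreover have "inj_on (nth_index :: nat \<Rightarrow> 'd) {..<p}"
  proof (rule inj_onI)
    fix q r assume *: "q \<in> {..<p}" "r \<in> {..<p}" "(nth_index q :: 'd) = nth_index r"
    show "q = r" using nth_index_less[of q r, where 'd='d] nth_index_less[of r q, where 'd='d] * assms
      by (cases q r rule: linorder_cases) auto
  qed
  ultimately show ?thesis by (simp add: card_image)
qed

lemma root_at_nth_index: "p < CARD('d) \<Longrightarrow> root_at S (nth_index p :: 'd::{finite,linorder}) = S ! p"
  by (simp add: root_at_def card_below_nth_index)

lemma nth_concat_pairs:
  "p < length xs \<Longrightarrow> concat (map (\<lambda>x. [f x, g x]) xs) ! (2 * p) = f (xs ! p) \<and>
    concat (map (\<lambda>x. [f x, g x]) xs) ! Suc (2 * p) = g (xs ! p)"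
proof (induction xs arbitrary: p)
  case (Cons x xs)
  then show ?case by (cases p) auto
qed simp

text \<open>The product of all factors but the first \<open>p\<close>. The tail that starts at \<open>p = 2 * (n - l)\<close> consists of the
  factors of the roots ending at \<open>3, \<dots>, l\<close>.\<close>

definition tail_product :: "nat \<Rightarrow> root list \<Rightarrow> nat \<Rightarrow> ('d::{finite,linorder}, complex) mpoly mat" where
  "tail_product n S p = foldr (*)
     (map (\<lambda>k. 1\<^sub>m n + var_poly k \<cdot>\<^sub>m root_matrix n (root_at S k)) (drop p (sorted_list_of_set UNIV)))
     (1\<^sub>m n)"

lemma psi_eq_tail_product: "psi n S = tail_product n S 0"
  by (simp add: psi_def tail_product_def)

lemma root_matrix_carrier: "root_matrix n \<beta> \<in> carrier_mat n n"
  by (cases \<beta>) (simp add: root_matrix_def)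

lemma tail_product_carrier: "tail_product n S p \<in> carrier_mat n n"
proof -
  have "foldr (*) (map (\<lambda>k. 1\<^sub>m n + var_poly k \<cdot>\<^sub>m root_matrix n (root_at S k)) ks) (1\<^sub>m n) \<in> carrier_mat n n"
    for ks :: "'d::{finite,linorder} list"
    by (induction ks) (auto simp: root_matrix_carrier intro!: mult_carrier_mat add_carrier_mat)
  then show ?thesis unfolding tail_product_def .
qed

text \<open>Multiplication on the left by \<open>1 + y f\<close> for the root \<open>(i, j)\<close> adds \<open>y\<close> times row \<open>i\<close> to row \<open>j\<close>.\<close>

lemma elementary_row_action:
  fixes X :: "'a::comm_ring_1 mat"
  assumes X: "X \<in> carrier_mat n n" and "r < n" "c < n" "1 \<le> i" "i \<le> n"
  shows "((1\<^sub>m n + y \<cdot>\<^sub>m root_matrix n (i, j)) * X) $$ (r, c)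
    = X $$ (r, c) + (if r = j - 1 then y * X $$ (i - 1, c) else 0)"
proof -
  have "((1\<^sub>m n + y \<cdot>\<^sub>m root_matrix n (i, j)) * X) $$ (r, c)
      = (\<Sum>t<n. ((if t = r then 1 else 0) + y * (if r = j - 1 \<and> t = i - 1 then 1 else 0)) * X $$ (t, c))"
    using assms
    by (simp add: times_mat_def scalar_prod_def root_matrix_def lessThan_atLeast0)
  also have "\<dots> = (\<Sum>t<n. (if t = r then X $$ (t, c) else 0)
      + (if t = i - 1 then (if r = j - 1 then y * X $$ (t, c) else 0) else 0))"
    by (intro sum.cong refl) (auto simp: algebra_simps)
  also have "\<dots> = X $$ (r, c) + (if r = j - 1 then y * X $$ (i - 1, c) else 0)"
    using assms by (simp add: sum.distrib)
  finally show ?thesis .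
qed

lemma tail_product_step:
  assumes "p < CARD('d)" "S ! p = (i, j)" "r < n" "c < n" "1 \<le> i" "i \<le> n"
  shows "tail_product n S p $$ (r, c) = (tail_product n S (Suc p) :: ('d::{finite,linorder}, complex) mpoly mat) $$ (r, c)
    + (if r = j - 1 then var_poly (nth_index p) * tail_product n S (Suc p) $$ (i - 1, c) else 0)"
proof -
  have "drop p (sorted_list_of_set (UNIV :: 'd set)) = nth_index p # drop (Suc p) (sorted_list_of_set UNIV)"
    using assms(1) by (simp add: nth_index_def Cons_nth_drop_Suc)
  then have "tail_product n S p
      = (1\<^sub>m n + var_poly (nth_index p) \<cdot>\<^sub>m root_matrix n (i, j)) * (tail_product n S (Suc p) :: ('d, complex) mpoly mat)"
    using assms(1,2) by (simp add: tail_product_def root_at_nth_index)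
  then show ?thesis
    by (simp only: elementary_row_action[OF tail_product_carrier assms(3-6)])
qed

lemma tail_product_end: "tail_product n S CARD('d) = (1\<^sub>m n :: ('d::{finite,linorder}, complex) mpoly mat)"
  by (simp add: tail_product_def)

definition psi_vectors :: "nat \<Rightarrow> root list \<Rightarrow> ('d::{finite,linorder}, complex) mpoly vectors" where
  "psi_vectors n S i = (psi n S $$ (i - 1, 0), psi n S $$ (i - 1, 1))"

lemma psi_minor_eq_bracket: "psi_minor n S p = bracket (psi_vectors n S) p"
  by (cases p) (simp add: psi_minor_def bracket_def psi_vectors_def)

text \<open>An iterated sequence together with the indices that define it. The last parameter only fixes the
  type that indexes the coordinates.\<close>

locale iterated_roots =
  fixes n :: nat and ia ja :: "nat \<Rightarrow> nat" and S :: "root list" and dim :: "'d::{finite,linorder} itself"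
  assumes n3: "n \<ge> 3" and card_d: "CARD('d) = 2 * (n - 2)"
    and ij: "l \<in> {3..n} \<Longrightarrow> ia l \<in> {1..<l} \<and> ja l \<in> {1..<l} \<and> ia l \<noteq> ja l"
    and S_def: "S = concat (map (\<lambda>l. [(ia l, l), (ja l, l)]) (rev [3..<Suc n]))"
begin

definition yv :: "nat \<Rightarrow> 'd" where "yv l = nth_index (2 * (n - l))"
definition zv :: "nat \<Rightarrow> 'd" where "zv l = nth_index (Suc (2 * (n - l)))"

lemma S_nth:
  assumes "l \<in> {3..n}"
  shows "S ! (2 * (n - l)) = (ia l, l)" "S ! Suc (2 * (n - l)) = (ja l, l)"
proof -
  have "rev [3..<Suc n] ! (n - l) = l" and "n - l < length (rev [3..<Suc n])"
    using assms by (auto simp: rev_nth simp del: upt_Suc)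
  then show "S ! (2 * (n - l)) = (ia l, l)" "S ! Suc (2 * (n - l)) = (ja l, l)"
    using nth_concat_pairs[of "n - l" "rev [3..<Suc n]" "\<lambda>l. (ia l, l)" "\<lambda>l. (ja l, l)"]
    unfolding S_def by metis+
qed

lemma position_bound: "l \<in> {3..n} \<Longrightarrow> Suc (2 * (n - l)) < CARD('d)"
  using n3 by (auto simp: card_d)

lemma root_at_yv: "l \<in> {3..n} \<Longrightarrow> root_at S (yv l) = (ia l, l)"
  and root_at_zv: "l \<in> {3..n} \<Longrightarrow> root_at S (zv l) = (ja l, l)"
  using position_bound[of l] by (simp_all add: yv_def zv_def root_at_nth_index S_nth)

lemma tail_product_rows:
  assumes l: "l \<in> {3..n}" and rc: "r < n" "c < 2"
  shows "tail_product n S (2 * (n - l)) $$ (r, c) = (tail_product n S (2 * (n - (l - 1))) :: ('d, complex) mpoly mat) $$ (r, c)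
    + (if r = l - 1 then var_poly (yv l) * tail_product n S (2 * (n - (l - 1))) $$ (ia l - 1, c)
         + var_poly (zv l) * tail_product n S (2 * (n - (l - 1))) $$ (ja l - 1, c) else 0)"
proof -
  note i = ij[OF l]
  have c: "c < n" using rc n3 by simp
  have nl: "2 * (n - (l - 1)) = Suc (Suc (2 * (n - l)))" using l by auto
  have il: "ia l - 1 < n" "ia l - 1 \<noteq> l - 1" "1 \<le> ia l" "ia l \<le> n" "1 \<le> ja l" "ja l \<le> n" using i l by auto
  note z = tail_product_step[OF position_bound[OF l] S_nth(2)[OF l] _ c il(5,6)]
  have yb: "2 * (n - l) < CARD('d)" using position_bound[OF l] by simp
  note y = tail_product_step[OF yb S_nth(1)[OF l] rc(1) c il(3,4)]
  show ?thesis
    unfolding y z[OF rc(1)] z[OF il(1)] nl yv_def zv_def using il(2) by (auto simp: algebra_simps)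
qed

text \<open>Rows beyond \<open>l\<close> have not been touched yet, so they are rows of the identity matrix.\<close>

lemma tail_product_new_rows:
  assumes "2 \<le> l" "l \<le> n" "l \<le> r" "r < n" "c < 2"
  shows "tail_product n S (2 * (n - l)) $$ (r, c) = (0 :: ('d, complex) mpoly)"
  using assms(1-3)
proof (induction l rule: dec_induct)
  case base
  have "tail_product n S (2 * (n - 2)) = (1\<^sub>m n :: ('d, complex) mpoly mat)"
    using tail_product_end[of n S, where 'd='d] by (simp add: card_d)
  then show ?case using assms base by simp
next
  case (step m)
  then show ?case using tail_product_rows[of "Suc m" r c] assms by simp
qed

text \<open>The factors still to come change later rows only.\<close>

lemma tail_product_old_rows:
  assumes "2 \<le> l" "l \<le> n" "r < l" "c < 2"
  shows "tail_product n S (2 * (n - l)) $$ (r, c) = (psi n S $$ (r, c) :: ('d, complex) mpoly)"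
  using assms(2,1,3)
proof (induction l rule: inc_induct)
  case base
  then show ?case by (simp add: psi_eq_tail_product)
next
  case (step m)
  then show ?case using tail_product_rows[of "Suc m" r c] assms(4) by auto
qed

lemma psi_row_rec:
  assumes l: "l \<in> {3..n}" and c: "c < 2"
  shows "psi n S $$ (l - 1, c) = var_poly (yv l) * psi n S $$ (ia l - 1, c)
    + (var_poly (zv l) * psi n S $$ (ja l - 1, c) :: ('d, complex) mpoly)"
proof -
  have i: "ia l - 1 < l - 1" "ja l - 1 < l - 1" using ij[OF l] by auto
  have "psi n S $$ (l - 1, c) = (tail_product n S (2 * (n - l)) $$ (l - 1, c) :: ('d, complex) mpoly)"
    using tail_product_old_rows[of l "l - 1" c] l c by auto
  also have "\<dots> = var_poly (yv l) * tail_product n S (2 * (n - (l - 1))) $$ (ia l - 1, c)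
         + var_poly (zv l) * tail_product n S (2 * (n - (l - 1))) $$ (ja l - 1, c)"
    using tail_product_rows[of l "l - 1" c] tail_product_new_rows[of "l - 1" "l - 1" c] l c by auto
  also have "\<dots> = var_poly (yv l) * psi n S $$ (ia l - 1, c) + var_poly (zv l) * psi n S $$ (ja l - 1, c)"
    using tail_product_old_rows[of "l - 1" "ia l - 1" c] tail_product_old_rows[of "l - 1" "ja l - 1" c] l c i
    by auto
  finally show ?thesis .
qed

lemma psi_first_rows:
  assumes "r < 2" "c < 2"
  shows "psi n S $$ (r, c) = (if r = c then 1 else 0 :: ('d, complex) mpoly)"
proof -
  have "tail_product n S (2 * (n - 2)) = (1\<^sub>m n :: ('d, complex) mpoly mat)"
    using tail_product_end[of n S, where 'd='d] by (simp add: card_d)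
  then show ?thesis using tail_product_old_rows[of 2 r c] assms n3 by simp
qed

sublocale iterated_vectors n ia ja yv zv "psi_vectors n S :: ('d, complex) mpoly vectors"
proof unfold_locales
  show "l \<in> {3..n} \<Longrightarrow> ia l \<in> {1..<l} \<and> ja l \<in> {1..<l} \<and> ia l \<noteq> ja l" for l by (rule ij)
  show "l \<in> {3..n} \<Longrightarrow> yv l < zv l" for l
    unfolding yv_def zv_def using position_bound[of l] by (intro nth_index_less) auto
  show "l \<in> {3..n} \<Longrightarrow> l' \<in> {3..n} \<Longrightarrow> l' < l \<Longrightarrow> zv l < yv l'" for l l'
    unfolding yv_def zv_def using position_bound[of l'] by (intro nth_index_less) auto
  show "UNIV = yv ` {3..n} \<union> zv ` {3..n}"
  proof -
    have "k \<in> yv ` {3..n} \<union> zv ` {3..n}" for k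
    proof -
      obtain p where p: "p < CARD('d)" "k = nth_index p" using nth_index_image[where 'd='d] by blast
      define l where "l = n - p div 2"
      have l: "l \<in> {3..n}" "n - l = p div 2" using p(1) n3 by (auto simp: l_def card_d)
      show ?thesis
      proof (cases "even p")
        case True
        then have "k = yv l" using l p by (simp add: yv_def)
        then show ?thesis using l by blast
      next
        case False
        then have "k = zv l" using l p by (simp add: zv_def)
        then show ?thesis using l by blast
      qed
    qed
    then show ?thesis by blast
  qed
  show "psi_vectors n S 1 = (1, 0 :: ('d, complex) mpoly)" "psi_vectors n S 2 = (0, 1 :: ('d, complex) mpoly)"
    using psi_first_rows[of 0] psi_first_rows[of 1] by (simp_all add: psi_vectors_def)
  show "l \<in> {3..n} \<Longrightarrow> psi_vectors n S l =
      (var_poly (yv l) * fst (psi_vectors n S (ia l)) + var_poly (zv l) * fst (psi_vectors n S (ja l)),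
       var_poly (yv l) * snd (psi_vectors n S (ia l)) + var_poly (zv l) * snd (psi_vectors n S (ja l)) :: ('d, complex) mpoly)"
    for l using psi_row_rec[of l 0] psi_row_rec[of l 1] by (simp add: psi_vectors_def)
qed

end

section \<open>Valuations and leading exponents\<close>

definition exponent_vec :: "('d::{finite,linorder} \<Rightarrow>\<^sub>0 nat) \<Rightarrow> int ^ 'd::{finite,linorder}" where
  "exponent_vec u = (\<chi> k. int (lookup u k))"

lemma exponent_vec_nth [simp]: "exponent_vec u $ k = int (lookup u k)"
  by (simp add: exponent_vec_def)

lemma exponents_eq: "exponents g = exponent_vec ` keys g"
  by (simp add: exponents_def exponent_vec_def)

lemma exponent_vec_add: "exponent_vec (u + w) = exponent_vec u + exponent_vec w"
  by (simp add: Finite_Cartesian_Product.vec_eq_iff lookup_add)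

lemma lex_greater_exponent_vec: "lex_greater (exponent_vec u) (exponent_vec w) \<longleftrightarrow> w < u"
  unfolding less_exponent_iff lex_greater_def by (auto simp: eq_commute)

lemma prec_exponent_vec: "prec S (exponent_vec u) (exponent_vec w) \<longleftrightarrow>
    root_weight S (exponent_vec u) < root_weight S (exponent_vec w) \<or>
    root_weight S (exponent_vec u) = root_weight S (exponent_vec w) \<and> w < u"
  by (simp add: prec_def lex_greater_exponent_vec)

lemma poly_valuation_eqI:
  assumes "u \<in> keys g" "\<And>w. w \<in> keys g \<Longrightarrow> w \<noteq> u \<Longrightarrow> prec S (exponent_vec u) (exponent_vec w)"
  shows "poly_valuation S g = exponent_vec u"
  unfolding poly_valuation_def
proof (rule the_equality)
  show "exponent_vec u \<in> exponents g \<and> (\<forall>u'\<in>exponents g. u' \<noteq> exponent_vec u \<longrightarrow> prec S (exponent_vec u) u')"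
    using assms by (auto simp: exponents_eq)
next
  fix v assume v: "v \<in> exponents g \<and> (\<forall>u'\<in>exponents g. u' \<noteq> v \<longrightarrow> prec S v u')"
  then obtain w where w: "v = exponent_vec w" "w \<in> keys g" by (auto simp: exponents_eq)
  show "v = exponent_vec u"
  proof (rule ccontr)
    assume "v \<noteq> exponent_vec u"
    then have "prec S (exponent_vec w) (exponent_vec u)" "prec S (exponent_vec u) (exponent_vec w)"
      using v w assms by (auto simp: exponents_eq)
    then show False by (auto simp: prec_exponent_vec)
  qed
qed

lemma poly_valuation_minimal:
  fixes g :: "('d::{finite,linorder}, complex) mpoly"
  assumes "g \<noteq> 0"
  obtains u where "u \<in> keys g" "poly_valuation S g = exponent_vec u"
    "\<And>w. w \<in> keys g \<Longrightarrow> w \<noteq> u \<Longrightarrow> prec S (exponent_vec u) (exponent_vec w)"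
proof -
  define \<Psi> where "\<Psi> u = root_weight S (exponent_vec u)" for u :: "'d \<Rightarrow>\<^sub>0 nat"
  have ne: "keys g \<noteq> {}" using lead_in_keys[OF assms] by auto
  define M where "M = Min (\<Psi> ` keys g)"
  define K where "K = {u \<in> keys g. \<Psi> u = M}"
  have "M \<in> \<Psi> ` keys g" unfolding M_def using ne by (intro Min_in) auto
  then have K: "finite K" "K \<noteq> {}" by (auto simp: K_def)
  define u where "u = Max K"
  have "u \<in> K" unfolding u_def using K by (rule Max_in)
  then have u: "u \<in> keys g" "\<Psi> u = M" by (auto simp: K_def)
  have min: "prec S (exponent_vec u) (exponent_vec w)" if "w \<in> keys g" "w \<noteq> u" for w
  proof (cases "\<Psi> w = M")
    case True
    then have "w \<le> u" using that K unfolding u_def by (intro Max_ge) (auto simp: K_def)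
    then show ?thesis using True u that by (simp add: prec_exponent_vec \<Psi>_def)
  next
    case False
    moreover have "M \<le> \<Psi> w" unfolding M_def using that by (intro Min_le) auto
    ultimately show ?thesis using u by (simp add: prec_exponent_vec \<Psi>_def)
  qed
  show thesis by (rule that[OF u(1) poly_valuation_eqI[OF u(1) min] min])
qed

text \<open>On exponents of equal weight the order is the reversed lexicographic one, so its minimum is the
  leading exponent.\<close>

lemma poly_valuation_constant_weight:
  fixes g :: "('d::{finite,linorder}, complex) mpoly"
  assumes "g \<noteq> 0" "\<And>u. u \<in> keys g \<Longrightarrow> root_weight S (exponent_vec u) = c"
  shows "poly_valuation S g = exponent_vec (lead g)"
proof (rule poly_valuation_eqI)
  show k: "lead g \<in> keys g" by (rule lead_in_keys[OF assms(1)])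
  fix w assume "w \<in> keys g" "w \<noteq> lead g"
  then show "prec S (exponent_vec (lead g)) (exponent_vec w)"
    using lead_ge[of w g] assms(2) k by (simp add: prec_exponent_vec)
qed

section \<open>The coordinate ring and its valuation\<close>

text \<open>A monomial in the Pluecker variables as a list of pairs. The order of the factors is irrelevant, hence the
  arbitrary enumeration of the variables.\<close>

definition bracket_list :: "(nat \<times> nat \<Rightarrow>\<^sub>0 nat) \<Rightarrow> (nat \<times> nat) list" where
  "bracket_list \<kappa> = concat (map (\<lambda>p. replicate (lookup \<kappa> p) p) (SOME ps. set ps = keys \<kappa> \<and> distinct ps))"

lemma bracket_list_properties:
  shows "set (bracket_list \<kappa>) \<subseteq> keys \<kappa>"
    and "length (bracket_list \<kappa>) = (\<Sum>p\<in>keys \<kappa>. lookup \<kappa> p)"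
    and "bmon v (bracket_list \<kappa>) = subst_mon (bracket v) \<kappa>"
proof -
  define ks where "ks = (SOME ps. set ps = keys \<kappa> \<and> distinct ps)"
  have ks: "set ks = keys \<kappa>" "distinct ks"
    using someI_ex[OF finite_distinct_list[OF finite_keys, of \<kappa>]] by (auto simp: ks_def)
  have bl: "bracket_list \<kappa> = concat (map (\<lambda>p. replicate (lookup \<kappa> p) p) ks)"
    by (simp add: bracket_list_def ks_def)
  show "set (bracket_list \<kappa>) \<subseteq> keys \<kappa>" unfolding bl ks(1)[symmetric] by auto
  show "length (bracket_list \<kappa>) = (\<Sum>p\<in>keys \<kappa>. lookup \<kappa> p)"
    unfolding bl ks(1)[symmetric] sum.distinct_set_conv_list[OF ks(2)]
    by (induction ks) auto
  have rep: "bmon v (replicate k p) = bracket v p ^ k" for k p by (induction k) auto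
  show "bmon v (bracket_list \<kappa>) = subst_mon (bracket v) \<kappa>"
    unfolding bl subst_mon_def ks(1)[symmetric] prod.distinct_set_conv_list[OF ks(2)]
    by (induction ks) (auto simp: rep)
qed

lemma subst_poly_bracket: "subst_poly h (bracket v) F = (\<Sum>\<kappa>\<in>keys F. h (lookup F \<kappa>) * bmon v (bracket_list \<kappa>))"
  by (simp add: subst_poly_def bracket_list_properties(3) subst_mon_def)

lemma plucker_ideal_iff:
  "F \<in> plucker_ideal n \<longleftrightarrow> F \<in> carrier (plucker_poly_ring n) \<and>
    (\<forall>v :: complex vectors. subst_poly (\<lambda>c. c) (bracket v) F = 0)"
proof -
  have 1: "(\<lambda>(i, j). a i * b j - a j * b i) = bracket (\<lambda>i. (a i, b i))" for a b :: "nat \<Rightarrow> complex"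
    by (auto simp: bracket_def fun_eq_iff algebra_simps)
  have "(\<forall>a b. subst_poly (\<lambda>c. c) (bracket (\<lambda>i. (a i, b i))) F = 0) \<longleftrightarrow>
      (\<forall>v :: complex vectors. subst_poly (\<lambda>c. c) (bracket v) F = 0)"
  proof (intro iffI allI)
    fix v :: "complex vectors"
    assume "\<forall>a b. subst_poly (\<lambda>c. c) (bracket (\<lambda>i. (a i, b i))) F = 0"
    from this[rule_format, of "\<lambda>i. fst (v i)" "\<lambda>i. snd (v i)"] show "subst_poly (\<lambda>c. c) (bracket v) F = 0" by simp
  qed blast
  then show ?thesis unfolding plucker_ideal_def 1 by simp
qed

lemma plucker_ring_simps:
  "F \<in> carrier (plucker_poly_ring n) \<longleftrightarrow> (\<forall>u\<in>keys F. keys u \<subseteq> plucker_indices n)"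
  "x \<oplus>\<^bsub>plucker_poly_ring n\<^esub> y = x + y"
  by (simp_all add: plucker_poly_ring_def)

lemma plucker_ring_add:
  "F \<in> carrier (plucker_poly_ring n) \<Longrightarrow> G \<in> carrier (plucker_poly_ring n) \<Longrightarrow> F + G \<in> carrier (plucker_poly_ring n)"
  "F \<in> carrier (plucker_poly_ring n) \<Longrightarrow> - F \<in> carrier (plucker_poly_ring n)"
proof -
  show "F \<in> carrier (plucker_poly_ring n) \<Longrightarrow> G \<in> carrier (plucker_poly_ring n) \<Longrightarrow> F + G \<in> carrier (plucker_poly_ring n)"
    using Poly_Mapping.keys_add[of F G] unfolding plucker_ring_simps by blast
  show "F \<in> carrier (plucker_poly_ring n) \<Longrightarrow> - F \<in> carrier (plucker_poly_ring n)"
    unfolding plucker_ring_simps by (simp add: in_keys_iff)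
qed

lemma plucker_ideal_closed:
  "0 \<in> plucker_ideal n"
  "F \<in> plucker_ideal n \<Longrightarrow> G \<in> plucker_ideal n \<Longrightarrow> F + G \<in> plucker_ideal n"
  "F \<in> plucker_ideal n \<Longrightarrow> - F \<in> plucker_ideal n"
proof -
  interpret coefficient_hom "\<lambda>c :: complex. c" by (rule id_hom)
  show "0 \<in> plucker_ideal n" by (simp add: plucker_ideal_iff subst_zero plucker_ring_simps)
  show "F \<in> plucker_ideal n \<Longrightarrow> G \<in> plucker_ideal n \<Longrightarrow> F + G \<in> plucker_ideal n"
    by (simp add: plucker_ideal_iff subst_add plucker_ring_add)
  show "F \<in> plucker_ideal n \<Longrightarrow> - F \<in> plucker_ideal n"
    by (simp add: plucker_ideal_iff subst_uminus plucker_ring_add)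
qed

lemma coord_class_eq: "coord_class n F = (\<lambda>h. h + F) ` plucker_ideal n"
  by (auto simp: coord_class_def a_r_coset_def r_coset_def plucker_poly_ring_def)

lemma coord_ring_zero: "\<zero>\<^bsub>coord_ring n\<^esub> = plucker_ideal n"
  by (simp add: coord_ring_def FactRing_def)

lemma coord_class_eq_zero_iff:
  assumes "F \<in> carrier (plucker_poly_ring n)"
  shows "coord_class n F = \<zero>\<^bsub>coord_ring n\<^esub> \<longleftrightarrow> F \<in> plucker_ideal n"
proof
  assume "coord_class n F = \<zero>\<^bsub>coord_ring n\<^esub>"
  moreover have "0 + F \<in> coord_class n F"
    unfolding coord_class_eq using plucker_ideal_closed(1) by (intro imageI)
  ultimately show "F \<in> plucker_ideal n" by (simp add: coord_ring_zero)
next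
  assume F: "F \<in> plucker_ideal n"
  show "coord_class n F = \<zero>\<^bsub>coord_ring n\<^esub>"
    unfolding coord_class_eq coord_ring_zero
  proof (intro equalityI subsetI)
    fix h assume "h \<in> plucker_ideal n"
    then have "h + - F \<in> plucker_ideal n" using F plucker_ideal_closed by blast
    then have "(h + - F) + F \<in> (\<lambda>h. h + F) ` plucker_ideal n" by (rule imageI)
    then show "h \<in> (\<lambda>h. h + F) ` plucker_ideal n" by simp
  qed (use F plucker_ideal_closed in auto)
qed

text \<open>All elements of the ideal are substituted to zero: they vanish at the complex points that are
  obtained by evaluating the rows of \<open>\<psi>\<^sub>S\<close>, and a polynomial that vanishes everywhere is zero. Hence the
  substitution is constant on the class.\<close>

lemma psi_pullback_coord_class:
  "psi_pullback S n (coord_class n F) =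
    (subst_poly const_poly (psi_minor n S) F :: ('d::{finite,linorder}, complex) mpoly)"
proof -
  interpret const: coefficient_hom "const_poly :: complex \<Rightarrow> ('d, complex) mpoly" by (rule const_poly_hom)
  interpret id: coefficient_hom "\<lambda>c :: complex. c" by (rule id_hom)
  have "subst_poly const_poly (psi_minor n S) h = (0 :: ('d, complex) mpoly)" if "h \<in> plucker_ideal n" for h
  proof (rule mpoly_eq_0_if_vanishing)
    fix y :: "'d \<Rightarrow> complex"
    let ?ev = "subst_poly (\<lambda>c. c) y"
    have "(\<lambda>p. ?ev (psi_minor n S p)) = bracket (\<lambda>i. (?ev (fst (psi_vectors n S i)), ?ev (snd (psi_vectors n S i))))"
      by (simp add: psi_minor_eq_bracket bracket_def id.subst_diff id.subst_mult fun_eq_iff)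
    then show "?ev (subst_poly const_poly (psi_minor n S) h) = 0"
      using that by (simp add: eval_subst_poly plucker_ideal_iff)
  qed
  then have "subst_poly const_poly (psi_minor n S) ` coord_class n F
      = {subst_poly const_poly (psi_minor n S) F :: ('d, complex) mpoly}"
    unfolding coord_class_eq image_image const.subst_add
    using plucker_ideal_closed(1)[of n] by auto
  then show ?thesis by (simp add: psi_pullback_def)
qed

context iterated_roots begin

abbreviation V :: "('d, complex) mpoly vectors" where "V \<equiv> psi_vectors n S"

text \<open>The sum of the roots of an exponent, in the basis of the \<open>\<epsilon>\<^sub>x\<close> and up to sign: \<open>\<epsilon>\<^sub>i - \<epsilon>\<^sub>j\<close> contributes
  \<open>1\<close> at \<open>j\<close> and \<open>- 1\<close> at \<open>i\<close>.\<close>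

definition root_degree :: "('d \<Rightarrow>\<^sub>0 nat) \<Rightarrow> nat \<Rightarrow> int" where
  "root_degree u x = (\<Sum>k\<in>UNIV. int (lookup u k) *
     (of_bool (snd (root_at S k) = x) - of_bool (fst (root_at S k) = x)))"

lemma root_degree_add: "root_degree (u + w) x = root_degree u x + root_degree w x"
  by (simp add: root_degree_def lookup_add distrib_right sum.distrib)

lemma root_degree_single: "root_degree (single k c) x =
    int c * (of_bool (snd (root_at S k) = x) - of_bool (fst (root_at S k) = x))"
proof -
  have "root_degree (single k c) x = (\<Sum>k'\<in>UNIV. if k' = k then int c *
     (of_bool (snd (root_at S k') = x) - of_bool (fst (root_at S k') = x)) else 0)"
    unfolding root_degree_def by (intro sum.cong refl) (auto simp: lookup_single when_def)
  then show ?thesis by simp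
qed

lemma root_range: "fst (root_at S (k::'d)) \<in> {1..n} \<and> snd (root_at S k) \<in> {1..n}"
proof -
  obtain l where l: "l \<in> {3..n}" "k = yv l \<or> k = zv l" using UNIV_yz by blast
  then show ?thesis using ij[OF l(1)] root_at_yv[OF l(1)] root_at_zv[OF l(1)] by auto
qed

text \<open>The height of a root is a linear function of the root, so \<open>\<Psi>\<close> factors through the root degree.\<close>

lemma root_weight_root_degree:
  "root_weight S (exponent_vec u) = (\<Sum>x=1..n. int x * root_degree u x)"
proof -
  have "(\<Sum>x=1..n. int x * root_degree u x) = (\<Sum>k\<in>UNIV. int (lookup u k) *
      ((\<Sum>x=1..n. int x * of_bool (snd (root_at S k) = x)) - (\<Sum>x=1..n. int x * of_bool (fst (root_at S k) = x))))"
    unfolding root_degree_def sum_distrib_left sum_subtractf[symmetric]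
    by (subst sum.swap) (simp add: algebra_simps)
  also have "\<dots> = (\<Sum>k\<in>UNIV. int (lookup u k) * (int (snd (root_at S k)) - int (fst (root_at S k))))"
  proof (intro sum.cong refl arg_cong2[where f="(*)"] arg_cong2[where f="(-)"])
    have s: "(\<Sum>x=1..n. int x * of_bool (y = x)) = int y" if "y \<in> {1..n}" for y
    proof -
      have "(\<Sum>x=1..n. int x * of_bool (y = x)) = (\<Sum>x=1..n. if y = x then int x else 0)"
        by (intro sum.cong) auto
      then show ?thesis using that by simp
    qed
    fix k :: 'd
    show "(\<Sum>x=1..n. int x * of_bool (snd (root_at S k) = x)) = int (snd (root_at S k))"
      "(\<Sum>x=1..n. int x * of_bool (fst (root_at S k) = x)) = int (fst (root_at S k))"
      using root_range[of k] by (auto intro: s)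
  qed
  also have "\<dots> = root_weight S (exponent_vec u)"
    by (simp add: root_weight_def height_def case_prod_unfold)
  finally show ?thesis by simp
qed

definition graded :: "(nat \<Rightarrow> int) \<Rightarrow> ('d, complex) mpoly \<Rightarrow> bool" where
  "graded d P \<longleftrightarrow> (\<forall>u\<in>keys P. \<forall>x. root_degree u x = d x)"

lemma graded_add: "graded d P \<Longrightarrow> graded d Q \<Longrightarrow> graded d (P + Q)"
  unfolding graded_def using Poly_Mapping.keys_add[of P Q] by blast

lemma graded_diff: "graded d P \<Longrightarrow> graded d Q \<Longrightarrow> graded d (P - Q)"
  unfolding graded_def using keys_diff[of P Q] by blast

lemma graded_mult: "graded d P \<Longrightarrow> graded d' Q \<Longrightarrow> graded (\<lambda>x. d x + d' x) (P * Q)"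
  unfolding graded_def by (auto elim!: keys_multE simp: root_degree_add)

lemma graded_cong: "graded d P \<Longrightarrow> (\<And>x. d x = d' x) \<Longrightarrow> graded d' P"
  by (simp add: graded_def)

lemma graded_var: "graded (\<lambda>x. of_bool (snd (root_at S k) = x) - of_bool (fst (root_at S k) = x)) (var_poly k)"
  by (simp add: graded_def var_poly_def root_degree_single)

lemma graded_one: "graded (\<lambda>x. 0) 1" and graded_zero: "graded d 0"
  by (simp_all add: graded_def root_degree_def)

lemma graded_const: "graded (\<lambda>x. 0) (const_poly c)"
  by (auto simp: graded_def root_degree_def const_poly_def)

text \<open>The rows are homogeneous for the torus action: the entry of \<open>v\<^sub>i\<close> in column \<open>c\<close> has the weight of the
  sum of roots leading from \<open>c\<close> to \<open>i\<close>.\<close>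

lemma graded_V:
  "i \<in> {1..n} \<Longrightarrow> graded (\<lambda>x. of_bool (i = x) - of_bool (x = 1)) (fst (V i)) \<and>
    graded (\<lambda>x. of_bool (i = x) - of_bool (x = 2)) (snd (V i))"
proof (induction i rule: less_induct)
  case (less i)
  consider "i = 1" | "i = 2" | "i \<in> {3..n}" using less.prems by fastforce
  then show ?case
  proof cases
    case 3
    note ij = ij[OF 3]
    have IH: "graded (\<lambda>x. of_bool (ia i = x) - of_bool (x = 1)) (fst (V (ia i)))"
      "graded (\<lambda>x. of_bool (ia i = x) - of_bool (x = 2)) (snd (V (ia i)))"
      "graded (\<lambda>x. of_bool (ja i = x) - of_bool (x = 1)) (fst (V (ja i)))"
      "graded (\<lambda>x. of_bool (ja i = x) - of_bool (x = 2)) (snd (V (ja i)))"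
      using less.IH[of "ia i"] less.IH[of "ja i"] ij less.prems by auto
    show ?thesis
      unfolding V_new[OF 3] fst_conv snd_conv
      by (intro conjI graded_add graded_cong[OF graded_mult[OF graded_var IH(1)]]
          graded_cong[OF graded_mult[OF graded_var IH(2)]] graded_cong[OF graded_mult[OF graded_var IH(3)]]
          graded_cong[OF graded_mult[OF graded_var IH(4)]])
        (simp_all add: root_at_yv[OF 3] root_at_zv[OF 3])
  qed (auto simp: graded_zero intro: graded_cong[OF graded_one])
qed

lemma graded_br:
  assumes "fst p \<in> {1..n}" "snd p \<in> {1..n}"
  shows "graded (\<lambda>x. int (occ p x) - of_bool (x = 1) - of_bool (x = 2)) (bracket V p)"
proof -
  note g = graded_V[OF assms(1)] graded_V[OF assms(2)]
  show ?thesis unfolding bracket_def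
    by (intro graded_diff graded_cong[OF graded_mult[OF conjunct1[OF g(1)] conjunct2[OF g(2)]]]
        graded_cong[OF graded_mult[OF conjunct2[OF g(1)] conjunct1[OF g(2)]]])
      (auto simp: occ_def)
qed

lemma graded_bmon:
  assumes "ps \<in> bracket_lists n"
  shows "graded (\<lambda>x. int (multideg ps x) - int (length ps) * (of_bool (x = 1) + of_bool (x = 2))) (bmon V ps)"
  using assms
proof (induction ps)
  case (Cons p ps)
  then have p: "fst p \<in> {1..n}" "snd p \<in> {1..n}" "ps \<in> bracket_lists n" by (auto simp: bracket_lists_def)
  show ?case unfolding bmon_Cons
    by (rule graded_cong[OF graded_mult[OF graded_br[OF p(1,2)] Cons.IH[OF p(3)]]])
      (simp add: multideg_Cons algebra_simps)
qed (simp add: graded_one)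

lemma graded_root_weight:
  "graded d P \<Longrightarrow> u \<in> keys P \<Longrightarrow> root_weight S (exponent_vec u) = (\<Sum>x=1..n. int x * d x)"
  by (simp add: root_weight_root_degree graded_def)

lemma valuation_coord_class: "valuation n S (coord_class n F) =
    poly_valuation S (subst_poly const_poly (bracket V) F :: ('d, complex) mpoly)"
proof -
  have "psi_minor n S = bracket V" by (auto simp: psi_minor_eq_bracket fun_eq_iff)
  then show ?thesis by (simp add: valuation_def psi_pullback_coord_class)
qed

lemma valuation_plucker_coord:
  assumes "i \<in> {1..n}" "j \<in> {1..n}" "i \<noteq> j"
  shows "valuation n S (plucker_coord n i j) = (exponent_vec (val (i, j)) :: int ^ 'd::{finite,linorder})"
proof -
  interpret const: coefficient_hom "const_poly :: complex \<Rightarrow> ('d, complex) mpoly" by (rule const_poly_hom)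
  have "poly_valuation S (bracket V (i, j)) = exponent_vec (lead (bracket V (i, j)))"
    using graded_root_weight[OF graded_br[of "(i, j)"]] assms
    by (intro poly_valuation_constant_weight bracket_nonzero) auto
  then show ?thesis
    by (simp add: plucker_coord_def valuation_coord_class const.subst_var val_def)
qed

text \<open>The multihomogeneous components of \<open>f\<close> pull back to polynomials of distinct root degrees. Hence the
  minimal exponent of the pullback is an exponent of exactly one component, and within a component
  the weight is constant, so it is its leading exponent.\<close>

theorem valuation_graded_piece:
  assumes "f \<in> graded_piece n m" "f \<noteq> \<zero>\<^bsub>coord_ring n\<^esub>"
  obtains ps where "ps \<in> bracket_lists n" "length ps = m"
    "valuation n S f = (exponent_vec (sum_list (map val ps)) :: int ^ 'd::{finite,linorder})"
proof -
  obtain F where F: "f = coord_class n F" "F \<in> carrier (plucker_poly_ring n)" "homogeneous_poly m F"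
    using assms(1) by (auto simp: graded_piece_def)
  define bl where "bl = bracket_list"
  have bl: "bl \<kappa> \<in> bracket_lists n" "length (bl \<kappa>) = m" if "\<kappa> \<in> keys F" for \<kappa>
  proof -
    have "keys \<kappa> \<subseteq> plucker_indices n" using F(2) that by (simp add: plucker_ring_simps)
    then show "bl \<kappa> \<in> bracket_lists n"
      using bracket_list_properties(1)[of \<kappa>] by (fastforce simp: in_bracket_lists_iff plucker_indices_def bl_def)
    show "length (bl \<kappa>) = m"
      using F(3) that by (simp add: bracket_list_properties(2) homogeneous_poly_def bl_def)
  qed
  define part where "part d v = (\<Sum>\<kappa>\<in>{\<kappa> \<in> keys F. multideg (bl \<kappa>) = d}. const_poly (lookup F \<kappa>) * bmon v (bl \<kappa>))"
    for d and v :: "('d, complex) mpoly vectors"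
  have part_bspan: "part d \<in> bspan (bracket_gens n d)" for d
    unfolding part_def by (intro bspan_sum bspan_scale bspan_bmon) (use bl in \<open>auto simp: bracket_gens_def\<close>)
  define g where "g = (subst_poly const_poly (bracket V) F :: ('d, complex) mpoly)"
  have g: "g = (\<Sum>\<kappa>\<in>keys F. const_poly (lookup F \<kappa>) * bmon V (bl \<kappa>))"
    by (simp add: g_def subst_poly_bracket bl_def)
  define rdeg where "rdeg d x = int (d x) - int m * (of_bool (x = 1) + of_bool (x = 2))" for d :: "nat \<Rightarrow> nat" and x :: nat
  have rdeg_inj: "d = d'" if "\<And>x. rdeg d x = rdeg d' x" for d d'
    using that by (auto simp: rdeg_def fun_eq_iff)
  have gr: "graded (rdeg (multideg (bl \<kappa>))) (const_poly (lookup F \<kappa>) * bmon V (bl \<kappa>))" if "\<kappa> \<in> keys F" for \<kappa>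
    by (rule graded_cong[OF graded_mult[OF graded_const graded_bmon[OF bl(1)[OF that]]]])
      (simp add: bl(2)[OF that] rdeg_def)
  have gr_sum: "\<exists>\<kappa>\<in>A. \<forall>x. root_degree u x = rdeg (multideg (bl \<kappa>)) x"
    if "u \<in> keys (\<Sum>\<kappa>\<in>A. const_poly (lookup F \<kappa>) * bmon V (bl \<kappa>))" "A \<subseteq> keys F" for u A
  proof -
    have "\<exists>\<kappa>\<in>A. lookup (const_poly (lookup F \<kappa>) * bmon V (bl \<kappa>)) u \<noteq> 0"
    proof (rule ccontr)
      assume "\<not> ?thesis"
      then have "lookup (\<Sum>\<kappa>\<in>A. const_poly (lookup F \<kappa>) * bmon V (bl \<kappa>)) u = 0"
        unfolding lookup_sum by (intro sum.neutral) blast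
      then show False using that(1) by (simp add: in_keys_iff)
    qed
    then obtain \<kappa> where "\<kappa> \<in> A" "u \<in> keys (const_poly (lookup F \<kappa>) * bmon V (bl \<kappa>))"
      by (auto simp: in_keys_iff)
    moreover from this(1) that(2) have "graded (rdeg (multideg (bl \<kappa>))) (const_poly (lookup F \<kappa>) * bmon V (bl \<kappa>))"
      by (intro gr) blast
    ultimately show ?thesis unfolding graded_def by blast
  qed
  \<comment> \<open>Components of different multidegree have no exponent in common.\<close>
  have split: "g = part d V + (\<Sum>\<kappa>\<in>{\<kappa> \<in> keys F. multideg (bl \<kappa>) \<noteq> d}. const_poly (lookup F \<kappa>) * bmon V (bl \<kappa>))" for d
    unfolding g part_def by (subst sum.union_disjoint[symmetric]) (auto intro!: sum.cong)
  have keys_part: "u \<in> keys (part d V) \<longleftrightarrow> u \<in> keys g \<and> (\<forall>x. root_degree u x = rdeg d x)" for u d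
  proof (cases "\<forall>x. root_degree u x = rdeg d x")
    case True
    have "u \<notin> keys (\<Sum>\<kappa>\<in>{\<kappa> \<in> keys F. multideg (bl \<kappa>) \<noteq> d}. const_poly (lookup F \<kappa>) * bmon V (bl \<kappa>))"
    proof
      assume "u \<in> keys (\<Sum>\<kappa>\<in>{\<kappa> \<in> keys F. multideg (bl \<kappa>) \<noteq> d}. const_poly (lookup F \<kappa>) * bmon V (bl \<kappa>))"
      from gr_sum[OF this] obtain \<kappa> where "multideg (bl \<kappa>) \<noteq> d" "\<forall>x. root_degree u x = rdeg (multideg (bl \<kappa>)) x"
        by (auto simp: graded_def)
      then show False using True rdeg_inj[of "multideg (bl \<kappa>)" d] by simp
    qed
    then show ?thesis using True split[of d] by (simp add: in_keys_iff lookup_add)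
  next
    case False
    have "u \<notin> keys (part d V)"
      using gr_sum[of u "{\<kappa> \<in> keys F. multideg (bl \<kappa>) = d}"] False by (auto simp: part_def graded_def)
    then show ?thesis using False by blast
  qed
  have "g \<noteq> 0"
  proof -
    have "F \<notin> plucker_ideal n" using assms(2) F coord_class_eq_zero_iff by blast
    then obtain v :: "complex vectors" where v: "subst_poly (\<lambda>c. c) (bracket v) F \<noteq> 0"
      using F(2) by (auto simp: plucker_ideal_iff)
    define w :: "('d, complex) mpoly vectors" where "w i = (const_poly (fst (v i)), const_poly (snd (v i)))" for i
    interpret const: coefficient_hom "const_poly :: complex \<Rightarrow> ('d, complex) mpoly" by (rule const_poly_hom)
    have cdiff: "const_poly (x - y) = (const_poly x - const_poly y :: ('d, complex) mpoly)" for x y :: complex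
      using const.hom_add[of x "- y"] by (simp add: const.hom_uminus)
    have csum: "const_poly (\<Sum>x\<in>A. h x) = (\<Sum>x\<in>A. const_poly (h x) :: ('d, complex) mpoly)" for A and h :: "_ \<Rightarrow> complex"
      by (induction A rule: infinite_finite_induct) (auto simp: const_poly_simps)
    have "const_poly (bmon v ps) = bmon w ps" for ps
      using hom_bmon[of "const_poly :: complex \<Rightarrow> ('d, complex) mpoly" v ps]
      by (simp add: const_poly_simps cdiff w_def[abs_def])
    then have "(\<Sum>\<kappa>\<in>keys F. const_poly (lookup F \<kappa>) * bmon w (bl \<kappa>)) = (const_poly (subst_poly (\<lambda>c. c) (bracket v) F) :: ('d, complex) mpoly)"
      by (simp add: subst_poly_bracket bl_def csum const_poly_simps)
    moreover have "\<dots> \<noteq> 0" using v by (auto simp: const_poly_def dest: arg_cong[where f=keys])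
    moreover have "(\<Sum>\<kappa>\<in>keys F. const_poly (lookup F \<kappa>) * bmon w (bl \<kappa>)) = (\<Sum>d\<in>(\<lambda>\<kappa>. multideg (bl \<kappa>)) ` keys F. part d w)"
      unfolding part_def by (rule sum.image_gen) simp
    ultimately have "(\<Sum>d\<in>(\<lambda>\<kappa>. multideg (bl \<kappa>)) ` keys F. part d w) \<noteq> 0" by (simp only: not_False_eq_True)
    then obtain d where "part d w \<noteq> 0" by (meson sum.neutral)
    then have "part d \<noteq> (\<lambda>v. 0)" by auto
    then have "part d V \<noteq> 0" using lead_bspan[OF _ _ part_bspan[of d]] n3 by auto
    then show ?thesis using lead_in_keys[of "part d V"] keys_part[of _ d] by auto
  qed
  then obtain u where u: "u \<in> keys g" "poly_valuation S g = exponent_vec u"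
    "\<And>w. w \<in> keys g \<Longrightarrow> w \<noteq> u \<Longrightarrow> prec S (exponent_vec u) (exponent_vec w)"
    by (rule poly_valuation_minimal[of g S]) blast
  obtain \<kappa> where \<kappa>: "\<forall>x. root_degree u x = rdeg (multideg (bl \<kappa>)) x"
    using gr_sum[of u "keys F"] u(1) by (auto simp: g graded_def)
  define d where "d = multideg (bl \<kappa>)"
  have ud: "u \<in> keys (part d V)" using keys_part[of u d] u(1) \<kappa> by (simp add: d_def)
  have "lead (part d V) = u"
  proof (rule lead_eqI[OF ud])
    fix w assume w: "w \<in> keys (part d V)"
    then have "w \<in> keys g" "root_weight S (exponent_vec w) = root_weight S (exponent_vec u)"
      using keys_part[of w d] keys_part[of u d] ud by (auto simp: root_weight_root_degree)
    then show "w \<le> u" using u(3)[of w] by (cases "w = u") (auto simp: prec_exponent_vec)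
  qed
  moreover have "part d \<noteq> (\<lambda>v. 0)" using ud by auto
  ultimately obtain ps where ps: "ps \<in> bracket_gens n d" "u = sum_list (map val ps)"
    using lead_bspan[OF _ _ part_bspan[of d]] n3 by auto
  \<comment> \<open>The multidegree determines the number of factors, so the decomposition has length \<open>m\<close>.\<close>
  have total: "(\<Sum>x=1..n. multideg qs x) = 2 * length qs" if "qs \<in> bracket_lists n" for qs
    using that
  proof (induction qs)
    case (Cons p qs)
    have "(\<Sum>x=1..n. occ p x) = 2"
    proof -
      have "(\<Sum>x=1..n. occ p x) = (\<Sum>x=1..n. if fst p = x then 1 else 0) + (\<Sum>x=1..n. if snd p = x then 1 else 0)"
        by (simp add: occ_def sum.distrib of_bool_def)
      also have "\<dots> = 2" using Cons.prems by (simp add: in_bracket_lists_iff)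
      finally show ?thesis .
    qed
    then show ?case using Cons by (simp add: multideg_Cons sum.distrib bracket_lists_def)
  qed simp
  obtain \<kappa>' where "\<kappa>' \<in> keys F" "multideg (bl \<kappa>') = d"
  proof -
    have "{\<kappa> \<in> keys F. multideg (bl \<kappa>) = d} \<noteq> {}"
      using ud by (force simp: part_def)
    then show thesis using that by blast
  qed
  then have "length ps = m"
    using total[of ps] total[of "bl \<kappa>'"] bl[of \<kappa>'] ps(1) by (auto simp: bracket_gens_def)
  then show thesis
    using that[of ps] ps u(2) by (auto simp: F(1) valuation_coord_class g_def[symmetric] bracket_gens_def)
qed

end

section \<open>The Newton--Okounkov polytope\<close>

lemma mean_in_convex:
  fixes C :: "'a::real_vector set"
  assumes "convex C" "ps \<noteq> []" "\<And>p. p \<in> set ps \<Longrightarrow> x p \<in> C"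
  shows "(1 / real (length ps)) *\<^sub>R sum_list (map x ps) \<in> C"
  using assms(2,3)
proof (induction ps rule: list_nonempty_induct)
  case (cons p ps)
  define k where "k = real (length ps)"
  have k: "k > 0" using cons(1) by (simp add: k_def)
  have "(1 / (k + 1)) *\<^sub>R x p + (k / (k + 1)) *\<^sub>R ((1 / k) *\<^sub>R sum_list (map x ps)) \<in> C"
  proof (rule convexD[OF assms(1)])
    show "x p \<in> C" "(1 / k) *\<^sub>R sum_list (map x ps) \<in> C" using cons by (auto simp: k_def)
    show "1 / (k + 1) + k / (k + 1) = 1" using k by (simp add: field_simps)
  qed (use k in auto)
  then show ?case using k by (simp add: k_def scaleR_add_right add.commute)
qed simp

lemma real_vec_exponent_add:
  "real_vec (exponent_vec (u + w)) = real_vec (exponent_vec u) + real_vec (exponent_vec w)"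
  by (simp add: real_vec_def Finite_Cartesian_Product.vec_eq_iff lookup_add)

lemma real_vec_exponent_sum_list:
  "real_vec (exponent_vec (sum_list (map x ps))) = sum_list (map (\<lambda>p. real_vec (exponent_vec (x p))) ps)"
proof (induction ps)
  case Nil
  show ?case by (simp add: real_vec_def Finite_Cartesian_Product.vec_eq_iff)
qed (simp add: real_vec_exponent_add)

lemma card_plucker_indices: "card (plucker_indices n) = n choose 2"
proof -
  have "plucker_indices n = (SIGMA j:{1..n}. {1..<j})\<inverse>"
    by (auto simp: plucker_indices_def)
  then have "card (plucker_indices n) = (\<Sum>j=1..n. card {1..<j})"
    by (simp add: card_inverse)
  also have "\<dots> = n choose 2"
    by (induction n) (auto simp: numeral_2_eq_2)
  finally show ?thesis .
qed

lemma finite_plucker_indices: "finite (plucker_indices n)"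
  by (rule finite_subset[of _ "{1..n} \<times> {1..n}"]) (auto simp: plucker_indices_def)

context iterated_roots begin

lemma val_older:
  assumes "i \<in> {1..n}" "j \<in> {1..n}" "i \<noteq> j" "i < l" "j < l"
  shows "older l (val (i, j))"
  using lead_in_keys[OF bracket_nonzero[OF assms(1-3)]] bracket_older[of "(i, j)" l] assms
  by (auto simp: val_def in_older_def)

lemma plucker_indices_cases:
  assumes "(k, l) \<in> plucker_indices n"
  obtains "k = 1" "l = 2" | "l \<in> {3..n}" "k \<in> {1..<l}" "k = ia l" | "l \<in> {3..n}" "k \<in> {1..<l}" "k \<noteq> ia l"
  using assms unfolding plucker_indices_def by fastforce

lemma val_le_1: "i \<in> {1..n} \<Longrightarrow> j \<in> {1..n} \<Longrightarrow> i \<noteq> j \<Longrightarrow> lookup (val (i, j)) x \<le> 1"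
proof -
  have *: "lookup (val (k, l)) x \<le> 1" if "(k, l) \<in> plucker_indices n" for k l
    using that
  proof (induction l arbitrary: k rule: less_induct)
    case (less l)
    have IH: "lookup (val (i, j)) x \<le> 1" if "i \<in> {1..<l}" "j \<in> {1..<l}" "i \<noteq> j" for i j
      using less.IH[of j i] less.IH[of i j] that less.prems val_swap[of i j]
      by (cases i j rule: linorder_cases) (auto simp: plucker_indices_def)
    have old: "older l (val (i, j))" if "i \<in> {1..<l}" "j \<in> {1..<l}" "i \<noteq> j" for i j
      using that less.prems by (intro val_older) (auto simp: plucker_indices_def)
    from less.prems show ?case
    proof (cases rule: plucker_indices_cases)
      case 1
      then show ?thesis using val_12 by simp
    next
      case 2
      note ij = ij[OF 2(1)]
      have "lookup (val (ia l, ja l)) (zv l) = 0"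
        using old[of "ia l" "ja l"] ij 2(1) by (auto simp: older_def)
      then show ?thesis using IH[of "ia l" "ja l"] ij 2
        by (auto simp: val_rec_z lookup_add lookup_single when_def)
    next
      case 3
      note ij = ij[OF 3(1)]
      have "lookup (val (k, ia l)) (yv l) = 0"
        using old[of k "ia l"] ij 3 by (auto simp: older_def)
      then show ?thesis using IH[of k "ia l"] ij 3
        by (auto simp: val_rec_y lookup_add lookup_single when_def)
    qed
  qed
  show "i \<in> {1..n} \<Longrightarrow> j \<in> {1..n} \<Longrightarrow> i \<noteq> j \<Longrightarrow> lookup (val (i, j)) x \<le> 1"
    using *[of i j] *[of j i] val_swap[of i j]
    by (cases i j rule: linorder_cases) (auto simp: plucker_indices_def)
qed

text \<open>The two newest coordinates of a value record whether the smaller index is \<open>i\<^sub>l\<close>.\<close>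

lemma val_newest:
  assumes "(k, l) \<in> plucker_indices n" "l \<in> {3..n}"
  shows "lookup (val (k, l)) (yv l) = (if k = ia l then 0 else 1)"
    "lookup (val (k, l)) (zv l) = (if k = ia l then 1 else 0)"
proof -
  have k: "k \<in> {1..<l}" using assms by (auto simp: plucker_indices_def)
  note ij = ij[OF assms(2)]
  have old: "older l (val (i, j))" if "i \<in> {1..<l}" "j \<in> {1..<l}" "i \<noteq> j" for i j
    using that assms(2) by (intro val_older) auto
  have zero: "lookup (val (i, j)) (yv l) = 0 \<and> lookup (val (i, j)) (zv l) = 0"
    if "i \<in> {1..<l}" "j \<in> {1..<l}" "i \<noteq> j" for i j
    using old[OF that] assms(2) by (auto simp: older_def)
  note neq = yv_neq_zv[OF assms(2) assms(2)]
  show "lookup (val (k, l)) (yv l) = (if k = ia l then 0 else 1)"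
    using zero[of k "ia l"] zero[of "ia l" "ja l"] ij k neq val_rec_y[OF assms(2) k] val_rec_z[OF assms(2)]
    by (auto simp: lookup_add lookup_single when_def)
  show "lookup (val (k, l)) (zv l) = (if k = ia l then 1 else 0)"
    using zero[of k "ia l"] zero[of "ia l" "ja l"] ij k neq val_rec_y[OF assms(2) k] val_rec_z[OF assms(2)]
    by (auto simp: lookup_add lookup_single when_def)
qed

text \<open>The largest index of a pair is the index of its newest variable; the newest variable is \<open>z\<^sub>l\<close> exactly for the
  pair \<open>{i\<^sub>l, l}\<close>, and otherwise the pair is recovered from the value with the unit vector of \<open>y\<^sub>l\<close>
  removed.\<close>

lemma val_inj: "inj_on val (plucker_indices n)"
proof -
  have le: "l' \<le> l" if "(k, l) \<in> plucker_indices n" "(k', l') \<in> plucker_indices n" "val (k, l) = val (k', l')"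
    for k l k' l'
  proof (rule ccontr)
    assume *: "\<not> l' \<le> l"
    then have l': "l' \<in> {3..n}" using that by (auto simp: plucker_indices_def)
    have "older l' (val (k, l))" using * that by (intro val_older) (auto simp: plucker_indices_def)
    then have "lookup (val (k', l')) (yv l') = 0" "lookup (val (k', l')) (zv l') = 0"
      using l' that(3) by (auto simp: older_def)
    then show False using val_newest[OF that(2) l'] by (auto split: if_splits)
  qed
  have "k = k'" if "(k, l) \<in> plucker_indices n" "(k', l) \<in> plucker_indices n" "val (k, l) = val (k', l)" for k k' l
    using that
  proof (induction l arbitrary: k k' rule: less_induct)
    case (less l)
    show ?case
    proof (cases "l \<in> {3..n}")
      case False
      then show ?thesis using less.prems by (auto simp: plucker_indices_def)
    next
      case True
      note a = ij[OF True]
      have iff: "k = ia l \<longleftrightarrow> k' = ia l"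
        using val_newest(1)[OF less.prems(1) True] val_newest(1)[OF less.prems(2) True] less.prems(3)
        by (metis zero_neq_one)
      show ?thesis
      proof (cases "k = ia l")
        case True
        then show ?thesis using iff by simp
      next
        case False
        have k: "k \<in> {1..<l}" "k' \<in> {1..<l}" using less.prems by (auto simp: plucker_indices_def)
        have eq: "val (k, ia l) = val (k', ia l)"
          using less.prems(3) val_rec_y[OF True k(1)] val_rec_y[OF True k(2)] False iff by simp
        \<comment> \<open>The induction hypothesis is about ordered pairs.\<close>
        define srt where "srt x = (min x (ia l), max x (ia l))" for x
        have srt: "srt x \<in> plucker_indices n" "val (srt x) = val (x, ia l)" "snd (srt x) < l" if "x \<in> {1..<l}" "x \<noteq> ia l" for x
        proof -
          have *: "srt x = (x, ia l) \<and> x < ia l \<or> srt x = (ia l, x) \<and> ia l < x"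
            using that(2) by (cases "x < ia l") (auto simp: srt_def)
          have "1 \<le> x" "x < l" "1 \<le> ia l" "ia l < l" "l \<le> n" using that(1) a \<open>l \<in> {3..n}\<close> by auto
          then show "srt x \<in> plucker_indices n" "snd (srt x) < l"
            using * by (auto simp: plucker_indices_def)
          show "val (srt x) = val (x, ia l)" using * val_swap[of "ia l" x] by auto
        qed
        have ok: "srt k \<in> plucker_indices n" "val (srt k) = val (k, ia l)" "snd (srt k) < l"
          "srt k' \<in> plucker_indices n" "val (srt k') = val (k', ia l)" "snd (srt k') < l"
          using srt[of k] srt[of k'] k False iff by auto
        have s: "snd (srt k) = snd (srt k')"
          using le[of "fst (srt k)" "snd (srt k)" "fst (srt k')" "snd (srt k')"]
            le[of "fst (srt k')" "snd (srt k')" "fst (srt k)" "snd (srt k)"] ok eq by simp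
        have f: "fst (srt k) = fst (srt k')"
          using less.IH[of "snd (srt k)" "fst (srt k)" "fst (srt k')"] ok eq s by (metis prod.collapse)
        show ?thesis using s f False iff by (auto simp: srt_def min_def max_def split: if_splits)
      qed
    qed
  qed
  note fst_eq = this
  show ?thesis
  proof (rule inj_onI)
    fix p q assume pq: "p \<in> plucker_indices n" "q \<in> plucker_indices n" "val p = val q"
    obtain k l k' l' where kl: "p = (k, l)" "q = (k', l')" by (cases p, cases q) blast
    have "l = l'" using le[of k l k' l'] le[of k' l' k l] pq unfolding kl by simp
    then show "p = q" using fst_eq[of k l k'] pq unfolding kl by simp
  qed
qed

definition vertex :: "nat \<times> nat \<Rightarrow> real ^ 'd::{finite,linorder}" where
  "vertex p = real_vec (exponent_vec (val p))"

definition vertices :: "(real ^ 'd::{finite,linorder}) set" where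
  "vertices = vertex ` plucker_indices n"

lemma vertex_nth: "vertex p $ k = real (lookup (val p) k)"
  by (simp add: vertex_def real_vec_def)

lemma vertex_mem: "i \<in> {1..n} \<Longrightarrow> j \<in> {1..n} \<Longrightarrow> i \<noteq> j \<Longrightarrow> vertex (i, j) \<in> vertices"
proof -
  assume ij: "i \<in> {1..n}" "j \<in> {1..n}" "i \<noteq> j"
  have "vertex (i, j) = vertex (j, i)" using val_swap[of i j] by (simp add: vertex_def)
  then show ?thesis using ij unfolding vertices_def
    by (cases i j rule: linorder_cases) (auto simp: plucker_indices_def intro: rev_image_eqI)
qed

lemma finite_vertices: "finite vertices"
  unfolding vertices_def using finite_plucker_indices by blast

lemma plucker_coord_nonzero:
  assumes "(i, j) \<in> plucker_indices n"
  shows "plucker_coord n i j \<in> graded_piece n 1" "plucker_coord n i j \<noteq> \<zero>\<^bsub>coord_ring n\<^esub>"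
proof -
  interpret id: coefficient_hom "\<lambda>c :: complex. c" by (rule id_hom)
  have F: "var_poly (i, j) \<in> carrier (plucker_poly_ring n)" "homogeneous_poly 1 (var_poly (i, j) :: plucker_poly)"
    using assms by (auto simp: plucker_ring_simps var_poly_def homogeneous_poly_def)
  then show "plucker_coord n i j \<in> graded_piece n 1"
    unfolding plucker_coord_def graded_piece_def by blast
  define v :: "complex vectors" where "v x = (of_bool (x = i), of_bool (x = j))" for x
  have "bracket v (i, j) = 1" using assms by (auto simp: bracket_def v_def plucker_indices_def)
  then have "subst_poly (\<lambda>c. c) (bracket v) (var_poly (i, j)) \<noteq> 0" by (simp add: id.subst_var)
  then have "var_poly (i, j) \<notin> plucker_ideal n" unfolding plucker_ideal_iff by blast
  then show "plucker_coord n i j \<noteq> \<zero>\<^bsub>coord_ring n\<^esub>"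
    using coord_class_eq_zero_iff[OF F(1)] by (simp add: plucker_coord_def)
qed

text \<open>A value of degree \<open>m\<close> divided by \<open>m\<close> is the mean of \<open>m\<close> vertices, and conversely each vertex is a value
  of degree one. A polytope is closed.\<close>

theorem newton_okounkov_body_eq: "newton_okounkov_body n S = convex hull vertices"
proof -
  define U :: "(real ^ 'd::{finite,linorder}) set" where
    "U = (\<Union>m\<in>{0<..}. {(1 / real m) *\<^sub>R real_vec (valuation n S f) | f.
        f \<in> graded_piece n m \<and> f \<noteq> \<zero>\<^bsub>coord_ring n\<^esub>})"
  have "U \<subseteq> convex hull vertices"
  proof
    fix x assume "x \<in> U"
    then obtain m f where m: "m > 0" "f \<in> graded_piece n m" "f \<noteq> \<zero>\<^bsub>coord_ring n\<^esub>"
      "x = (1 / real m) *\<^sub>R real_vec (valuation n S f)" by (auto simp: U_def)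
    obtain ps where ps: "ps \<in> bracket_lists n" "length ps = m"
      "valuation n S f = (exponent_vec (sum_list (map val ps)) :: int ^ 'd::{finite,linorder})"
      by (rule valuation_graded_piece[OF m(2,3)])
    have "x = (1 / real (length ps)) *\<^sub>R sum_list (map vertex ps)"
      using ps by (simp add: m(4) real_vec_exponent_sum_list vertex_def[abs_def])
    also have "\<dots> \<in> convex hull vertices"
    proof (rule mean_in_convex)
      show "ps \<noteq> []" using ps m(1) by auto
      fix p assume "p \<in> set ps"
      then show "vertex p \<in> convex hull vertices"
        using ps(1) vertex_mem[of "fst p" "snd p"] by (intro hull_inc) (auto simp: in_bracket_lists_iff)
    qed (rule convex_convex_hull)
    finally show "x \<in> convex hull vertices" .
  qed
  moreover have "vertices \<subseteq> U"
  proof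
    fix x assume "x \<in> vertices"
    then obtain i j where ij: "(i, j) \<in> plucker_indices n" "x = vertex (i, j)" by (auto simp: vertices_def)
    have "i \<in> {1..n}" "j \<in> {1..n}" "i \<noteq> j" using ij(1) by (auto simp: plucker_indices_def)
    then have "x = (1 / real 1) *\<^sub>R real_vec (valuation n S (plucker_coord n i j))"
      by (simp add: valuation_plucker_coord ij(2) vertex_def)
    then show "x \<in> U" unfolding U_def using plucker_coord_nonzero[OF ij(1)] by force
  qed
  ultimately have "convex hull U = convex hull vertices"
    by (metis convex_convex_hull hull_mono hull_hull order_antisym)
  moreover have "closed (convex hull vertices)"
    using finite_vertices by (simp add: compact_imp_closed finite_imp_compact_convex_hull)
  ultimately show ?thesis by (simp add: newton_okounkov_body_def U_def closure_closed)
qed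

lemma vertex_01: "x \<in> vertices \<Longrightarrow> x $ k \<in> {0, 1}"
proof -
  assume "x \<in> vertices"
  then obtain i j where ij: "(i, j) \<in> plucker_indices n" "x = vertex (i, j)" by (auto simp: vertices_def)
  have "lookup (val (i, j)) k \<le> 1" using ij(1) by (intro val_le_1) (auto simp: plucker_indices_def)
  then have "lookup (val (i, j)) k = 0 \<or> lookup (val (i, j)) k = 1" by linarith
  then show ?thesis by (auto simp: ij(2) vertex_nth)
qed

end

lemma hypercube_bounds:
  fixes x :: "real ^ 'd"
  shows "x \<in> hypercube \<Longrightarrow> 0 \<le> x $ k \<and> x $ k \<le> 1"
proof -
  assume "x \<in> hypercube"
  moreover have "hypercube \<subseteq> {x :: real ^ 'd. 0 \<le> x $ k \<and> x $ k \<le> 1}"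
    unfolding hypercube_def
  proof (rule hull_minimal)
    show "{x :: real ^ 'd. \<forall>k. x $ k \<in> {0, 1}} \<subseteq> {x. 0 \<le> x $ k \<and> x $ k \<le> 1}"
    proof
      fix x :: "real ^ 'd" assume "x \<in> {x. \<forall>k. x $ k \<in> {0, 1}}"
      then have "x $ k = 0 \<or> x $ k = 1" by auto
      then show "x \<in> {x. 0 \<le> x $ k \<and> x $ k \<le> 1}" by auto
    qed
    show "convex {x :: real ^ 'd. 0 \<le> x $ k \<and> x $ k \<le> 1}"
      by (auto simp: convex_def intro!: add_nonneg_nonneg convex_bound_le)
  qed
  ultimately show ?thesis by auto
qed

lemma interior_hypercube_no_lattice_points: "interior hypercube \<inter> (lattice_points :: (real ^ 'd) set) = {}"
proof -
  have "hypercube \<subseteq> (cbox 0 1 :: (real ^ 'd) set)"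
    by (auto simp: mem_box_cart hypercube_bounds)
  then have "interior hypercube \<subseteq> (box 0 1 :: (real ^ 'd) set)"
    using interior_mono interior_cbox by metis
  moreover have "real_vec m \<notin> box 0 1" for m :: "int ^ 'd"
  proof
    assume "real_vec m \<in> box 0 1"
    then have "0 < real_of_int (m $ k) \<and> real_of_int (m $ k) < 1" for k by (simp add: mem_box_cart real_vec_def)
    then have "0 < m $ k \<and> m $ k < 1" for k by (metis of_int_0_less_iff of_int_less_1_iff)
    then have "m $ undefined > 0" "m $ undefined < 1" by blast+
    then show False by linarith
  qed
  ultimately show ?thesis unfolding lattice_points_def by blast
qed

text \<open>A coordinate of a convex combination of points of the cube is \<open>0\<close> or \<open>1\<close> only if both points agree
  there, so no point with 0/1 coordinates lies inside a segment.\<close>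

lemma extreme_points_of_01_hull:
  fixes X :: "(real ^ 'd) set"
  assumes "finite X" "\<And>x k. x \<in> X \<Longrightarrow> x $ k \<in> {0, 1}"
  shows "{x. x extreme_point_of (convex hull X)} = X"
proof (intro equalityI subsetI)
  fix x assume "x \<in> {x. x extreme_point_of (convex hull X)}"
  then show "x \<in> X" using extreme_point_of_convex_hull by blast
next
  fix x assume x: "x \<in> X"
  have cube: "convex hull X \<subseteq> hypercube"
    unfolding hypercube_def using assms(2) by (intro hull_mono) blast
  have "x extreme_point_of (convex hull X)"
    unfolding extreme_point_of_def
  proof (intro conjI ballI notI)
    show "x \<in> convex hull X" using x by (rule hull_inc)
    fix a b assume ab: "a \<in> convex hull X" "b \<in> convex hull X" "x \<in> open_segment a b"
    then obtain u where u: "0 < u" "u < 1" "x = (1 - u) *\<^sub>R a + u *\<^sub>R b" "a \<noteq> b"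
      by (auto simp: in_segment)
    have "a $ k = b $ k" for k
    proof -
      have bd: "0 \<le> a $ k" "a $ k \<le> 1" "0 \<le> b $ k" "b $ k \<le> 1"
        using hypercube_bounds ab(1,2) cube by blast+
      have e: "x $ k = (1 - u) * a $ k + u * b $ k" by (simp add: u(3))
      have "x $ k = 0 \<or> x $ k = 1" using assms(2)[OF x, of k] by auto
      then show ?thesis
      proof
        assume "x $ k = 0"
        moreover have "(1 - u) * a $ k \<ge> 0" "u * b $ k \<ge> 0" using bd u by auto
        ultimately have "(1 - u) * a $ k = 0" "u * b $ k = 0" using e by linarith+
        then show ?thesis using u by simp
      next
        assume "x $ k = 1"
        then have "(1 - u) * (1 - a $ k) + u * (1 - b $ k) = 0" using e by (simp add: algebra_simps)
        moreover have "(1 - u) * (1 - a $ k) \<ge> 0" "u * (1 - b $ k) \<ge> 0" using bd u by auto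
        ultimately have "(1 - u) * (1 - a $ k) = 0" "u * (1 - b $ k) = 0" by linarith+
        then show ?thesis using u by simp
      qed
    qed
    then show False using u(4) by (simp add: Finite_Cartesian_Product.vec_eq_iff)
  qed
  then show "x \<in> {x. x extreme_point_of (convex hull X)}" by simp
qed

context iterated_roots begin

lemma card_vertices: "card vertices = n choose 2"
proof -
  have "inj_on vertex (plucker_indices n)"
  proof (rule inj_onI)
    fix p q assume *: "p \<in> plucker_indices n" "q \<in> plucker_indices n" "vertex p = vertex q"
    have "val p = val q"
    proof (rule poly_mapping_eqI)
      fix k
      have "vertex p $ k = vertex q $ k" using *(3) by simp
      then show "lookup (val p) k = lookup (val q) k" by (simp add: vertex_nth)
    qed
    then show "p = q" using inj_onD[OF val_inj] * by blast
  qed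
  then show ?thesis by (simp add: vertices_def card_image card_plucker_indices)
qed

lemma vertices_eq: "vertices = {real_vec (valuation n S (plucker_coord n i j)) | i j. 1 \<le> i \<and> i < j \<and> j \<le> n}"
proof -
  have "vertex (i, j) = real_vec (valuation n S (plucker_coord n i j))" if "1 \<le> i" "i < j" "j \<le> n" for i j
    using that by (simp add: valuation_plucker_coord vertex_def)
  then have "vertices = (\<lambda>(i, j). real_vec (valuation n S (plucker_coord n i j))) ` plucker_indices n"
    unfolding vertices_def by (intro image_cong refl) (auto simp: plucker_indices_def)
  then show ?thesis by (auto simp: plucker_indices_def)
qed

lemma hull_vertices_subset_hypercube: "convex hull vertices \<subseteq> hypercube"
  unfolding hypercube_def using vertex_01 by (intro hull_mono) blast

end

section \<open>Quartets of leaves in a graph\<close>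

definition adjacent_in :: "'v graph \<Rightarrow> 'v set \<Rightarrow> ('v \<times> 'v) set" where
  "adjacent_in G A = {(u, v). u \<in> A \<and> v \<in> A \<and> {u, v} \<in> snd G}"

definition connected_in :: "'v graph \<Rightarrow> 'v set \<Rightarrow> bool" where
  "connected_in G A \<longleftrightarrow> A \<subseteq> fst G \<and> (\<forall>x\<in>A. \<forall>y\<in>A. (x, y) \<in> (adjacent_in G A)\<^sup>*)"

text \<open>In a tree: some edge separates \<open>{p, q}\<close> from \<open>{r, s}\<close>. Connected vertex sets in place of paths or edge cuts make
  both the transport along a map and the extension to a larger tree a matter of images.\<close>

definition quartet :: "'v graph \<Rightarrow> 'v \<Rightarrow> 'v \<Rightarrow> 'v \<Rightarrow> 'v \<Rightarrow> bool" where
  "quartet G p q r s \<longleftrightarrow> (\<exists>A B. connected_in G A \<and> connected_in G B \<and> A \<inter> B = {} \<and>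
     p \<in> A \<and> q \<in> A \<and> r \<in> B \<and> s \<in> B)"

lemma quartetI:
  "connected_in G A \<Longrightarrow> connected_in G B \<Longrightarrow> A \<inter> B = {} \<Longrightarrow> p \<in> A \<Longrightarrow> q \<in> A \<Longrightarrow> r \<in> B \<Longrightarrow> s \<in> B \<Longrightarrow>
    quartet G p q r s"
  unfolding quartet_def by blast

lemma rtrancl_map_rel:
  assumes "(x, y) \<in> r\<^sup>*" "\<And>u v. (u, v) \<in> r \<Longrightarrow> (f u, f v) \<in> s\<^sup>*"
  shows "(f x, f y) \<in> s\<^sup>*"
  using assms(1) by (induction rule: rtrancl_induct) (auto intro: rtrancl_trans assms(2))

lemma adjacent_in_sym: "sym (adjacent_in G A)"
  by (auto simp: adjacent_in_def sym_def insert_commute)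

lemma connected_inI_root:
  assumes "A \<subseteq> fst G" "\<And>x. x \<in> A \<Longrightarrow> (x, r) \<in> (adjacent_in G A)\<^sup>*"
  shows "connected_in G A"
  unfolding connected_in_def
proof (intro conjI ballI assms(1))
  fix x y assume xy: "x \<in> A" "y \<in> A"
  have "(x, r) \<in> (adjacent_in G A)\<^sup>*" by (rule assms(2)[OF xy(1)])
  moreover from assms(2)[OF xy(2)] have "(r, y) \<in> (adjacent_in G A)\<^sup>*"
    by (rule symD[OF sym_rtrancl[OF adjacent_in_sym]])
  ultimately show "(x, y) \<in> (adjacent_in G A)\<^sup>*" by (meson rtrancl_trans)
qed

lemma connected_in_image:
  assumes "connected_in G A" "f ` A \<subseteq> fst H"
    and "\<And>u v. u \<in> A \<Longrightarrow> v \<in> A \<Longrightarrow> {u, v} \<in> snd G \<Longrightarrow> f u = f v \<or> {f u, f v} \<in> snd H"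
  shows "connected_in H (f ` A)"
  unfolding connected_in_def
proof (intro conjI assms(2) ballI)
  fix x' y' assume "x' \<in> f ` A" "y' \<in> f ` A"
  then obtain x y where xy: "x \<in> A" "y \<in> A" "x' = f x" "y' = f y" by blast
  have "(f x, f y) \<in> (adjacent_in H (f ` A))\<^sup>*"
  proof (rule rtrancl_map_rel[where f = f and r = "adjacent_in G A"])
    show "(x, y) \<in> (adjacent_in G A)\<^sup>*" using assms(1) xy by (simp add: connected_in_def)
    fix u v assume "(u, v) \<in> adjacent_in G A"
    then show "(f u, f v) \<in> (adjacent_in H (f ` A))\<^sup>*"
      using assms(3)[of u v] by (cases "f u = f v") (auto simp: adjacent_in_def intro!: r_into_rtrancl)
  qed
  then show "(x', y') \<in> (adjacent_in H (f ` A))\<^sup>*" by (simp add: xy)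
qed

lemma quartet_isomorphism:
  assumes "bij_betw f (fst G) (fst H)" "(\<lambda>e. f ` e) ` snd G = snd H" "quartet G p q r s"
  shows "quartet H (f p) (f q) (f r) (f s)"
proof -
  obtain A B where AB: "connected_in G A" "connected_in G B" "A \<inter> B = {}" "p \<in> A" "q \<in> A" "r \<in> B" "s \<in> B"
    using assms(3) by (auto simp: quartet_def)
  have im: "connected_in H (f ` C)" if "connected_in G C" for C
  proof (rule connected_in_image[OF that])
    show "f ` C \<subseteq> fst H" using that assms(1) unfolding connected_in_def bij_betw_def by blast
    fix u v assume "{u, v} \<in> snd G"
    then have "f ` {u, v} \<in> snd H" using assms(2) by blast
    then show "f u = f v \<or> {f u, f v} \<in> snd H" by simp
  qed
  have "f ` A \<inter> f ` B = {}"
    using AB assms(1) inj_on_image_Int[of f "fst G" A B] by (auto simp: connected_in_def bij_betw_def)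
  then show ?thesis unfolding quartet_def using im[OF AB(1)] im[OF AB(2)] AB(4-7) by blast
qed

lemma graph_isomorphism_inverse:
  assumes "bij_betw f (fst G) (fst H)" "(\<lambda>e. f ` e) ` snd G = snd H" "\<And>e. e \<in> snd G \<Longrightarrow> e \<subseteq> fst G"
  shows "bij_betw (inv_into (fst G) f) (fst H) (fst G)" "(\<lambda>e. inv_into (fst G) f ` e) ` snd H = snd G"
proof -
  show "bij_betw (inv_into (fst G) f) (fst H) (fst G)" using assms(1) by (rule bij_betw_inv_into)
  have "inv_into (fst G) f ` f ` e = e" if "e \<in> snd G" for e
    using assms(1) assms(3)[OF that] by (simp add: bij_betw_def inv_into_image_cancel)
  then show "(\<lambda>e. inv_into (fst G) f ` e) ` snd H = snd G"
    unfolding assms(2)[symmetric] image_image by simp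
qed

section \<open>Trees grown by cherries\<close>

lemma two_edgesI:
  "e \<in> E \<Longrightarrow> e' \<in> E \<Longrightarrow> e \<noteq> e' \<Longrightarrow> x \<in> e \<Longrightarrow> x \<in> e' \<Longrightarrow> \<exists>e\<in>E. \<exists>e'\<in>E. e \<noteq> e' \<and> x \<in> e \<and> x \<in> e'"
  by blast

lemma snd_attach_leaf:
  "snd (attach_leaf i l G) = {e \<in> snd G. Leaf i \<notin> e} \<union> {insert (Inner l) (e - {Leaf i}) | e. e \<in> snd G \<and> Leaf i \<in> e}
        \<union> {{Inner l, Leaf i}, {Inner l, Leaf l}}"
  by (simp add: attach_leaf_def case_prod_unfold)

text \<open>\<open>T l\<close> is the tree with leaves \<open>1, \<dots>, l\<close>, and \<open>c l\<close> the leaf that forms a cherry with \<open>l\<close> when \<open>l\<close> is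
  attached.\<close>

locale cherry_tree =
  fixes n :: nat and c :: "nat \<Rightarrow> nat" and T :: "nat \<Rightarrow> node graph"
  assumes T_3: "T 3 = tripod"
    and T_Suc: "3 \<le> l \<Longrightarrow> l < n \<Longrightarrow> T (Suc l) = attach_leaf (c (Suc l)) (Suc l) (T l)"
    and c_range: "4 \<le> l \<Longrightarrow> l \<le> n \<Longrightarrow> c l \<in> {1..<l}"
begin

text \<open>The index of the inner vertex next to leaf \<open>i\<close> in \<open>T l\<close>; the value \<open>3\<close> below \<open>l = 3\<close> is a default.\<close>

fun leaf_neighbour :: "nat \<Rightarrow> nat \<Rightarrow> nat" where
  "leaf_neighbour 0 i = 3"
| "leaf_neighbour (Suc l) i = (if l < 3 then 3 else if i = c (Suc l) \<or> i = Suc l then Suc l else leaf_neighbour l i)"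

text \<open>Attaching \<open>m\<close> subdivides the edge between leaf \<open>c m\<close> and its neighbour, so the new inner vertex is
  joined to that neighbour.\<close>

definition parent :: "nat \<Rightarrow> nat" where
  "parent m = leaf_neighbour (m - 1) (c m)"

definition inner_edges :: "nat \<Rightarrow> node set set" where
  "inner_edges l = (\<lambda>m. {Inner m, Inner (parent m)}) ` {4..l}"

definition leaf_edges :: "nat \<Rightarrow> node set set" where
  "leaf_edges l = (\<lambda>i. {Inner (leaf_neighbour l i), Leaf i}) ` {1..l}"

lemma leaf_neighbour_3 [simp]: "leaf_neighbour 3 i = 3"
  by (simp add: numeral_3_eq_3)

lemma leaf_neighbour_Suc: "3 \<le> l \<Longrightarrow> leaf_neighbour (Suc l) i = (if i = c (Suc l) \<or> i = Suc l then Suc l else leaf_neighbour l i)"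
  by simp

declare leaf_neighbour.simps [simp del]

lemma leaf_neighbour_range: "3 \<le> l \<Longrightarrow> leaf_neighbour l i \<in> {3..l}"
proof (induction l rule: dec_induct)
  case (step m)
  then show ?case by (auto simp: leaf_neighbour_Suc)
qed simp

lemma parent_range: "4 \<le> m \<Longrightarrow> parent m \<in> {3..<m}"
proof -
  assume "4 \<le> m"
  then have "3 \<le> m - 1" by simp
  from leaf_neighbour_range[OF this, of "c m"] \<open>4 \<le> m\<close> show ?thesis by (auto simp: parent_def)
qed

lemma tree_structure:
  assumes "3 \<le> l" "l \<le> n"
  shows "T l = (Leaf ` {1..l} \<union> Inner ` {3..l}, inner_edges l \<union> leaf_edges l)"
  using assms
proof (induction l rule: dec_induct)
  case base
  have "{1..3::nat} = {1, 2, 3}" by auto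
  then show ?case unfolding T_3 tripod_def inner_edges_def leaf_edges_def by auto
next
  case (step l)
  define a where "a = c (Suc l)"
  have a: "a \<in> {1..l}" using c_range[of "Suc l"] step by (auto simp: a_def)
  let ?E = "inner_edges l \<union> leaf_edges l"
  have IH: "T l = (Leaf ` {1..l} \<union> Inner ` {3..l}, ?E)" using step by simp
  have V: "Leaf ` {1..Suc l} \<union> Inner ` {3..Suc l} = Leaf ` {1..l} \<union> Inner ` {3..l} \<union> {Inner (Suc l), Leaf (Suc l)}"
    using step by (auto simp: atLeastAtMostSuc_conv)
  have Ea: "{e \<in> ?E. Leaf a \<in> e} = {{Inner (leaf_neighbour l a), Leaf a}}"
    using a by (auto simp: inner_edges_def leaf_edges_def)
  have En: "{e \<in> ?E. Leaf a \<notin> e} = inner_edges l \<union> (\<lambda>i. {Inner (leaf_neighbour l i), Leaf i}) ` ({1..l} - {a})"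
    by (auto simp: inner_edges_def leaf_edges_def)
  have sub: "{insert (Inner (Suc l)) (e - {Leaf a}) |e. e \<in> ?E \<and> Leaf a \<in> e} = {{Inner (Suc l), Inner (leaf_neighbour l a)}}"
  proof -
    have "{insert (Inner (Suc l)) (e - {Leaf a}) |e. e \<in> ?E \<and> Leaf a \<in> e}
        = (\<lambda>e. insert (Inner (Suc l)) (e - {Leaf a})) ` {e \<in> ?E. Leaf a \<in> e}" by auto
    then show ?thesis unfolding Ea by auto
  qed
  have inner: "inner_edges (Suc l) = inner_edges l \<union> {{Inner (Suc l), Inner (leaf_neighbour l a)}}"
    using step by (simp add: inner_edges_def atLeastAtMostSuc_conv parent_def a_def)
  have "{1..Suc l} = ({1..l} - {a}) \<union> {a, Suc l}" using a by auto
  then have leaf: "leaf_edges (Suc l) = (\<lambda>i. {Inner (leaf_neighbour l i), Leaf i}) ` ({1..l} - {a})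
      \<union> {{Inner (Suc l), Leaf a}, {Inner (Suc l), Leaf (Suc l)}}"
    unfolding leaf_edges_def using step by (auto simp: leaf_neighbour_Suc a_def image_Un)
  have "T (Suc l) = attach_leaf a (Suc l) (T l)" using T_Suc step by (simp add: a_def)
  then show ?case
    unfolding IH attach_leaf_def prod.case sub En V inner leaf by (simp add: Un_ac insert_commute)
qed

lemma leaf_in_connected:
  assumes "connected_in (T l) A" "Leaf x \<in> A" "3 \<le> l" "l \<le> n"
  shows "x \<in> {1..l}"
proof -
  have "Leaf x \<in> fst (T l)" using assms(1,2) unfolding connected_in_def by blast
  then show ?thesis unfolding tree_structure[OF assms(3,4)] by auto
qed

lemma leaf_degree:
  assumes "3 \<le> l" "l \<le> n" "i \<in> {1..l}"
  shows "{e \<in> snd (T l). Leaf i \<in> e} = {{Inner (leaf_neighbour l i), Leaf i}}"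
  using assms by (auto simp: tree_structure inner_edges_def leaf_edges_def)

lemma edge_subset:
  assumes "3 \<le> l" "l \<le> n" "e \<in> snd (T l)"
  shows "e \<subseteq> fst (T l)"
proof -
  have "e \<in> inner_edges l \<or> e \<in> leaf_edges l" using assms(3) by (simp add: tree_structure[OF assms(1,2)])
  then have "e \<subseteq> Leaf ` {1..l} \<union> Inner ` {3..l}"
  proof
    assume "e \<in> inner_edges l"
    then obtain m where m: "m \<in> {4..l}" "e = {Inner m, Inner (parent m)}" by (auto simp: inner_edges_def)
    then have "m \<in> {3..l}" "parent m \<in> {3..l}" using parent_range[of m] by auto
    then show ?thesis by (simp add: m(2))
  next
    assume "e \<in> leaf_edges l"
    then obtain i where i: "i \<in> {1..l}" "e = {Inner (leaf_neighbour l i), Leaf i}" by (auto simp: leaf_edges_def)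
    then show ?thesis using leaf_neighbour_range[OF assms(1), of i] by simp
  qed
  then show ?thesis by (simp add: tree_structure[OF assms(1,2)])
qed

text \<open>Subdivision replaces an edge at an inner vertex by another one at the same vertex. Together with
  \<open>leaf_degree\<close> this shows that the leaves can be recognized in the graph.\<close>

lemma inner_degree:
  assumes "3 \<le> l" "l \<le> n" "m \<in> {3..l}"
  shows "\<exists>e\<in>snd (T l). \<exists>e'\<in>snd (T l). e \<noteq> e' \<and> Inner m \<in> e \<and> Inner m \<in> e'"
  using assms
proof (induction l rule: dec_induct)
  case base
  then have "m = 3" by simp
  have "{Inner 3, Leaf 1} \<in> leaf_edges 3" "{Inner 3, Leaf 2} \<in> leaf_edges 3"
    by (auto simp: leaf_edges_def)
  moreover have "leaf_edges 3 \<subseteq> snd (T 3)" using tree_structure[of 3] base by simp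
  ultimately have "{Inner 3, Leaf 1} \<in> snd (T 3)" "{Inner 3, Leaf 2} \<in> snd (T 3)" by blast+
  moreover have "{Inner 3, Leaf 1} \<noteq> {Inner 3, Leaf 2}" by (simp add: doubleton_eq_iff)
  ultimately show ?case unfolding \<open>m = 3\<close> by (rule two_edgesI) simp_all
next
  case (step l)
  define a where "a = c (Suc l)"
  have a: "a \<in> {1..l}" using c_range[of "Suc l"] step by (auto simp: a_def)
  have T: "T (Suc l) = attach_leaf a (Suc l) (T l)" using T_Suc step by (simp add: a_def)
  show ?case
  proof (cases "m = Suc l")
    case True
    have "{Inner m, Leaf a} \<in> snd (T (Suc l))" "{Inner m, Leaf m} \<in> snd (T (Suc l))"
      unfolding T True snd_attach_leaf by blast+
    moreover have "{Inner m, Leaf a} \<noteq> {Inner m, Leaf m}" using a True by (simp add: doubleton_eq_iff)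
    ultimately show ?thesis by (rule two_edgesI) simp_all
  next
    case False
    then obtain e e' where e: "e \<in> snd (T l)" "e' \<in> snd (T l)" "e \<noteq> e'" "Inner m \<in> e" "Inner m \<in> e'"
      using step by auto
    define r where "r e = (if Leaf a \<in> e then insert (Inner (Suc l)) (e - {Leaf a}) else e)" for e
    have r: "r e \<in> snd (T (Suc l))" "Inner m \<in> r e" if "e \<in> snd (T l)" "Inner m \<in> e" for e
      using that unfolding T snd_attach_leaf r_def by (cases "Leaf a \<in> e"; auto)+
    have new: "Inner (Suc l) \<notin> x" if "x \<in> snd (T l)" for x
    proof -
      have "x \<subseteq> fst (T l)" by (rule edge_subset[OF _ _ that]) (use step in auto)
      moreover have "Inner (Suc l) \<notin> fst (T l)" using step by (auto simp: tree_structure)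
      ultimately show ?thesis by blast
    qed
    have "r e \<noteq> r e'"
    proof
      assume eq: "r e = r e'"
      have "Leaf a \<in> e \<longleftrightarrow> Leaf a \<in> e'" using eq new[OF e(1)] new[OF e(2)] by (auto simp: r_def split: if_splits)
      moreover have "e = e'" if "Leaf a \<in> e" "Leaf a \<in> e'"
      proof -
        have "e \<in> {e \<in> snd (T l). Leaf a \<in> e}" "e' \<in> {e \<in> snd (T l). Leaf a \<in> e}" using that e by blast+
        moreover have "l \<le> n" using step.prems by simp
        ultimately show ?thesis using leaf_degree[OF step.hyps(1) _ a] by auto
      qed
      ultimately show False using eq e(3) by (auto simp: r_def split: if_splits)
    qed
    then show ?thesis using r[OF e(1,4)] r[OF e(2,5)] by (intro two_edgesI[of "r e" _ "r e'"])
  qed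
qed

lemma inner_connected:
  assumes "3 \<le> l" "l \<le> m" "m \<le> n" "Inner ` {3..l} \<subseteq> A" "x \<in> {3..l}"
  shows "(Inner x, Inner 3) \<in> (adjacent_in (T m) A)\<^sup>*"
  using assms(5)
proof (induction x rule: less_induct)
  case (less x)
  show ?case
  proof (cases "x = 3")
    case False
    then have x: "4 \<le> x" "x \<le> l" using less.prems by auto
    have p: "parent x \<in> {3..l}" "parent x < x" using parent_range[OF x(1)] x by auto
    have "{Inner x, Inner (parent x)} \<in> snd (T m)"
      using x assms by (auto simp: tree_structure inner_edges_def)
    then have "(Inner x, Inner (parent x)) \<in> adjacent_in (T m) A"
      using assms(4) less.prems p by (auto simp: adjacent_in_def)
    then show ?thesis using less.IH[OF p(2,1)] by (rule converse_rtrancl_into_rtrancl)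
  qed simp
qed

text \<open>The cherry with its centre is one connected set; the inner vertices that are older than the centre,
  together with the two other leaves, are the other one.\<close>

lemma cherry_quartet:
  assumes l: "4 \<le> l" "l \<le> n" and k: "k \<in> {1..<l} - {c l}" "k' \<in> {1..<l} - {c l}"
  shows "quartet (T l) (Leaf (c l)) (Leaf l) (Leaf k) (Leaf k')"
proof -
  define A where "A = {Leaf (c l), Inner l, Leaf l}"
  define B where "B = {Leaf k, Leaf k'} \<union> Inner ` {3..l-1}"
  note a = c_range[OF l]
  have T: "T l = (Leaf ` {1..l} \<union> Inner ` {3..l}, inner_edges l \<union> leaf_edges l)"
    using l by (intro tree_structure) auto
  have le: "{Inner (leaf_neighbour l i), Leaf i} \<in> snd (T l)" if "i \<in> {1..l}" for i
    using that by (auto simp: T leaf_edges_def)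
  have nb_new: "leaf_neighbour l (c l) = l" "leaf_neighbour l l = l" using leaf_neighbour_Suc[of "l - 1"] l by auto
  have "connected_in (T l) A"
  proof (rule connected_inI_root)
    show "A \<subseteq> fst (T l)" using a l by (auto simp: T A_def)
    fix x assume "x \<in> A"
    then consider "x = Inner l" | i where "x = Leaf i" "i \<in> {c l, l}" by (auto simp: A_def)
    then show "(x, Inner l) \<in> (adjacent_in (T l) A)\<^sup>*"
    proof cases
      case 2
      have "{Inner l, Leaf i} \<in> snd (T l)" using le[of i] nb_new 2 a l by auto
      then have "(x, Inner l) \<in> adjacent_in (T l) A" using 2 by (auto simp: adjacent_in_def A_def insert_commute)
      then show ?thesis by blast
    qed simp
  qed
  moreover have "connected_in (T l) B"
  proof (rule connected_inI_root)
    show "B \<subseteq> fst (T l)" using k by (auto simp: T B_def)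
    fix x assume "x \<in> B"
    then consider m where "x = Inner m" "m \<in> {3..l-1}" | i where "x = Leaf i" "i \<in> {k, k'}" by (auto simp: B_def)
    then show "(x, Inner 3) \<in> (adjacent_in (T l) B)\<^sup>*"
    proof cases
      case 1
      then show ?thesis using inner_connected[of "l - 1" l B m] l by (auto simp: B_def)
    next
      case 2
      have i: "i \<in> {1..<l}" "i \<noteq> c l" using 2 k by auto
      have leaf_neighbour: "leaf_neighbour l i = leaf_neighbour (l - 1) i" using leaf_neighbour_Suc[of "l - 1" i] l i by auto
      have nbr: "leaf_neighbour l i \<in> {3..l-1}" unfolding leaf_neighbour using leaf_neighbour_range[of "l - 1" i] l by auto
      have "{Inner (leaf_neighbour l i), Leaf i} \<in> snd (T l)" using le[of i] i by auto
      then have "(x, Inner (leaf_neighbour l i)) \<in> adjacent_in (T l) B"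
        using 2 nbr by (auto simp: adjacent_in_def B_def insert_commute)
      moreover have "(Inner (leaf_neighbour l i), Inner 3) \<in> (adjacent_in (T l) B)\<^sup>*"
        using inner_connected[of "l - 1" l B "leaf_neighbour l i"] l nbr by (auto simp: B_def)
      ultimately show ?thesis by (rule converse_rtrancl_into_rtrancl)
    qed
  qed
  moreover have "A \<inter> B = {}" using k l by (auto simp: A_def B_def)
  ultimately show ?thesis
    unfolding quartet_def by (intro exI[of _ A] exI[of _ B]) (auto simp: A_def B_def)
qed

text \<open>Only the edge at leaf \<open>c (Suc l)\<close> is lost, and the path through the new inner vertex replaces it.\<close>

lemma connected_in_attach:
  assumes l: "3 \<le> l" "l < n" and A: "connected_in (T l) A"
  shows "connected_in (T (Suc l)) (A \<union> (if Leaf (c (Suc l)) \<in> A then {Inner (Suc l)} else {}))"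
proof (cases "A = {}")
  case True
  then show ?thesis by (simp add: connected_in_def)
next
  case False
  define a where "a = c (Suc l)"
  have a: "a \<in> {1..l}" using c_range[of "Suc l"] l by (auto simp: a_def)
  define A' where "A' = A \<union> (if Leaf a \<in> A then {Inner (Suc l)} else {})"
  have T: "T l = (Leaf ` {1..l} \<union> Inner ` {3..l}, inner_edges l \<union> leaf_edges l)"
    "T (Suc l) = (Leaf ` {1..Suc l} \<union> Inner ` {3..Suc l}, inner_edges (Suc l) \<union> leaf_edges (Suc l))"
    using l tree_structure[of l] tree_structure[of "Suc l"] by auto
  have E: "snd (T (Suc l)) = snd (attach_leaf a (Suc l) (T l))" using T_Suc l by (simp add: a_def)
  have Ia: "{Inner (Suc l), Leaf a} \<in> snd (T (Suc l))"
    unfolding E snd_attach_leaf by blast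
  have step: "(u, v) \<in> (adjacent_in (T (Suc l)) A')\<^sup>*" if uv: "(u, v) \<in> adjacent_in (T l) A" for u v
  proof -
    have mem: "u \<in> A'" "v \<in> A'" "{u, v} \<in> snd (T l)" using uv by (auto simp: adjacent_in_def A'_def)
    show ?thesis
    proof (cases "Leaf a \<in> {u, v}")
      case False
      then have "{u, v} \<in> snd (T (Suc l))"
        using mem(3) unfolding E snd_attach_leaf by blast
      then show ?thesis using mem by (auto simp: adjacent_in_def)
    next
      case True
      then have "Leaf a \<in> A" using uv by (auto simp: adjacent_in_def)
      then have I: "Inner (Suc l) \<in> A'" "Leaf a \<in> A'" by (auto simp: A'_def)
      have e: "{u, v} = {Inner (leaf_neighbour l a), Leaf a}"
      proof -
        have "{u, v} \<in> {e \<in> snd (T l). Leaf a \<in> e}" using mem(3) True by blast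
        from this[unfolded leaf_degree[OF l(1) less_imp_le[OF l(2)] a]] show ?thesis by simp
      qed
      have "{Inner (Suc l), Inner (leaf_neighbour l a)} \<in> snd (T (Suc l))"
        using l by (auto simp: T inner_edges_def parent_def a_def)
      then have "(Inner (leaf_neighbour l a), Inner (Suc l)) \<in> adjacent_in (T (Suc l)) A'"
        "(Inner (Suc l), Inner (leaf_neighbour l a)) \<in> adjacent_in (T (Suc l)) A'"
        using I mem e by (auto simp: adjacent_in_def insert_commute doubleton_eq_iff)
      moreover have "(Inner (Suc l), Leaf a) \<in> adjacent_in (T (Suc l)) A'"
        "(Leaf a, Inner (Suc l)) \<in> adjacent_in (T (Suc l)) A'"
        using I Ia by (auto simp: adjacent_in_def insert_commute)
      ultimately have "(Inner (leaf_neighbour l a), Leaf a) \<in> (adjacent_in (T (Suc l)) A')\<^sup>*"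
        "(Leaf a, Inner (leaf_neighbour l a)) \<in> (adjacent_in (T (Suc l)) A')\<^sup>*"
        by (meson r_into_rtrancl rtrancl_trans)+
      then show ?thesis using e by (auto simp: doubleton_eq_iff)
    qed
  qed
  have path: "(x, y) \<in> (adjacent_in (T (Suc l)) A')\<^sup>*" if "x \<in> A" "y \<in> A" for x y
    using rtrancl_map_rel[of x y "adjacent_in (T l) A" "\<lambda>x. x"] A that step by (simp add: connected_in_def)
  obtain r0 where "r0 \<in> A" using False by blast
  define r where "r = (if Leaf a \<in> A then Leaf a else r0)"
  have r: "r \<in> A" "Leaf a \<in> A \<Longrightarrow> r = Leaf a" using \<open>r0 \<in> A\<close> by (simp_all add: r_def)
  have "connected_in (T (Suc l)) A'"
  proof (rule connected_inI_root)
    have "A \<subseteq> Leaf ` {1..l} \<union> Inner ` {3..l}" using A by (simp add: connected_in_def T)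
    also have "\<dots> \<subseteq> fst (T (Suc l))" by (auto simp: T)
    finally have "A \<subseteq> fst (T (Suc l))" .
    moreover have "Inner (Suc l) \<in> fst (T (Suc l))" using l by (simp add: T)
    ultimately show "A' \<subseteq> fst (T (Suc l))" unfolding A'_def by (cases "Leaf a \<in> A") simp_all
    fix x assume x: "x \<in> A'"
    show "(x, r) \<in> (adjacent_in (T (Suc l)) A')\<^sup>*"
    proof (cases "x \<in> A")
      case True
      then show ?thesis using path r by blast
    next
      case False
      then have "x = Inner (Suc l)" "Leaf a \<in> A" using x by (auto simp: A'_def split: if_splits)
      then have "(x, r) \<in> adjacent_in (T (Suc l)) A'" using r Ia by (auto simp: adjacent_in_def A'_def)
      then show ?thesis by blast
    qed
  qed
  then show ?thesis by (simp add: A'_def a_def)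
qed

lemma quartet_attach:
  assumes l: "3 \<le> l" "l < n" and "quartet (T l) p q r s"
  shows "quartet (T (Suc l)) p q r s"
proof -
  obtain A B where AB: "connected_in (T l) A" "connected_in (T l) B" "A \<inter> B = {}" "p \<in> A" "q \<in> A" "r \<in> B" "s \<in> B"
    using assms(3) by (auto simp: quartet_def)
  let ?f = "\<lambda>A. A \<union> (if Leaf (c (Suc l)) \<in> A then {Inner (Suc l)} else {})"
  have "Inner (Suc l) \<notin> A" "Inner (Suc l) \<notin> B"
    using AB(1,2) l by (auto simp: connected_in_def tree_structure)
  then have disj: "?f A \<inter> ?f B = {}" using AB(3) by auto
  show ?thesis
    by (rule quartetI[OF connected_in_attach[OF l AB(1)] connected_in_attach[OF l AB(2)] disj])
      (use AB(4-7) in simp_all)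
qed

lemma cherry_quartet_final:
  assumes "4 \<le> l" "l \<le> n" "k \<in> {1..<l} - {c l}" "k' \<in> {1..<l} - {c l}"
  shows "quartet (T n) (Leaf (c l)) (Leaf l) (Leaf k) (Leaf k')"
proof -
  have "quartet (T m) (Leaf (c l)) (Leaf l) (Leaf k) (Leaf k')" if "l \<le> m" "m \<le> n" for m
    using that
  proof (induction m rule: dec_induct)
    case base
    show ?case using cherry_quartet assms by blast
  next
    case (step m)
    then show ?case using quartet_attach[of m] assms(1) by simp
  qed
  then show ?thesis using assms by blast
qed

text \<open>For a tree metric the common value of the differences is the length of the edge at leaf \<open>l\<close> minus
  that of the edge at leaf \<open>c l\<close> in \<open>T l\<close>.\<close>

definition tree_like :: "(nat \<Rightarrow> nat \<Rightarrow> 'a::ab_group_add) \<Rightarrow> bool" where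
  "tree_like \<delta> \<longleftrightarrow> (\<forall>i j. \<delta> i j = \<delta> j i) \<and>
     (\<forall>l\<in>{4..n}. \<forall>k\<in>{1..<l} - {c l}. \<forall>k'\<in>{1..<l} - {c l}. \<delta> k l - \<delta> k (c l) = \<delta> k' l - \<delta> k' (c l))"

text \<open>Contracting the cherry \<open>{c l, l}\<close> of \<open>T l\<close> to the leaf \<open>c l\<close> maps a quartet to a quartet of the smaller tree,
  unless it identifies the two leaves on one side. Merging \<open>l\<close> into \<open>c l\<close> changes both sides of the claimed equation
  by the same constant for each occurrence of \<open>l\<close>, and the equation is trivial if two leaves on
  one side are identified.\<close>

lemma tree_like_quartet:
  assumes "tree_like \<delta>" "3 \<le> l" "l \<le> n"
    and "quartet (T l) (Leaf i) (Leaf j) (Leaf k) (Leaf k')" "i \<noteq> j" "k \<noteq> k'"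
  shows "\<delta> i k + \<delta> j k' = \<delta> i k' + \<delta> j k"
  using assms(2-6)
proof (induction l arbitrary: i j k k' rule: dec_induct)
  case base
  then obtain A B where AB: "connected_in (T 3) A" "connected_in (T 3) B" "A \<inter> B = {}" "Leaf i \<in> A" "Leaf j \<in> A"
    "Leaf k \<in> B" "Leaf k' \<in> B" by (auto simp: quartet_def)
  have "3 \<le> n" using base by simp
  then have "{i, j, k, k'} \<subseteq> {1..3}"
    using leaf_in_connected[OF AB(1)] leaf_in_connected[OF AB(2)] AB(4-7) by blast
  moreover have "i \<noteq> k" "i \<noteq> k'" "j \<noteq> k" "j \<noteq> k'" using AB(3-7) by blast+
  then have "card {i, j, k, k'} = 4" using base.prems(3,4) by simp
  ultimately show ?case using card_mono[of "{1..3::nat}" "{i, j, k, k'}"] by simp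
next
  case (step l)
  define l' where "l' = Suc l"
  define a where "a = c l'"
  have a: "a \<in> {1..l}" using c_range[of l'] step by (auto simp: a_def l'_def)
  have T: "T l = (Leaf ` {1..l} \<union> Inner ` {3..l}, inner_edges l \<union> leaf_edges l)"
    "T l' = (Leaf ` {1..l'} \<union> Inner ` {3..l'}, inner_edges l' \<union> leaf_edges l')"
    using step tree_structure[of l] tree_structure[of l'] by (auto simp: l'_def)
  obtain A B where AB: "connected_in (T l') A" "connected_in (T l') B" "A \<inter> B = {}" "Leaf i \<in> A" "Leaf j \<in> A"
    "Leaf k \<in> B" "Leaf k' \<in> B" using step.prems by (auto simp: quartet_def l'_def)
  have range: "{i, j, k, k'} \<subseteq> {1..l'}" 
  proof -
    have "3 \<le> l'" "l' \<le> n" using step by (auto simp: l'_def)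
    then show ?thesis using leaf_in_connected[OF AB(1)] leaf_in_connected[OF AB(2)] AB(4-7) by blast
  qed
  define \<pi> where "\<pi> v = (if v = Inner l' \<or> v = Leaf l' then Leaf a else v)" for v
  define \<rho> where "\<rho> x = (if x = l' then a else x)" for x
  have \<pi>_Leaf: "\<pi> (Leaf x) = Leaf (\<rho> x)" for x by (auto simp: \<pi>_def \<rho>_def)
  have \<pi>_edge: "\<pi> u = \<pi> v \<or> {\<pi> u, \<pi> v} \<in> snd (T l)" if uv: "{u, v} \<in> snd (T l')" for u v
  proof -
    have nbr: "leaf_neighbour l x \<noteq> l'" for x using leaf_neighbour_range[of l x] step by (auto simp: l'_def)
    consider m where "m \<in> {4..l}" "{u, v} = {Inner m, Inner (parent m)}" | "{u, v} = {Inner l', Inner (leaf_neighbour l a)}"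
      | x where "x \<in> {1..l}" "x \<noteq> a" "{u, v} = {Inner (leaf_neighbour l x), Leaf x}"
      | x where "x = a \<or> x = l'" "{u, v} = {Inner l', Leaf x}"
    proof -
      have "{u, v} \<in> inner_edges l' \<or> {u, v} \<in> leaf_edges l'" using uv by (simp add: T)
      then show thesis
      proof
        assume "{u, v} \<in> inner_edges l'"
        then obtain m where "m \<in> {4..l'}" "{u, v} = {Inner m, Inner (parent m)}" by (auto simp: inner_edges_def)
        then show thesis using that(1)[of m] that(2) by (cases "m = l'") (auto simp: parent_def a_def l'_def)
      next
        assume "{u, v} \<in> leaf_edges l'"
        then obtain x where "x \<in> {1..l'}" "{u, v} = {Inner (leaf_neighbour l' x), Leaf x}" by (auto simp: leaf_edges_def)
        then show thesis using that(3,4)[of x] step(1)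
          by (cases "x = a \<or> x = l'") (auto simp: l'_def leaf_neighbour_Suc a_def)
      qed
    qed
    then show ?thesis
    proof cases
      case 1
      have "parent m \<noteq> l'" "m \<noteq> l'" using parent_range[of m] 1 by (auto simp: l'_def)
      then have "{\<pi> u, \<pi> v} = {Inner m, Inner (parent m)}" using 1(2) by (auto simp: \<pi>_def doubleton_eq_iff)
      then show ?thesis using 1(1) by (auto simp: T inner_edges_def)
    next
      case 2
      then have "{\<pi> u, \<pi> v} = {Inner (leaf_neighbour l a), Leaf a}" using nbr by (auto simp: \<pi>_def doubleton_eq_iff)
      then show ?thesis using a by (auto simp: T leaf_edges_def)
    next
      case 3
      then have "x \<noteq> l'" by (auto simp: l'_def)
      then have "{\<pi> u, \<pi> v} = {Inner (leaf_neighbour l x), Leaf x}" using 3 nbr by (auto simp: \<pi>_def doubleton_eq_iff)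
      then show ?thesis using 3 by (auto simp: T leaf_edges_def)
    next
      case 4
      then show ?thesis by (auto simp: \<pi>_def doubleton_eq_iff)
    qed
  qed
  have conn: "connected_in (T l) (\<pi> ` C)" if C: "connected_in (T l') C" for C
  proof (rule connected_in_image[OF C])
    show "\<pi> ` C \<subseteq> fst (T l)"
    proof
      fix w assume "w \<in> \<pi> ` C"
      then obtain v where v: "v \<in> C" "w = \<pi> v" by blast
      have "v \<in> Leaf ` {1..l'} \<union> Inner ` {3..l'}" using C v(1) unfolding connected_in_def T by auto
      then show "w \<in> fst (T l)" using a v(2) by (auto simp: \<pi>_def l'_def le_Suc_eq T)
    qed
  qed (rule \<pi>_edge)
  \<comment> \<open>A connected set with two leaves that meets the new cherry contains its centre. Hence two disjoint
    ones cannot both meet it, and their images under the contraction remain disjoint.\<close>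
  have centre: "Inner l' \<in> C"
    if C: "connected_in (T l') C" and xy: "Leaf x \<in> C" "Leaf y \<in> C" "x \<noteq> y" and z: "z \<in> C" "\<pi> z = Leaf a" for C x y z
  proof (cases "z = Inner l'")
    case False
    then have "z = Leaf a \<or> z = Leaf l'" using z(2) by (auto simp: \<pi>_def split: if_splits)
    then obtain w where w: "z = Leaf w" "w = a \<or> w = l'" by blast
    have "Leaf x \<noteq> Leaf y" using xy(3) by simp
    then obtain t where t: "t \<in> C" "t \<noteq> z" using xy(1,2) by metis
    have "(z, t) \<in> (adjacent_in (T l') C)\<^sup>*" using C z t by (simp add: connected_in_def)
    then obtain s where "(z, s) \<in> adjacent_in (T l') C" using t(2) by (auto elim: converse_rtranclE)
    then have s: "s \<in> C" "{z, s} \<in> snd (T l')" by (auto simp: adjacent_in_def)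
    have "{z, s} = {Inner (leaf_neighbour l' w), Leaf w}"
    proof -
      have "{z, s} \<in> {e \<in> snd (T l'). Leaf w \<in> e}" using s(2) w(1) by simp
      moreover have "w \<in> {1..l'}" "3 \<le> l'" "l' \<le> n" using w a step by (auto simp: l'_def)
      note leaf_degree[OF this(2,3,1)]
      ultimately have "{z, s} \<in> {{Inner (leaf_neighbour l' w), Leaf w}}" by (simp only:)
      then show ?thesis by (simp only: singleton_iff)
    qed
    then have "s = Inner (leaf_neighbour l' w)" using w by (auto simp: doubleton_eq_iff)
    moreover have "leaf_neighbour l' w = l'" using w step(1) by (auto simp: l'_def leaf_neighbour_Suc a_def)
    ultimately show ?thesis using s by simp
  qed (use z in simp)
  have disj: "\<pi> ` A \<inter> \<pi> ` B = {}"
  proof (rule ccontr)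
    assume "\<pi> ` A \<inter> \<pi> ` B \<noteq> {}"
    then obtain x y where xy: "x \<in> A" "y \<in> B" "\<pi> x = \<pi> y" by auto
    have "x \<noteq> y" using xy AB(3) by auto
    then have "\<pi> x = Leaf a" "\<pi> y = Leaf a" using xy(3) by (auto simp: \<pi>_def split: if_splits)
    then have "Inner l' \<in> A" "Inner l' \<in> B"
      using centre[OF AB(1) AB(4,5) step.prems(3) xy(1)] centre[OF AB(2) AB(6,7) step.prems(4) xy(2)] by auto
    then show False using AB(3) by auto
  qed
  have q: "quartet (T l) (Leaf (\<rho> i)) (Leaf (\<rho> j)) (Leaf (\<rho> k)) (Leaf (\<rho> k'))"
    unfolding quartet_def \<pi>_Leaf[symmetric]
    using conn[OF AB(1)] conn[OF AB(2)] disj AB(4-7) by blast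
  have cross: "\<rho> x \<noteq> \<rho> y" if "Leaf x \<in> A" "Leaf y \<in> B" for x y
    using disj that \<pi>_Leaf by (metis disjoint_iff imageI)
  have sym: "\<delta> x y = \<delta> y x" for x y using assms(1) by (simp add: tree_like_def)
  have l': "l' \<in> {4..n}" using step by (auto simp: l'_def)
  have tl: "\<delta> x l' - \<delta> x a = \<delta> y l' - \<delta> y a" if "x \<in> {1..l} - {a}" "y \<in> {1..l} - {a}" for x y
  proof -
    have "x \<in> {1..<l'} - {c l'}" "y \<in> {1..<l'} - {c l'}" using that by (auto simp: l'_def a_def)
    then show ?thesis using assms(1) l' unfolding tree_like_def a_def by blast
  qed
  obtain b where b: "b \<in> {1..l} - {a}"
  proof -
    have "(if a = 1 then 2 else 1) \<in> {1..l} - {a}" using step(1) by auto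
    then show thesis by (rule that)
  qed
  define y where "y = \<delta> b l' - \<delta> b a"
  have rec: "\<delta> x z = \<delta> (\<rho> x) (\<rho> z) + (if x = l' then y else 0) + (if z = l' then y else 0)"
    if xz: "\<rho> x \<noteq> \<rho> z" "x \<in> {1..l'}" "z \<in> {1..l'}" for x z
  proof -
    have new: "\<delta> x l' = \<delta> x a + y" if "x \<in> {1..l} - {a}" for x
      using tl[OF that b] by (simp add: y_def algebra_simps)
    consider "x \<noteq> l'" "z \<noteq> l'" | "x = l'" "z \<in> {1..l} - {a}" | "z = l'" "x \<in> {1..l} - {a}"
      using xz a by (auto simp: \<rho>_def l'_def split: if_splits)
    then show ?thesis
    proof cases
      case 1 then show ?thesis by (simp add: \<rho>_def)
    next
      case 2
      then have "z \<noteq> l'" by (auto simp: l'_def)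
      then show ?thesis using 2 new[OF 2(2)] sym[of l' z] sym[of a z] by (simp add: \<rho>_def)
    next
      case 3
      then have "x \<noteq> l'" by (auto simp: l'_def)
      then show ?thesis using 3 new[OF 3(2)] by (simp add: \<rho>_def)
    qed
  qed
  note recs = rec[OF cross[OF AB(4,6)]] rec[OF cross[OF AB(5,7)]] rec[OF cross[OF AB(4,7)]] rec[OF cross[OF AB(5,6)]]
  have expand: "\<delta> i k + \<delta> j k' = \<delta> i k' + \<delta> j k" if "\<delta> (\<rho> i) (\<rho> k) + \<delta> (\<rho> j) (\<rho> k') = \<delta> (\<rho> i) (\<rho> k') + \<delta> (\<rho> j) (\<rho> k)"
    using recs range that by (simp add: algebra_simps)
  show ?case
  proof (rule expand, cases "\<rho> i = \<rho> j \<or> \<rho> k = \<rho> k'")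
    case True
    then show "\<delta> (\<rho> i) (\<rho> k) + \<delta> (\<rho> j) (\<rho> k') = \<delta> (\<rho> i) (\<rho> k') + \<delta> (\<rho> j) (\<rho> k)"
      by (auto simp: add.commute)
  next
    case False
    then show "\<delta> (\<rho> i) (\<rho> k) + \<delta> (\<rho> j) (\<rho> k') = \<delta> (\<rho> i) (\<rho> k') + \<delta> (\<rho> j) (\<rho> k)"
      using step.IH[OF _ q] step.prems by auto
  qed
qed

text \<open>The cherry \<open>{c l, l}\<close> is separated from any two other leaves below \<open>l\<close>, also in the final tree.\<close>

lemma tree_likeI_quartet:
  assumes "\<And>i j. \<delta> i j = \<delta> j i"
    and "\<And>i j k k'. {i, j, k, k'} \<subseteq> {1..n} \<Longrightarrow> quartet (T n) (Leaf i) (Leaf j) (Leaf k) (Leaf k') \<Longrightarrow> i \<noteq> j \<Longrightarrow> k \<noteq> k' \<Longrightarrow>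
      \<delta> i k + \<delta> j k' = \<delta> i k' + \<delta> j k"
  shows "tree_like \<delta>"
  unfolding tree_like_def
proof (intro conjI allI ballI)
  fix l k k' assume *: "l \<in> {4..n}" "k \<in> {1..<l} - {c l}" "k' \<in> {1..<l} - {c l}"
  have a: "c l \<in> {1..<l}" using c_range * by auto
  show "\<delta> k l - \<delta> k (c l) = \<delta> k' l - \<delta> k' (c l)"
  proof (cases "k = k'")
    case False
    have "\<delta> (c l) k + \<delta> l k' = \<delta> (c l) k' + \<delta> l k"
      by (rule assms(2)[OF _ cherry_quartet_final]) (use * a False in auto)
    then show ?thesis using assms(1)[of "c l"] assms(1)[of l] by (simp add: algebra_simps)
  qed simp
qed (rule assms(1))

end

section \<open>Affine maps between valuations of isomorphic trees\<close>

definition leading_vec :: "nat \<Rightarrow> root list \<Rightarrow> nat \<Rightarrow> nat \<Rightarrow> int ^ 'd::{finite,linorder}" where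
  "leading_vec n S i j = exponent_vec (lead (bracket (psi_vectors n S) (i, j)))"

lemma unit_vec_times_matrix: "exponent_vec (single k 1) v* (M :: int ^ 'd::{finite,linorder} ^ 'd::{finite,linorder}) = M $ k"
proof -
  have "(\<Sum>i\<in>UNIV. M $ i $ j * exponent_vec (single k 1) $ i) = (\<Sum>i\<in>UNIV. if i = k then M $ i $ j else 0)" for j
    by (intro sum.cong refl) (auto simp: lookup_single when_def)
  then show ?thesis
    by (simp add: vector_matrix_mult_def Finite_Cartesian_Product.vec_eq_iff mult.commute)
qed

context iterated_roots begin

lemma leading_vec_val: "(leading_vec n S i j :: int ^ 'd::{finite,linorder}) = exponent_vec (val (i, j))"
  by (simp add: leading_vec_def val_def)

lemma cherry_leaf_eq: "l \<in> {3..n} \<Longrightarrow> cherry_leaf n S l = ia l"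
  by (simp add: cherry_leaf_def S_nth)

sublocale tree: cherry_tree n "cherry_leaf n S" "\<lambda>l. tree_aux n S (l - 3)"
proof
  fix l assume l: "3 \<le> l" "l < n"
  then have "Suc l - 3 = Suc (l - 3)" "l - 3 + 4 = Suc l" by auto
  then show "tree_aux n S (Suc l - 3) = attach_leaf (cherry_leaf n S (Suc l)) (Suc l) (tree_aux n S (l - 3))"
    by (simp only: tree_aux.simps)
next
  fix l assume "4 \<le> l" "l \<le> n"
  then show "cherry_leaf n S l \<in> {1..<l}" using cherry_leaf_eq[of l] ij[of l] by simp
qed simp

lemma leading_vec_sym: "(leading_vec n S i j :: int ^ 'd::{finite,linorder}) = leading_vec n S j i"
  by (simp add: leading_vec_val val_swap)

lemma leading_vec_y:
  "l \<in> {3..n} \<Longrightarrow> k \<in> {1..<l} \<Longrightarrow> k \<noteq> ia l \<Longrightarrow>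
    leading_vec n S k l = exponent_vec (single (yv l) 1) + leading_vec n S k (ia l)"
  by (simp add: leading_vec_val val_rec_y exponent_vec_add)

lemma leading_vec_z:
  "l \<in> {3..n} \<Longrightarrow> leading_vec n S (ia l) l = exponent_vec (single (zv l) 1) + leading_vec n S (ia l) (ja l)"
  by (simp add: leading_vec_val val_rec_z exponent_vec_add)

lemma leading_vec_tree_like: "tree.tree_like (leading_vec n S :: nat \<Rightarrow> nat \<Rightarrow> int ^ 'd::{finite,linorder})"
  unfolding tree.tree_like_def
proof (intro conjI allI ballI)
  show "(leading_vec n S i j :: int ^ 'd::{finite,linorder}) = leading_vec n S j i" for i j by (rule leading_vec_sym)
  fix l k k' assume l: "l \<in> {4..n}" and k: "k \<in> {1..<l} - {cherry_leaf n S l}" "k' \<in> {1..<l} - {cherry_leaf n S l}"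
  then have l3: "l \<in> {3..n}" by auto
  show "(leading_vec n S k l :: int ^ 'd::{finite,linorder}) - leading_vec n S k (cherry_leaf n S l)
      = leading_vec n S k' l - leading_vec n S k' (cherry_leaf n S l)"
    using k leading_vec_y[OF l3, of k] leading_vec_y[OF l3, of k'] by (simp add: cherry_leaf_eq[OF l3])
qed

text \<open>The unit vectors of \<open>y\<^sub>l\<close> and \<open>z\<^sub>l\<close> are \<open>v(b l) - v(b a)\<close> and \<open>v(a l) - v(a b)\<close>, so these rows are the
  only possible ones for a linear map that takes differences of \<open>v\<close> to differences of \<open>\<delta>\<close>.\<close>

definition transfer_matrix :: "(nat \<Rightarrow> nat \<Rightarrow> int ^ 'd::{finite,linorder}) \<Rightarrow> int ^ 'd::{finite,linorder} ^ 'd::{finite,linorder}" where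
  "transfer_matrix \<delta> = (\<chi> k. case root_at S k of (i, l) \<Rightarrow>
     if i = ia l then \<delta> (ja l) l - \<delta> (ja l) (ia l) else \<delta> (ia l) l - \<delta> (ia l) (ja l))"

lemma transfer_matrix_rows:
  assumes "l \<in> {3..n}"
  shows "transfer_matrix \<delta> $ yv l = \<delta> (ja l) l - \<delta> (ja l) (ia l)"
    "transfer_matrix \<delta> $ zv l = \<delta> (ia l) l - \<delta> (ia l) (ja l)"
  using ij[OF assms] by (auto simp: transfer_matrix_def root_at_yv[OF assms] root_at_zv[OF assms])

text \<open>Both sides satisfy the same recursion in the larger index; the matrix is built so that the
  increments agree for \<open>k = b\<close> and \<open>k = a\<close>, and being tree-like extends this to all \<open>k\<close>.\<close>

lemma tree_like_affine:
  assumes \<delta>: "tree.tree_like \<delta>" and "i \<in> {1..n}" "j \<in> {1..n}" "i \<noteq> j"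
  shows "leading_vec n S i j v* transfer_matrix \<delta> + \<delta> 1 2 = \<delta> i j"
proof -
  let ?M = "transfer_matrix \<delta>"
  have sym: "\<delta> x y = \<delta> y x" for x y using \<delta> by (simp add: tree.tree_like_def)
  have *: "leading_vec n S k l v* ?M + \<delta> 1 2 = \<delta> k l" if "(k, l) \<in> plucker_indices n" for k l
    using that
  proof (induction l arbitrary: k rule: less_induct)
    case (less l)
    have IH: "leading_vec n S x y v* ?M + \<delta> 1 2 = \<delta> x y" if "x \<in> {1..<l}" "y \<in> {1..<l}" "x \<noteq> y" for x y
    proof (cases "x < y")
      case True
      then show ?thesis using less.IH[of y x] that less.prems by (auto simp: plucker_indices_def)
    next
      case False
      then have "leading_vec n S y x v* ?M + \<delta> 1 2 = \<delta> y x"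
        using less.IH[of x y] that less.prems by (auto simp: plucker_indices_def)
      then show ?thesis by (simp add: sym[of x y] leading_vec_sym[of x y])
    qed
    from less.prems show ?case
    proof (cases rule: plucker_indices_cases)
      case 1
      have "leading_vec n S 1 2 = (0 :: int ^ 'd::{finite,linorder})"
        using val_12 by (simp add: leading_vec_val Finite_Cartesian_Product.vec_eq_iff)
      then show ?thesis using 1 by simp
    next
      case 2
      have "leading_vec n S (ia l) (ja l) v* ?M + \<delta> 1 2 = \<delta> (ia l) (ja l)"
        using IH[of "ia l" "ja l"] ij[OF 2(1)] by auto
      then show ?thesis
        by (simp add: 2(3) leading_vec_z[OF 2(1)] vector_matrix_left_distrib unit_vec_times_matrix[simplified]
            transfer_matrix_rows[OF 2(1)] add.assoc)
    next
      case 3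
      have IHk: "leading_vec n S k (ia l) v* ?M + \<delta> 1 2 = \<delta> k (ia l)"
        using IH[of k "ia l"] ij[OF 3(1)] 3 by auto
      have "\<delta> (ja l) l - \<delta> (ja l) (ia l) = \<delta> k l - \<delta> k (ia l)"
      proof (cases "l = 3")
        case True
        then have "k = ja l" using ij[OF 3(1)] 3 by auto
        then show ?thesis by simp
      next
        case False
        then have l4: "l \<in> {4..n}" using 3 by auto
        have "k \<in> {1..<l} - {cherry_leaf n S l}" "ja l \<in> {1..<l} - {cherry_leaf n S l}"
          using 3 ij[OF 3(1)] by (auto simp: cherry_leaf_eq[OF 3(1)])
        then show ?thesis using \<delta> l4 unfolding tree.tree_like_def cherry_leaf_eq[OF 3(1), symmetric] by blast
      qed
      then show ?thesis
        using IHk by (simp add: leading_vec_y[OF 3] vector_matrix_left_distrib unit_vec_times_matrix[simplified]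
            transfer_matrix_rows[OF 3(1)] add.assoc)
    qed
  qed
  show ?thesis
  proof (cases "i < j")
    case True
    then show ?thesis using *[of i j] assms by (auto simp: plucker_indices_def)
  next
    case False
    then have "leading_vec n S j i v* ?M + \<delta> 1 2 = \<delta> j i"
      using *[of j i] assms by (auto simp: plucker_indices_def)
    then show ?thesis by (simp add: sym[of i j] leading_vec_sym[of i j])
  qed
qed

lemma unit_vec_difference:
  obtains i j i' j' where "{i, j, i', j'} \<subseteq> {1..n}" "i \<noteq> j" "i' \<noteq> j'"
    "exponent_vec (single (k :: 'd) 1) = leading_vec n S i j - (leading_vec n S i' j' :: int ^ 'd::{finite,linorder})"
proof -
  obtain l where l: "l \<in> {3..n}" "k = yv l \<or> k = zv l" using UNIV_yz by blast
  note ijl = ij[OF l(1)]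
  from l(2) show thesis
  proof
    assume "k = yv l"
    then show thesis using leading_vec_y[OF l(1), of "ja l"] ijl l(1)
      by (intro that[of "ja l" l "ja l" "ia l"]) auto
  next
    assume "k = zv l"
    then show thesis using leading_vec_z[OF l(1)] ijl l(1)
      by (intro that[of "ia l" l "ia l" "ja l"]) auto
  qed
qed

end

text \<open>A leaf lies on one edge only, an inner vertex on at least two.\<close>

lemma leaf_image:
  assumes "cherry_tree n c T" "cherry_tree n c' T'" "3 \<le> n"
    and "bij_betw f (fst (T n)) (fst (T' n))" "(\<lambda>e. f ` e) ` snd (T n) = snd (T' n)" "i \<in> {1..n}"
  shows "\<exists>j\<in>{1..n}. f (Leaf i) = Leaf j"
proof (rule ccontr)
  assume neg: "\<not> ?thesis"
  interpret T: cherry_tree n c T by fact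
  interpret T': cherry_tree n c' T' by fact
  have "Leaf i \<in> fst (T n)" using assms(6) by (simp add: T.tree_structure[OF assms(3) order_refl])
  then have "f (Leaf i) \<in> fst (T' n)" using assms(4) by (rule bij_betw_apply[rotated])
  then obtain m where m: "m \<in> {3..n}" "f (Leaf i) = Inner m"
    using neg unfolding T'.tree_structure[OF assms(3) order_refl] by auto
  obtain e e' where e: "e \<in> snd (T' n)" "e' \<in> snd (T' n)" "e \<noteq> e'" "Inner m \<in> e" "Inner m \<in> e'"
    using T'.inner_degree[OF assms(3) order_refl m(1)] by blast
  have pre: "\<exists>d\<in>{d \<in> snd (T n). Leaf i \<in> d}. x = f ` d" if "x \<in> snd (T' n)" "Inner m \<in> x" for x
  proof -
    have "x \<in> (\<lambda>e. f ` e) ` snd (T n)" unfolding assms(5) by (rule that(1))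
    then obtain d where d: "d \<in> snd (T n)" "x = f ` d" by (rule imageE)
    have "f (Leaf i) \<in> f ` d" using that(2) m(2) d(2) by simp
    then obtain y where y: "y \<in> d" "f (Leaf i) = f y" by blast
    have "y \<in> fst (T n)" using T.edge_subset[OF assms(3) order_refl d(1)] y(1) by blast
    moreover have "inj_on f (fst (T n))" using assms(4) by (rule bij_betw_imp_inj_on)
    ultimately have "Leaf i = y" using inj_onD[of f "fst (T n)" "Leaf i" y] y(2) \<open>Leaf i \<in> fst (T n)\<close> by blast
    then show ?thesis using d y(1) by blast
  qed
  from pre[OF e(1,4)] pre[OF e(2,5)] show False
    unfolding T.leaf_degree[OF assms(3) order_refl assms(6)] using e(3) by simp
qed

lemma transfer_of_isomorphism:
  assumes 1: "iterated_roots TYPE('d::{finite,linorder}) n i1 j1 S1" and 2: "iterated_roots TYPE('d) n i2 j2 S2"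
    and f: "bij_betw f (fst (sequence_tree n S1)) (fst (sequence_tree n S2))"
      "(\<lambda>e. f ` e) ` snd (sequence_tree n S1) = snd (sequence_tree n S2)"
    and \<sigma>: "\<And>i. i \<in> {1..n} \<Longrightarrow> f (Leaf i) = Leaf (\<sigma> i) \<and> \<sigma> i \<in> {1..n}" "inj_on \<sigma> {1..n}"
  shows "\<exists>(M :: int ^ 'd::{finite,linorder} ^ 'd::{finite,linorder}) w. \<forall>i\<in>{1..n}. \<forall>j\<in>{1..n}. i \<noteq> j \<longrightarrow>
    leading_vec n S1 i j v* M + w = leading_vec n S2 (\<sigma> i) (\<sigma> j)"
proof -
  interpret R1: iterated_roots n i1 j1 S1 "TYPE('d)" by fact
  interpret R2: iterated_roots n i2 j2 S2 "TYPE('d)" by fact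
  define \<delta> where "\<delta> i j = (leading_vec n S2 (\<sigma> i) (\<sigma> j) :: int ^ 'd::{finite,linorder})" for i j
  have "R1.tree.tree_like \<delta>"
  proof (rule R1.tree.tree_likeI_quartet)
    show "\<delta> i j = \<delta> j i" for i j by (simp add: \<delta>_def R2.leading_vec_sym[of "\<sigma> i"])
    fix i j k k' assume r: "{i, j, k, k'} \<subseteq> {1..n}"
      and q: "quartet (tree_aux n S1 (n - 3)) (Leaf i) (Leaf j) (Leaf k) (Leaf k')" "i \<noteq> j" "k \<noteq> k'"
    have "quartet (tree_aux n S2 (n - 3)) (f (Leaf i)) (f (Leaf j)) (f (Leaf k)) (f (Leaf k'))"
      using quartet_isomorphism[OF f] q(1) by (simp add: sequence_tree_def)
    then have "quartet (tree_aux n S2 (n - 3)) (Leaf (\<sigma> i)) (Leaf (\<sigma> j)) (Leaf (\<sigma> k)) (Leaf (\<sigma> k'))"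
      using \<sigma>(1) r by simp
    moreover have "\<sigma> i \<noteq> \<sigma> j" "\<sigma> k \<noteq> \<sigma> k'" using \<sigma>(2) r q(2,3) by (auto dest: inj_onD)
    ultimately show "\<delta> i k + \<delta> j k' = \<delta> i k' + \<delta> j k"
      unfolding \<delta>_def
      by (intro R2.tree.tree_like_quartet[OF R2.leading_vec_tree_like R1.n3 order_refl]) auto
  qed
  from R1.tree_like_affine[OF this] show ?thesis
    by (intro exI[of _ "R1.transfer_matrix \<delta>"] exI[of _ "\<delta> 1 2"]) (simp add: \<delta>_def)
qed

text \<open>The composite of the two affine maps fixes all values, hence their differences, and these include
  the unit vectors.\<close>

lemma transfer_inverse:
  assumes 1: "iterated_roots TYPE('d::{finite,linorder}) n i1 j1 S1"
    and \<sigma>: "\<And>i. i \<in> {1..n} \<Longrightarrow> \<sigma> i \<in> {1..n} \<and> \<tau> (\<sigma> i) = i"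
    and M: "\<forall>i\<in>{1..n}. \<forall>j\<in>{1..n}. i \<noteq> j \<longrightarrow> leading_vec n S1 i j v* M + w = leading_vec n S2 (\<sigma> i) (\<sigma> j)"
    and N: "\<forall>i\<in>{1..n}. \<forall>j\<in>{1..n}. i \<noteq> j \<longrightarrow>
      leading_vec n S2 i j v* N + w' = (leading_vec n S1 (\<tau> i) (\<tau> j) :: int ^ 'd::{finite,linorder})"
  shows "M ** N = Finite_Cartesian_Product.mat 1"
proof -
  interpret R1: iterated_roots n i1 j1 S1 "TYPE('d)" by fact
  have "(M ** N) $ k = Finite_Cartesian_Product.mat 1 $ k" for k
  proof -
    obtain i j i' j' where ij: "{i, j, i', j'} \<subseteq> {1..n}" "i \<noteq> j" "i' \<noteq> j'"
      "exponent_vec (single k 1) = leading_vec n S1 i j - (leading_vec n S1 i' j' :: int ^ 'd::{finite,linorder})"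
      by (rule R1.unit_vec_difference)
    have comp: "(leading_vec n S1 x y v* M) v* N = leading_vec n S1 x y - w' - w v* N"
      if "x \<in> {1..n}" "y \<in> {1..n}" "x \<noteq> y" for x y
    proof -
      have "\<sigma> x \<noteq> \<sigma> y" using \<sigma>[OF that(1)] \<sigma>[OF that(2)] that(3) by metis
      then have "leading_vec n S2 (\<sigma> x) (\<sigma> y) v* N + w' = leading_vec n S1 x y"
        using N[rule_format, of "\<sigma> x" "\<sigma> y"] \<sigma>[OF that(1)] \<sigma>[OF that(2)] by simp
      then have "leading_vec n S1 x y v* M v* N + w v* N + w' = leading_vec n S1 x y"
        using M[rule_format, OF that] by (metis vector_matrix_left_distrib)
      then show ?thesis by (simp add: algebra_simps)
    qed
    have "(M ** N) $ k = (exponent_vec (single k 1) v* M) v* N"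
      by (simp add: vector_matrix_mul_assoc unit_vec_times_matrix[simplified])
    also have "\<dots> = leading_vec n S1 i j v* M v* N - leading_vec n S1 i' j' v* M v* N"
      unfolding ij(4) vector_matrix_mult_diff_distrib ..
    also have "\<dots> = exponent_vec (single k 1)"
      using comp[of i j] comp[of i' j'] ij by simp
    also have "\<dots> = Finite_Cartesian_Product.mat 1 $ k"
      by (simp add: Finite_Cartesian_Product.vec_eq_iff Finite_Cartesian_Product.mat_def lookup_single when_def)
    finally show ?thesis .
  qed
  then show ?thesis by (simp add: Finite_Cartesian_Product.vec_eq_iff)
qed

lemma real_vec_affine:
  "real_vec (x v* M + w) = real_vec x v* (\<chi> i j. of_int (M $ i $ j)) + real_vec w"
  by (simp add: real_vec_def vector_matrix_mult_def Finite_Cartesian_Product.vec_eq_iff)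

lemma convex_hull_affine_image:
  fixes A :: "real ^ 'd ^ 'd"
  shows "(\<lambda>x. x v* A + w) ` (convex hull X) = convex hull ((\<lambda>x. x v* A + w) ` X)"
proof -
  have lin: "linear (\<lambda>x. x v* A)"
    by (intro linearI) (auto simp: vector_matrix_left_distrib scaleR_vector_matrix_assoc)
  have "(\<lambda>x. x v* A + w) ` Y = (\<lambda>x. w + x) ` (\<lambda>x. x v* A) ` Y" for Y
    by (auto simp: image_image add.commute)
  then show ?thesis by (simp only: convex_hull_linear_image[OF lin] convex_hull_translation)
qed

lemma iterated_sequence_roots:
  assumes "iterated_sequence n S" "n \<ge> 3" "CARD('d::{finite,linorder}) = 2 * (n - 2)"
  obtains i j where "iterated_roots TYPE('d) n i j S"
proof -
  obtain i j where "\<forall>l\<in>{3..n}. i l \<in> {1..l-1} \<and> j l \<in> {1..l-1} \<and> i l \<noteq> j l"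
    "S = concat (map (\<lambda>l. [(i l, l), (j l, l)]) (rev [3..<Suc n]))"
    using assms(1) unfolding iterated_sequence_def by blast
  then have "iterated_roots TYPE('d) n i j S"
    by (intro iterated_roots.intro assms) fastforce+
  then show thesis by (rule that)
qed

theorem bodies_unimodularly_equivalent:
  assumes 1: "iterated_roots TYPE('d::{finite,linorder}) n i1 j1 S1" and 2: "iterated_roots TYPE('d) n i2 j2 S2"
    and iso: "graph_isomorphic (sequence_tree n S1) (sequence_tree n S2)"
  shows "unimodularly_equivalent (newton_okounkov_body n S1 :: (real ^ 'd::{finite,linorder}) set) (newton_okounkov_body n S2)"
proof -
  interpret R1: iterated_roots n i1 j1 S1 "TYPE('d)" by fact
  interpret R2: iterated_roots n i2 j2 S2 "TYPE('d)" by fact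
  note n3 = R1.n3
  obtain f where f: "bij_betw f (fst (sequence_tree n S1)) (fst (sequence_tree n S2))"
    "(\<lambda>e. f ` e) ` snd (sequence_tree n S1) = snd (sequence_tree n S2)"
    using iso by (auto simp: graph_isomorphic_def)
  have "\<forall>i\<in>{1..n}. \<exists>j\<in>{1..n}. f (Leaf i) = Leaf j"
    using leaf_image[OF R1.tree.cherry_tree_axioms R2.tree.cherry_tree_axioms n3] f by (simp add: sequence_tree_def)
  then obtain \<sigma> where \<sigma>: "\<And>i. i \<in> {1..n} \<Longrightarrow> f (Leaf i) = Leaf (\<sigma> i) \<and> \<sigma> i \<in> {1..n}" by metis
  have leaves: "Leaf i \<in> fst (sequence_tree n S1)" if "i \<in> {1..n}" for i
    using that by (simp add: sequence_tree_def R1.tree.tree_structure[OF n3 order_refl])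
  have inj: "inj_on \<sigma> {1..n}"
  proof (rule inj_onI)
    fix x y assume xy: "x \<in> {1..n}" "y \<in> {1..n}" "\<sigma> x = \<sigma> y"
    then have "f (Leaf x) = f (Leaf y)" using \<sigma>[OF xy(1)] \<sigma>[OF xy(2)] by simp
    then have "Leaf x = Leaf y"
      using inj_onD[OF bij_betw_imp_inj_on[OF f(1)]] leaves[OF xy(1)] leaves[OF xy(2)] by blast
    then show "x = y" by simp
  qed
  have surj: "\<sigma> ` {1..n} = {1..n}"
    using \<sigma> inj by (intro endo_inj_surj) auto
  define \<tau> where "\<tau> = inv_into {1..n} \<sigma>"
  have \<tau>\<sigma>: "\<tau> (\<sigma> i) = i" if "i \<in> {1..n}" for i using inj that by (simp add: \<tau>_def)
  have \<sigma>\<tau>: "\<sigma> (\<tau> i) = i" "\<tau> i \<in> {1..n}" if "i \<in> {1..n}" for i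
  proof -
    have "i \<in> \<sigma> ` {1..n}" unfolding surj by (rule that)
    then show "\<sigma> (\<tau> i) = i" "\<tau> i \<in> {1..n}" unfolding \<tau>_def by (rule f_inv_into_f, rule inv_into_into)
  qed
  define g where "g = inv_into (fst (sequence_tree n S1)) f"
  have g: "bij_betw g (fst (sequence_tree n S2)) (fst (sequence_tree n S1))"
    "(\<lambda>e. g ` e) ` snd (sequence_tree n S2) = snd (sequence_tree n S1)"
    unfolding g_def using R1.tree.edge_subset[OF n3 order_refl]
    by (intro graph_isomorphism_inverse[OF f]; simp add: sequence_tree_def)+
  have g\<tau>: "g (Leaf i) = Leaf (\<tau> i) \<and> \<tau> i \<in> {1..n}" if "i \<in> {1..n}" for i
  proof -
    have "f (Leaf (\<tau> i)) = Leaf i" using \<sigma>[OF \<sigma>\<tau>(2)[OF that]] \<sigma>\<tau>(1)[OF that] by simp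
    then have "g (Leaf i) = Leaf (\<tau> i)"
      unfolding g_def using inv_into_f_f[of f _ "Leaf (\<tau> i)"] f(1) leaves[OF \<sigma>\<tau>(2)[OF that]]
      by (metis bij_betw_def)
    then show ?thesis using \<sigma>\<tau>(2)[OF that] by simp
  qed
  have inj\<tau>: "inj_on \<tau> {1..n}" using \<sigma>\<tau>(1) by (metis inj_onI)
  have "\<exists>(M :: int ^ 'd::{finite,linorder} ^ 'd::{finite,linorder}) w. \<forall>i\<in>{1..n}. \<forall>j\<in>{1..n}. i \<noteq> j \<longrightarrow>
      leading_vec n S1 i j v* M + w = leading_vec n S2 (\<sigma> i) (\<sigma> j)"
    by (rule transfer_of_isomorphism[OF 1 2 f _ inj]) (rule \<sigma>)
  then obtain M :: "int ^ 'd::{finite,linorder} ^ 'd::{finite,linorder}" and w where M: "\<forall>i\<in>{1..n}. \<forall>j\<in>{1..n}. i \<noteq> j \<longrightarrow>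
      leading_vec n S1 i j v* M + w = leading_vec n S2 (\<sigma> i) (\<sigma> j)"
    by (elim exE)
  have "\<exists>(N :: int ^ 'd::{finite,linorder} ^ 'd::{finite,linorder}) w'. \<forall>i\<in>{1..n}. \<forall>j\<in>{1..n}. i \<noteq> j \<longrightarrow>
      leading_vec n S2 i j v* N + w' = leading_vec n S1 (\<tau> i) (\<tau> j)"
    by (rule transfer_of_isomorphism[OF 2 1 g _ inj\<tau>]) (rule g\<tau>)
  then obtain N :: "int ^ 'd::{finite,linorder} ^ 'd::{finite,linorder}" and w' where N: "\<forall>i\<in>{1..n}. \<forall>j\<in>{1..n}. i \<noteq> j \<longrightarrow>
      leading_vec n S2 i j v* N + w' = leading_vec n S1 (\<tau> i) (\<tau> j)"
    by (elim exE)
  have "M ** N = Finite_Cartesian_Product.mat 1" by (rule transfer_inverse[OF 1 _ M N]) (use \<sigma> \<tau>\<sigma> in auto)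
  moreover have "N ** M = Finite_Cartesian_Product.mat 1" by (rule transfer_inverse[OF 2 _ N M]) (use \<sigma>\<tau> in auto)
  ultimately have inv: "invertible M" unfolding invertible_def by blast
  define h where "h x = x v* (\<chi> i j. of_int (M $ i $ j)) + real_vec w" for x :: "real ^ 'd::{finite,linorder}"
  have lv: "R1.vertex (i, j) = real_vec (leading_vec n S1 i j)" "R2.vertex (i, j) = real_vec (leading_vec n S2 i j)" for i j
    by (simp_all add: R1.vertex_def R2.vertex_def R1.leading_vec_val R2.leading_vec_val)
  have hv: "h (R1.vertex (i, j)) = R2.vertex (\<sigma> i, \<sigma> j)" if "i \<in> {1..n}" "j \<in> {1..n}" "i \<noteq> j" for i j
    unfolding lv h_def real_vec_affine[symmetric] M[rule_format, OF that] ..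
  have "h ` R1.vertices = R2.vertices"
  proof (intro equalityI subsetI)
    fix x assume "x \<in> h ` R1.vertices"
    then obtain i j where ij: "(i, j) \<in> plucker_indices n" "x = h (R1.vertex (i, j))" by (auto simp: R1.vertices_def)
    then have r: "i \<in> {1..n}" "j \<in> {1..n}" "i \<noteq> j" by (auto simp: plucker_indices_def)
    then have "\<sigma> i \<noteq> \<sigma> j" using inj by (auto dest: inj_onD)
    then show "x \<in> R2.vertices"
      unfolding ij(2) hv[OF r] using \<sigma>[OF r(1)] \<sigma>[OF r(2)] by (intro R2.vertex_mem) auto
  next
    fix x assume "x \<in> R2.vertices"
    then obtain i j where ij: "(i, j) \<in> plucker_indices n" "x = R2.vertex (i, j)" by (auto simp: R2.vertices_def)
    then have r: "i \<in> {1..n}" "j \<in> {1..n}" "i \<noteq> j" by (auto simp: plucker_indices_def)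
    then have ne: "\<tau> i \<noteq> \<tau> j" using inj\<tau> by (auto dest: inj_onD)
    have "h (R1.vertex (\<tau> i, \<tau> j)) = x"
      using hv[OF \<sigma>\<tau>(2)[OF r(1)] \<sigma>\<tau>(2)[OF r(2)] ne] \<sigma>\<tau>(1) r ij(2) by simp
    moreover have "R1.vertex (\<tau> i, \<tau> j) \<in> R1.vertices" using \<sigma>\<tau>(2) r ne by (intro R1.vertex_mem) auto
    ultimately show "x \<in> h ` R1.vertices" by blast
  qed
  then have "newton_okounkov_body n S2 = h ` (newton_okounkov_body n S1 :: (real ^ 'd::{finite,linorder}) set)"
    unfolding R1.newton_okounkov_body_eq R2.newton_okounkov_body_eq h_def convex_hull_affine_image by simp
  then show ?thesis
    unfolding unimodularly_equivalent_def h_def using inv by blast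
qed

theorem corollary2:
  fixes n :: nat
  assumes "n \<ge> 3"
    and "CARD('d::{finite,linorder}) = 2 * (n - 2)"
  shows
    "(\<forall>S. iterated_sequence n S \<longrightarrow>
        (let \<Delta> = newton_okounkov_body n S :: (real ^ 'd::{finite,linorder}) set in
           polytope \<Delta> \<and>
           card {x. x extreme_point_of \<Delta>} = n choose 2 \<and>
           {x. x extreme_point_of \<Delta>} =
             {real_vec (valuation n S (plucker_coord n i j)) | i j. 1 \<le> i \<and> i < j \<and> j \<le> n} \<and>
           interior \<Delta> \<inter> lattice_points = {} \<and>
           \<Delta> \<subseteq> hypercube)) \<and>
     (\<forall>S1 S2. iterated_sequence n S1 \<longrightarrow> iterated_sequence n S2 \<longrightarrow> S1 \<noteq> S2 \<longrightarrow>
        graph_isomorphic (sequence_tree n S1) (sequence_tree n S2) \<longrightarrow>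
        unimodularly_equivalent
          (newton_okounkov_body n S1 :: (real ^ 'd::{finite,linorder}) set) (newton_okounkov_body n S2))"
proof (intro conjI allI impI)
  fix S assume "iterated_sequence n S"
  then obtain i j where "iterated_roots TYPE('d) n i j S"
    by (rule iterated_sequence_roots[OF _ assms])
  then interpret R: iterated_roots n i j S "TYPE('d)" .
  have ext: "{x. x extreme_point_of (convex hull R.vertices)} = R.vertices"
    using R.finite_vertices R.vertex_01 by (rule extreme_points_of_01_hull)
  have "interior (convex hull R.vertices) \<subseteq> interior hypercube"
    by (rule interior_mono[OF R.hull_vertices_subset_hypercube])
  then have "interior (convex hull R.vertices) \<inter> lattice_points = {}"
    using interior_hypercube_no_lattice_points by blast
  then show "let \<Delta> = newton_okounkov_body n S :: (real ^ 'd::{finite,linorder}) set in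
           polytope \<Delta> \<and>
           card {x. x extreme_point_of \<Delta>} = n choose 2 \<and>
           {x. x extreme_point_of \<Delta>} =
             {real_vec (valuation n S (plucker_coord n i j)) | i j. 1 \<le> i \<and> i < j \<and> j \<le> n} \<and>
           interior \<Delta> \<inter> lattice_points = {} \<and>
           \<Delta> \<subseteq> hypercube"
    unfolding Let_def R.newton_okounkov_body_eq ext R.vertices_eq[symmetric]
    using R.finite_vertices R.card_vertices R.hull_vertices_subset_hypercube
    by (auto simp: polytope_def)
next
  fix S1 S2
  assume "iterated_sequence n S1" "iterated_sequence n S2"
    "graph_isomorphic (sequence_tree n S1) (sequence_tree n S2)"
  then show "unimodularly_equivalent
          (newton_okounkov_body n S1 :: (real ^ 'd::{finite,linorder}) set) (newton_okounkov_body n S2)"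
    by (meson iterated_sequence_roots[OF _ assms] bodies_unimodularly_equivalent)
qed

end
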